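(* The problem C-$\langle \mathcal{K}_r \rightarrow \mathcal{T}_s \rangle$ is in $\mathsf{P}$: when the virtual graph is a clique and the substrate graph is a tree, a minimum-cost feasible mapping (or the fact that none exists) can be computed in time $\mathcal{O}(n_r^2 n_s)$.
   Context: Uniform-demand Virtual Network Embedding (uniVNE). An instance consists of a virtual graph $\mathcal{G}_r=(V_r,E_r)$ (undirected, simple, connected, $n_r=|V_r|$ nodes) and a substrate graph $\mathcal{G}_s=(V_s,E_s)$ (undirected, simple, connected, $n_s=|V_s|$ nodes) with capacities $c(u)\in\mathbb{N}^+$ for $u\in V_s$ and $c(e)\in\mathbb{N}^+$ for $e\in E_s$. A mapping is a pair $m=(m_V,m_E)$ where $m_V:V_r\to V_s$ and $m_E$ assigns to each virtual edge $(\bar u,\bar v)\in E_r$ a loop-free path of $\mathcal{G}_s$ connecting $m_V(\bar u)$ and $m_V(\bar v)$ (the empty path if these coincide). The mapping is feasible if every $u\in V_s$ satisfies $|m_V^{-1}(u)|\le c(u)$ and every $e\in E_s$ belongs to at most $c(e)$ of the paths $m_E(\bar e)$. In C-uniVNE one is additionally given nonnegative integer costs $w(u)$, $u\in V_s$, and $w(e)$, $e\in E_s$ (and a budget $\Gamma$); the cost of $m$ is $\sum_{\bar u\in V_r} w(m_V(\bar u))+\sum_{\bar e\in E_r}\sum_{e\in m_E(\bar e)} w(e)$, and the task is to decide whether a feasible mapping of cost at most $\Gamma$ exists, equivalently to find a minimum-cost feasible mapping. *)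

theory Defs
  imports "HOL-Library.Log_Nat" "HOL-Computational_Algebra.Polynomial"
begin

section \<open>Graphs\<close>

definition simple_graph :: "'a set \<Rightarrow> 'a set set \<Rightarrow> bool" where
  "simple_graph V E \<longleftrightarrow> finite V \<and> (\<forall>e\<in>E. e \<subseteq> V \<and> card e = 2)"

text \<open>A loop-free path is given by its sequence of vertices. The path without edges
  at a vertex \<open>u\<close> is the list \<open>[u]\<close>.\<close>

definition is_path :: "'a set \<Rightarrow> 'a set set \<Rightarrow> 'a list \<Rightarrow> bool" where
  "is_path V E p \<longleftrightarrow>
     p \<noteq> [] \<and> distinct p \<and> set p \<subseteq> V \<and> (\<forall>i. Suc i < length p \<longrightarrow> {p ! i, p ! Suc i} \<in> E)"

definition path_edges :: "'a list \<Rightarrow> 'a set set" where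
  "path_edges p = {{p ! i, p ! Suc i} | i. Suc i < length p}"

definition graph_connected :: "'a set \<Rightarrow> 'a set set \<Rightarrow> bool" where
  "graph_connected V E \<longleftrightarrow>
     V \<noteq> {} \<and> (\<forall>u\<in>V. \<forall>v\<in>V. \<exists>p. is_path V E p \<and> hd p = u \<and> last p = v)"

definition is_cycle :: "'a set \<Rightarrow> 'a set set \<Rightarrow> 'a list \<Rightarrow> bool" where
  "is_cycle V E p \<longleftrightarrow> length p \<ge> 3 \<and> is_path V E p \<and> {last p, hd p} \<in> E"

definition is_clique :: "'a set \<Rightarrow> 'a set set \<Rightarrow> bool" where
  "is_clique V E \<longleftrightarrow> simple_graph V E \<and> (\<forall>u\<in>V. \<forall>v\<in>V. u \<noteq> v \<longrightarrow> {u, v} \<in> E)"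

definition is_tree :: "'a set \<Rightarrow> 'a set set \<Rightarrow> bool" where
  "is_tree V E \<longleftrightarrow> simple_graph V E \<and> graph_connected V E \<and> (\<nexists>p. is_cycle V E p)"


section \<open>Uniform-demand virtual network embedding\<close>

record ('r, 's) uniVNE =
  VR :: "'r set"
  ER :: "'r set set"
  VS :: "'s set"
  ES :: "'s set set"
  node_cap :: "'s \<Rightarrow> nat"
  edge_cap :: "'s set \<Rightarrow> nat"
  node_cost :: "'s \<Rightarrow> nat"
  edge_cost :: "'s set \<Rightarrow> nat"

definition uniVNE_instance :: "('r, 's) uniVNE \<Rightarrow> bool" where
  "uniVNE_instance I \<longleftrightarrow>
     simple_graph (VR I) (ER I) \<and> graph_connected (VR I) (ER I) \<and>
     simple_graph (VS I) (ES I) \<and> graph_connected (VS I) (ES I) \<and>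
     (\<forall>u\<in>VS I. node_cap I u > 0) \<and> (\<forall>e\<in>ES I. edge_cap I e > 0)"

type_synonym ('r, 's) vne_mapping = "('r \<Rightarrow> 's) \<times> ('r set \<Rightarrow> 's list)"

text \<open>For a virtual edge \<open>e = {a, b}\<close> the path \<open>m\<^sub>E e\<close> may be listed in either direction,
  whence the condition on the unordered pair of its end points.\<close>

definition is_mapping :: "('r, 's) uniVNE \<Rightarrow> ('r, 's) vne_mapping \<Rightarrow> bool" where
  "is_mapping I = (\<lambda>(m\<^sub>V, m\<^sub>E).
     (\<forall>a\<in>VR I. m\<^sub>V a \<in> VS I) \<and>
     (\<forall>e\<in>ER I. is_path (VS I) (ES I) (m\<^sub>E e) \<and> {hd (m\<^sub>E e), last (m\<^sub>E e)} = m\<^sub>V ` e))"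

definition feasible :: "('r, 's) uniVNE \<Rightarrow> ('r, 's) vne_mapping \<Rightarrow> bool" where
  "feasible I = (\<lambda>(m\<^sub>V, m\<^sub>E).
     is_mapping I (m\<^sub>V, m\<^sub>E) \<and>
     (\<forall>u\<in>VS I. card {a \<in> VR I. m\<^sub>V a = u} \<le> node_cap I u) \<and>
     (\<forall>e\<in>ES I. card {f \<in> ER I. e \<in> path_edges (m\<^sub>E f)} \<le> edge_cap I e))"

definition mapping_cost :: "('r, 's) uniVNE \<Rightarrow> ('r, 's) vne_mapping \<Rightarrow> nat" where
  "mapping_cost I = (\<lambda>(m\<^sub>V, m\<^sub>E).
     (\<Sum>a\<in>VR I. node_cost I (m\<^sub>V a)) + (\<Sum>f\<in>ER I. \<Sum>e\<in>path_edges (m\<^sub>E f). edge_cost I e))"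

definition min_cost_feasible :: "('r, 's) uniVNE \<Rightarrow> ('r, 's) vne_mapping \<Rightarrow> bool" where
  "min_cost_feasible I m \<longleftrightarrow>
     feasible I m \<and> (\<forall>m'. feasible I m' \<longrightarrow> mapping_cost I m \<le> mapping_cost I m')"


section \<open>Random access machines\<close>

text \<open>
  A random access machine with a one-way input tape, a one-way output tape and
  registers holding natural numbers. The only arithmetic operations are addition and
  truncated subtraction (and no multiplication), so that a number produced in \<open>t\<close> steps
  is at most \<open>t\<close> bits longer than the numbers in the input and in the program.

  Operands are register addresses, except for the literal \<open>n\<close> in \<open>Const r n\<close> and the
  jump targets. \<open>Load\<close> and \<open>Store\<close> address indirectly. The machine halts when the program counter
  leaves the program.
\<close>

datatype instr =
    Const nat nat
  | Move nat nat
  | Add nat nat nat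
  | Sub nat nat nat
  | Load nat nat
  | Store nat nat
  | Jump nat
  | JZero nat nat
  | JEof nat
  | Read nat
  | Write nat

record ram =
  pc :: nat
  mem :: "nat \<Rightarrow> nat"
  inp :: "nat list"
  out :: "nat list"

definition set_reg :: "nat \<Rightarrow> nat \<Rightarrow> ram \<Rightarrow> ram" where
  "set_reg r n s = s\<lparr>pc := Suc (pc s), mem := (mem s)(r := n)\<rparr>"

definition next_input :: "ram \<Rightarrow> nat" where
  "next_input s = (case inp s of [] \<Rightarrow> 0 | x # _ \<Rightarrow> x)"

fun exec :: "instr \<Rightarrow> ram \<Rightarrow> ram" where
  "exec (Const r n) s = set_reg r n s"
| "exec (Move r a) s = set_reg r (mem s a) s"
| "exec (Add r a b) s = set_reg r (mem s a + mem s b) s"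
| "exec (Sub r a b) s = set_reg r (mem s a - mem s b) s"
| "exec (Load r a) s = set_reg r (mem s (mem s a)) s"
| "exec (Store r a) s = set_reg (mem s r) (mem s a) s"
| "exec (Jump l) s = s\<lparr>pc := l\<rparr>"
| "exec (JZero r l) s = s\<lparr>pc := (if mem s r = 0 then l else Suc (pc s))\<rparr>"
| "exec (JEof l) s = s\<lparr>pc := (if inp s = [] then l else Suc (pc s))\<rparr>"
| "exec (Read r) s = (set_reg r (next_input s) s)\<lparr>inp := tl (inp s)\<rparr>"
| "exec (Write r) s = s\<lparr>pc := Suc (pc s), out := out s @ [mem s r]\<rparr>"

definition halted :: "instr list \<Rightarrow> ram \<Rightarrow> bool" where
  "halted P s \<longleftrightarrow> pc s \<ge> length P"

definition step :: "instr list \<Rightarrow> ram \<Rightarrow> ram" where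
  "step P s = (if halted P s then s else exec (P ! pc s) s)"

definition initial :: "nat list \<Rightarrow> ram" where
  "initial xs = \<lparr>pc = 0, mem = (\<lambda>_. 0), inp = xs, out = []\<rparr>"

definition run :: "instr list \<Rightarrow> nat list \<Rightarrow> nat \<Rightarrow> ram" where
  "run P xs t = (step P ^^ t) (initial xs)"

text \<open>Halted states are fixed points of \<^const>\<open>step\<close>, so \<open>t\<close> is an upper bound on the number of
  steps, that is, on the running time under the uniform cost criterion.\<close>

definition computes_within :: "instr list \<Rightarrow> nat list \<Rightarrow> nat \<Rightarrow> nat list \<Rightarrow> bool" where
  "computes_within P xs t ys \<longleftrightarrow> halted P (run P xs t) \<and> out (run P xs t) = ys"

text \<open>The logarithmic cost criterion charges every instruction the length in binary of all
  register addresses and numbers it handles.\<close>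

definition bits :: "nat \<Rightarrow> nat" where
  "bits n = max 1 (floorlog 2 n)"

fun instr_cost :: "instr \<Rightarrow> ram \<Rightarrow> nat" where
  "instr_cost (Const r n) s = 1 + bits r + bits n"
| "instr_cost (Move r a) s = 1 + bits r + bits a + bits (mem s a)"
| "instr_cost (Add r a b) s =
     1 + bits r + bits a + bits (mem s a) + bits b + bits (mem s b)"
| "instr_cost (Sub r a b) s =
     1 + bits r + bits a + bits (mem s a) + bits b + bits (mem s b)"
| "instr_cost (Load r a) s = 1 + bits r + bits a + bits (mem s a) + bits (mem s (mem s a))"
| "instr_cost (Store r a) s = 1 + bits r + bits (mem s r) + bits a + bits (mem s a)"
| "instr_cost (Jump l) s = 1"
| "instr_cost (JZero r l) s = 1 + bits r + bits (mem s r)"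
| "instr_cost (JEof l) s = 1"
| "instr_cost (Read r) s = 1 + bits r + bits (next_input s)"
| "instr_cost (Write r) s = 1 + bits r + bits (mem s r)"

definition step_cost :: "instr list \<Rightarrow> ram \<Rightarrow> nat" where
  "step_cost P s = (if halted P s then 0 else instr_cost (P ! pc s) s)"

definition log_cost :: "instr list \<Rightarrow> nat list \<Rightarrow> nat \<Rightarrow> nat" where
  "log_cost P xs t = (\<Sum>i<t. step_cost P (run P xs i))"

definition input_size :: "nat list \<Rightarrow> nat" where
  "input_size xs = (\<Sum>x\<leftarrow>xs. bits x)"

text \<open>The class P, for languages of finite sequences of numbers written in binary: polynomial
  logarithmic cost on a random access machine is the same as polynomial time on a
  Turing machine. The machine has to decide membership for every input, including inputs that do
  not encode an instance.\<close>

definition class_P :: "nat list set set" where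
  "class_P = {L. \<exists>P (q :: nat poly). \<forall>xs. \<exists>t.
      computes_within P xs t [if xs \<in> L then 1 else 0] \<and>
      log_cost P xs t \<le> poly q (input_size xs)}"


section \<open>Encoding of instances and mappings\<close>

definition edge_pair :: "'a \<times> 'a \<Rightarrow> 'a set" where
  "edge_pair = (\<lambda>(u, v). {u, v})"

definition lists_edges :: "('a \<times> 'a) list \<Rightarrow> 'a set set \<Rightarrow> bool" where
  "lists_edges es E \<longleftrightarrow> distinct (map edge_pair es) \<and> edge_pair ` set es = E"

definition adjacency_matrix :: "nat \<Rightarrow> nat set set \<Rightarrow> nat list" where
  "adjacency_matrix n E = concat (map (\<lambda>i. map (\<lambda>j. if {i, j} \<in> E then 1 else 0) [0..<n]) [0..<n])"

text \<open>The virtual graph is given by its adjacency matrix; the substrate graph by the capacities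
  and costs of its nodes, followed by a list of its edges with their capacities and costs. The
  order of the edges and of the two end points of an edge is arbitrary.\<close>

definition encodes_instance :: "(nat, nat) uniVNE \<Rightarrow> nat list \<Rightarrow> bool" where
  "encodes_instance I xs \<longleftrightarrow> (\<exists>n\<^sub>r n\<^sub>s es.
     VR I = {..<n\<^sub>r} \<and> VS I = {..<n\<^sub>s} \<and> lists_edges es (ES I) \<and>
     xs = n\<^sub>r # adjacency_matrix n\<^sub>r (ER I) @
          n\<^sub>s # concat (map (\<lambda>u. [node_cap I u, node_cost I u]) [0..<n\<^sub>s]) @
          length es # concat (map (\<lambda>(u, v). [u, v, edge_cap I {u, v}, edge_cost I {u, v}]) es))"

text \<open>A mapping is written as the images of the virtual nodes, followed by one block for every
  virtual edge, consisting of its end points, the number of vertices of its path, and the path.\<close>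

definition encodes_mapping :: "(nat, nat) uniVNE \<Rightarrow> (nat, nat) vne_mapping \<Rightarrow> nat list \<Rightarrow> bool" where
  "encodes_mapping I = (\<lambda>(m\<^sub>V, m\<^sub>E) ys. \<exists>fs.
     lists_edges fs (ER I) \<and>
     ys = map m\<^sub>V [0..<card (VR I)] @
          concat (map (\<lambda>(a, b). [a, b, length (m\<^sub>E {a, b})] @ m\<^sub>E {a, b}) fs))"

text \<open>The decision problem C-uniVNE, restricted to virtual graphs of the class \<open>R\<close> and substrate
  graphs of the class \<open>S\<close>; \<open>\<Gamma>\<close> is the budget.\<close>

definition C_uniVNE ::
  "(nat set \<Rightarrow> nat set set \<Rightarrow> bool) \<Rightarrow> (nat set \<Rightarrow> nat set set \<Rightarrow> bool) \<Rightarrow> nat list set" where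
  "C_uniVNE R S = {\<Gamma> # xs | \<Gamma> xs. \<exists>I.
     uniVNE_instance I \<and> R (VR I) (ER I) \<and> S (VS I) (ES I) \<and> encodes_instance I xs \<and>
     (\<exists>m. feasible I m \<and> mapping_cost I m \<le> \<Gamma>)}"

text \<open>Solving the optimisation problem means writing 0 if there is no feasible mapping, and
  otherwise 1 followed by a feasible mapping of minimum cost.\<close>

definition is_solution :: "(nat, nat) uniVNE \<Rightarrow> nat list \<Rightarrow> bool" where
  "is_solution I ys \<longleftrightarrow>
     (if \<exists>m. feasible I m
      then \<exists>m zs. min_cost_feasible I m \<and> encodes_mapping I m zs \<and> ys = 1 # zs
      else ys = [0])"

end

theory Submission
  imports Defs "HOL-Library.Extended_Nat"
begin

text \<open>
  In a tree, a loop-free path uses the edge \<open>e\<close> if and only if its end points lie on different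
  sides of \<open>e\<close>. When the virtual graph is a clique on \<open>n\<close> nodes and \<open>k\<close> of them are placed below
  \<open>e\<close>, exactly \<open>k * (n - k)\<close> paths use \<open>e\<close>, however they are chosen. Hence feasibility and cost depend
  only on how many virtual nodes every substrate node receives, and the minimum cost of placing \<open>k\<close>
  virtual nodes in a subtree is computed by dynamic programming: merging the table of a
  child into the table of its parent is a (min, +)-convolution, which takes time quadratic in \<open>n\<close> and
  happens once for every substrate edge.

  To find the order of the merges in linear time from an unsorted list of edges, keep for every
  vertex its degree and the sum of the positions of its incident edges among the vertices that
  remain. For a leaf this sum is the position of its only edge, so that leaves other than the root 0
  can be eliminated one after the other without adjacency lists. The elimination
  gets stuck precisely if the edges do not form a tree.

  The paths of an optimal mapping are found by going through the elimination order once: the current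
  end points of the two halves of the path move to their parents when they are eliminated,
  until they meet.
\<close>

section \<open>Leaf elimination in trees\<close>

text \<open>Two demands beyond the combinatorics shape the development. The bound is claimed for a
  concrete machine without multiplication, so every product that the algorithm needs
  (\<open>n * n\<close>, row offsets, \<open>k * (n - k)\<close>, multiples of a cost) is
  accumulated by additions inside loops that fit into the budget of order \<open>n * n * m\<close>;
  the program is written in a small structured language whose timed semantics is related to machine
  steps once, up to a factor depending on the program only. And membership in P requires an answer
  on every sequence of numbers, so the input is validated before it is used: the tree property is
  not presupposed but certified by a completed elimination, and the facts about contraction and
  paths are derived from such an elimination alone. For a valid instance of length \<open>L\<close>
  one has \<open>L + 1 = n * n + 6 * m\<close>, whence \<open>n * n * m\<close> is at most quadratic
  in the length, while the numbers themselves gain at most one bit per machine step.\<close>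

definition leaf_seq :: "nat set \<Rightarrow> nat set set \<Rightarrow> (nat \<Rightarrow> nat) \<Rightarrow> (nat \<Rightarrow> nat) \<Rightarrow> nat \<Rightarrow> bool" where
  "leaf_seq V E Q par H \<longleftrightarrow> (\<forall>h<H. Q h \<in> V - {0} - Q ` {..<h} \<and>
     {y \<in> V - Q ` {..<h}. {Q h, y} \<in> E} = {par (Q h)})"

lemma leaf_seqD:
  assumes "leaf_seq V E Q par H" "h < H"
  shows "Q h \<in> V" "Q h \<noteq> 0" "Q h \<notin> Q ` {..<h}"
    "par (Q h) \<in> V" "par (Q h) \<notin> Q ` {..<h}" "{Q h, par (Q h)} \<in> E"
    "y \<in> V \<Longrightarrow> y \<notin> Q ` {..<h} \<Longrightarrow> {Q h, y} \<in> E \<Longrightarrow> y = par (Q h)"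
  using assms unfolding leaf_seq_def by auto

lemma leaf_seq_inj: "leaf_seq V E Q par H \<Longrightarrow> inj_on Q {..<H}"
proof (rule linorder_inj_onI)
  fix h h' assume "leaf_seq V E Q par H" "h < h'" "h' \<in> {..<H}"
  then show "Q h \<noteq> Q h'" using leaf_seqD(3)[of V E Q par H h'] by (metis imageI lessThan_iff)
qed auto

lemma root_not_eliminated: "leaf_seq V E Q par H \<Longrightarrow> 0 \<notin> Q ` {..<H}"
  using leaf_seqD(2) by force

lemma simple_graphD:
  assumes "simple_graph V E" "{u, v} \<in> E"
  shows "u \<in> V" "v \<in> V" "u \<noteq> v"
  using assms unfolding simple_graph_def by fastforce+

text \<open>Serves to pick the vertex that is eliminated first among those of a path, an edge or a
  cycle; all its neighbours there still remain at that time.\<close>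

lemma first_index:
  assumes "\<exists>h. h < (H::nat) \<and> P h"
  obtains h where "h < H" "P h" "\<And>h'. h' < h \<Longrightarrow> \<not> P h'"
proof -
  have "(LEAST h. h < H \<and> P h) < H \<and> P (LEAST h. h < H \<and> P h)"
    using assms by (rule LeastI_ex)
  moreover have "\<not> P h'" if "h' < (LEAST h. h < H \<and> P h)" for h'
    using not_less_Least[OF that] calculation that by simp
  ultimately show ?thesis using that by blast
qed

text \<open>The vertex eliminated first on a path between remaining vertices would have both its
  neighbours on the path equal to its only remaining neighbour.\<close>

lemma path_in_remaining:
  assumes ls: "leaf_seq V E Q par H" and p: "is_path V E p"
    and ends: "hd p \<notin> Q ` {..<H}" "last p \<notin> Q ` {..<H}"
  shows "set p \<inter> Q ` {..<H} = {}"
proof (rule ccontr)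
  assume "set p \<inter> Q ` {..<H} \<noteq> {}"
  then have "\<exists>h. h < H \<and> Q h \<in> set p" by auto
  then obtain h where h: "h < H" "Q h \<in> set p" and min: "\<And>h'. h' < h \<Longrightarrow> Q h' \<notin> set p"
    using first_index[of H "\<lambda>h. Q h \<in> set p"] by metis
  obtain i where i: "i < length p" "p ! i = Q h" using h(2) by (metis in_set_conv_nth)
  have pV: "p \<noteq> []" "distinct p" "set p \<subseteq> V" "\<And>i. Suc i < length p \<Longrightarrow> {p ! i, p ! Suc i} \<in> E"
    using p by (auto simp: is_path_def)
  have "i \<noteq> 0" using i ends(1) h(1) pV(1) by (auto simp: hd_conv_nth)
  have "i \<noteq> length p - 1" using i ends(2) h(1) pV(1) by (auto simp: last_conv_nth)
  with i have i2: "Suc i < length p" by simp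
  have nb: "p ! j = par (Q h)" if "j < length p" "{Q h, p ! j} \<in> E" for j
    using leaf_seqD(7)[OF ls h(1), of "p ! j"] that pV(3) min
    by (metis image_iff lessThan_iff nth_mem subsetD)
  have "p ! Suc i = par (Q h)" using nb[of "Suc i"] pV(4)[OF i2] i i2 by simp
  moreover have "p ! (i - 1) = par (Q h)"
    using nb[of "i - 1"] pV(4)[of "i - 1"] i \<open>i \<noteq> 0\<close> by (simp add: insert_commute)
  ultimately have "Suc i = i - 1"
    using pV(2) i2 by (metis nth_eq_iff_index_eq less_imp_diff_less i(1))
  then show False by simp
qed

text \<open>The remaining vertices thus always induce a connected subgraph, which is what lets the
  elimination of a tree go on until only the root is left.\<close>

lemma remaining_path:
  assumes "graph_connected V E" "leaf_seq V E Q par H"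
    and "u \<in> V - Q ` {..<H}" "v \<in> V - Q ` {..<H}"
  obtains p where "is_path V E p" "hd p = u" "last p = v" "set p \<subseteq> V - Q ` {..<H}"
proof -
  obtain p where p: "is_path V E p" "hd p = u" "last p = v"
    using assms unfolding graph_connected_def by blast
  have "set p \<inter> Q ` {..<H} = {}"
    using path_in_remaining[OF assms(2) p(1)] p assms(3,4) by auto
  moreover have "set p \<subseteq> V" using p(1) by (simp add: is_path_def)
  ultimately have "set p \<subseteq> V - Q ` {..<H}" by blast
  then show ?thesis using that p by blast
qed

text \<open>The second vertex of a remaining path from \<open>z\<close> to the root. It excludes
  that a waiting vertex of a tree ever has degree 0.\<close>

lemma remaining_neighbour:
  assumes "graph_connected V E" "leaf_seq V E Q par H" "0 \<in> V"
    and "z \<in> V - Q ` {..<H}" "z \<noteq> 0"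
  shows "\<exists>y\<in>V - Q ` {..<H}. {z, y} \<in> E"
proof -
  have 0: "0 \<in> V - Q ` {..<H}" using assms(3) root_not_eliminated[OF assms(2)] by simp
  obtain p where p: "is_path V E p" "hd p = z" "last p = 0" "set p \<subseteq> V - Q ` {..<H}"
    by (rule remaining_path[OF assms(1,2,4) 0])
  have "p \<noteq> []" using p(1) by (simp add: is_path_def)
  moreover have "p \<noteq> [x]" for x using p(2,3) assms(5) by auto
  ultimately obtain y q where pq: "p = z # y # q" using p(2) by (cases p; cases "tl p") auto
  have "{p ! 0, p ! Suc 0} \<in> E" using p(1) unfolding is_path_def pq by (metis length_Cons Suc_less_eq zero_less_Suc)
  then have "{z, y} \<in> E" by (simp add: pq)
  moreover have "y \<in> V - Q ` {..<H}" using p(4) unfolding pq by (meson list.set_intros subsetD)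
  ultimately show ?thesis by blast
qed

lemma is_path_append1:
  assumes "is_path V E p" "y \<in> V" "y \<notin> set p" "{last p, y} \<in> E"
  shows "is_path V E (p @ [y])"
  unfolding is_path_def
proof (intro conjI allI impI)
  fix i assume "Suc i < length (p @ [y])"
  then consider "Suc i < length p" | "Suc i = length p" by fastforce
  then show "{(p @ [y]) ! i, (p @ [y]) ! Suc i} \<in> E"
  proof cases
    case 2
    then have "i = length p - 1" "i < length p" by simp_all
    then show ?thesis using assms 2 by (auto simp: nth_append last_conv_nth is_path_def)
  qed (use assms in \<open>auto simp: nth_append is_path_def\<close>)
qed (use assms in \<open>auto simp: is_path_def\<close>)

lemma is_path_drop:
  "is_path V E p \<Longrightarrow> j < length p \<Longrightarrow> is_path V E (drop j p)"
  unfolding is_path_def using set_drop_subset[of j p] by (auto simp: add.commute[of j])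

text \<open>The last vertex of a longest path from the root is a leaf.\<close>

lemma leaf_exists:
  assumes tree: "is_tree V E" and ls: "leaf_seq V E Q par H" and "0 \<in> V"
    and z0: "z0 \<in> V - Q ` {..<H}" "z0 \<noteq> 0"
  shows "\<exists>z y. z \<in> V - Q ` {..<H} \<and> z \<noteq> 0 \<and> {y \<in> V - Q ` {..<H}. {z, y} \<in> E} = {y}"
proof -
  let ?R = "V - Q ` {..<H}"
  have sg: "simple_graph V E" and con: "graph_connected V E" and cyc: "\<nexists>p. is_cycle V E p"
    using tree by (auto simp: is_tree_def)
  have fin: "finite V" using sg by (simp add: simple_graph_def)
  have 0: "0 \<in> ?R" using assms(3) root_not_eliminated[OF ls] by simp
  define S where "S = {p. is_path V E p \<and> hd p = 0 \<and> set p \<subseteq> ?R}"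
  have len: "length p \<le> card V" if "p \<in> S" for p
    using that fin card_mono[of V "set p"] by (auto simp: S_def is_path_def distinct_card)
  obtain p0 where "is_path V E p0" "hd p0 = 0" "last p0 = z0" "set p0 \<subseteq> ?R"
    by (rule remaining_path[OF con ls 0 z0(1)])
  then have p0: "p0 \<in> S" "last p0 = z0" by (simp_all add: S_def)
  have "p0 \<noteq> []" using p0 by (simp add: S_def is_path_def)
  moreover have "p0 \<noteq> [x]" for x using p0 z0(2) by (auto simp: S_def)
  ultimately have "length p0 \<ge> 2" by (cases p0; cases "tl p0") auto
  have "\<exists>p. p \<in> S \<and> (\<forall>q. q \<in> S \<longrightarrow> length q \<le> length p)"
    using p0(1) len by (intro ex_has_greatest_nat[of _ p0 length "Suc (card V)"]) (auto simp: less_Suc_eq_le)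
  then obtain p where p: "p \<in> S" "\<And>q. q \<in> S \<Longrightarrow> length q \<le> length p" by blast
  \<comment> \<open>The path to \<open>z0\<close> has an edge because \<open>z0\<close> is not the
    root; hence so does the longest path, and its last vertex differs from the root.\<close>
  have len2: "length p \<ge> 2" using p(2)[OF p0(1)] \<open>length p0 \<ge> 2\<close> by simp
  have pp: "is_path V E p" "hd p = 0" "set p \<subseteq> ?R" using p(1) by (auto simp: S_def)
  have dist: "distinct p" "p \<noteq> []" using pp by (auto simp: is_path_def)
  define z where "z = last p"
  define y where "y = p ! (length p - 2)"
  have z: "z = p ! (length p - 1)" using dist by (simp add: z_def last_conv_nth)
  have "z \<noteq> 0"
    using len2 dist pp(2) nth_eq_iff_index_eq[of p "length p - 1" 0] by (simp add: z hd_conv_nth)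
  have "z \<in> ?R" using pp(3) last_in_set[OF dist(2)] unfolding z_def by blast
  have "Suc (length p - 2) = length p - 1" "Suc (length p - 2) < length p" using len2 by simp_all
  then have "{y, z} \<in> E"
    using pp(1) unfolding is_path_def y_def z by metis
  have "y \<in> ?R" using pp(3) nth_mem[of "length p - 2" p] len2 unfolding y_def by fastforce
  \<comment> \<open>Off the path, another remaining neighbour of \<open>z\<close> would extend a
    longest path. On the path, it lies at least two places before \<open>z\<close>, so the rest of
    the path from there has three or more vertices and is closed to a cycle by the edge to
    \<open>z\<close>.\<close>
  have "y' = y" if y': "y' \<in> ?R" "{z, y'} \<in> E" for y'
  proof (rule ccontr)
    assume "y' \<noteq> y"
    show False
    proof (cases "y' \<in> set p")
      case False
      then have "p @ [y'] \<in> S"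
        using is_path_append1[OF pp(1), of y'] y' pp dist by (auto simp: S_def z_def)
      then show False using p(2) by fastforce
    next
      case True
      then obtain j where j: "j < length p" "p ! j = y'" by (metis in_set_conv_nth)
      have "z \<noteq> y'" using simple_graphD(3)[OF sg y'(2)] .
      then have "j \<noteq> length p - 1" using j z by auto
      moreover have "j \<noteq> length p - 2" using j \<open>y' \<noteq> y\<close> by (auto simp: y_def)
      ultimately have "is_cycle V E (drop j p)"
        using j is_path_drop[OF pp(1) j(1)] y'(2) by (auto simp: is_cycle_def hd_drop_conv_nth z_def)
      then show False using cyc by blast
    qed
  qed
  moreover have "{z, y} \<in> E" using \<open>{y, z} \<in> E\<close> by (simp add: insert_commute)
  ultimately have "{y \<in> ?R. {z, y} \<in> E} = {y}"
    using \<open>y \<in> ?R\<close> by blast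
  then show ?thesis using \<open>z \<in> ?R\<close> \<open>z \<noteq> 0\<close> by blast
qed

lemma leaf_seq_extend:
  assumes "leaf_seq V E Q par H" "z \<in> V - Q ` {..<H}" "z \<noteq> 0"
    "{y \<in> V - Q ` {..<H}. {z, y} \<in> E} = {y}"
  shows "leaf_seq V E (Q(H := z)) (par(z := y)) (Suc H)"
  unfolding leaf_seq_def
proof (intro allI impI)
  fix h assume "h < Suc H"
  have im: "(Q(H := z)) ` {..<h} = Q ` {..<h}" if "h \<le> H" for h using that by auto
  show "(Q(H := z)) h \<in> V - {0} - (Q(H := z)) ` {..<h} \<and>
      {y \<in> V - (Q(H := z)) ` {..<h}. {(Q(H := z)) h, y} \<in> E} = {(par(z := y)) ((Q(H := z)) h)}"
  proof (cases "h = H")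
    case True
    then show ?thesis using assms(2-4) im[of H] by auto
  next
    case False
    with \<open>h < Suc H\<close> have "h < H" by simp
    then have "Q h \<noteq> z" using assms(2) by auto
    then show ?thesis
      using assms(1) \<open>h < H\<close> im[of h] unfolding leaf_seq_def by auto
  qed
qed

lemma remaining_card:
  assumes "leaf_seq V E Q par H" "finite V"
  shows "card (V - Q ` {..<H}) = card V - H"
proof -
  have "Q ` {..<H} \<subseteq> V" using leaf_seqD(1)[OF assms(1)] by auto
  then show ?thesis
    using card_Diff_subset[of "Q ` {..<H}" V] card_image[OF leaf_seq_inj[OF assms(1)]] by simp
qed

lemma leaf_seq_ex:
  assumes "is_tree V E" "0 \<in> V" "H \<le> card V - 1"
  shows "\<exists>Q par. leaf_seq V E Q par H"
  using assms(3)
proof (induction H)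
  case 0
  then show ?case by (simp add: leaf_seq_def)
next
  case (Suc H)
  then obtain Q par where ls: "leaf_seq V E Q par H" by auto
  have fin: "finite V" using assms(1) by (simp add: is_tree_def simple_graph_def)
  have "card (V - Q ` {..<H} - {0}) \<noteq> 0"
    using remaining_card[OF ls fin] Suc.prems card_Diff_singleton_if[of "V - Q ` {..<H}" 0] by auto
  then obtain z0 where "z0 \<in> V - Q ` {..<H} - {0}" by (metis card.empty ex_in_conv)
  then obtain z y where "z \<in> V - Q ` {..<H}" "z \<noteq> 0" "{y \<in> V - Q ` {..<H}. {z, y} \<in> E} = {y}"
    using leaf_exists[OF assms(1) ls assms(2), of z0] by blast
  then show ?case using leaf_seq_extend[OF ls] by blast
qed

text \<open>A complete elimination: by \<open>m = Suc H\<close> only the root is left. That the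
  graph is a tree is a consequence (\<open>tree\<close>), since a successful run of the program has
  to certify it.\<close>

locale elimination =
  fixes m :: nat and E :: "nat set set" and Q par :: "nat \<Rightarrow> nat" and H :: nat
  assumes simple: "simple_graph {..<m} E"
    and leaves: "leaf_seq {..<m} E Q par H"
    and m: "m = Suc H"
begin

definition remaining :: "nat \<Rightarrow> nat set" where
  "remaining h = {..<m} - Q ` {..<h}"

abbreviation edge :: "nat \<Rightarrow> nat set" where
  "edge h \<equiv> {Q h, par (Q h)}"

lemma finite_remaining [simp]: "finite (remaining h)" by (simp add: remaining_def)

lemma remaining_0: "remaining 0 = {..<m}" by (simp add: remaining_def)

lemma remaining_Suc: "remaining (Suc h) = remaining h - {Q h}"
  by (auto simp: remaining_def lessThan_Suc)

lemma Q_remaining: "h < H \<Longrightarrow> Q h \<in> remaining h"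
  using leaf_seqD(1,3)[OF leaves] by (auto simp: remaining_def)

lemma par_neq: "h < H \<Longrightarrow> par (Q h) \<noteq> Q h"
  using leaf_seqD(6)[OF leaves] simple_graphD(3)[OF simple] by metis

lemma par_remaining: "h < H \<Longrightarrow> par (Q h) \<in> remaining (Suc h)"
  using leaf_seqD(4,5)[OF leaves] par_neq by (auto simp: remaining_Suc) (auto simp: remaining_def)

lemma Q_image: "Q ` {..<H} = {..<m} - {0}"
proof (rule card_subset_eq)
  show "Q ` {..<H} \<subseteq> {..<m} - {0}" using leaf_seqD(1)[OF leaves] root_not_eliminated[OF leaves] by auto
  show "card (Q ` {..<H}) = card ({..<m} - {0})"
    using card_image[OF leaf_seq_inj[OF leaves]] m by simp
qed simp

lemma remaining_H: "remaining H = {0}"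
  unfolding remaining_def Q_image using m by auto

lemma remaining_subset: "h \<le> h' \<Longrightarrow> remaining h' \<subseteq> remaining h"
  by (auto simp: remaining_def)

lemma edge_in: "h < H \<Longrightarrow> edge h \<in> E"
  using leaf_seqD(6)[OF leaves] by simp

text \<open>Two distinct end points cannot both be the root. When the first of them is eliminated,
  the other one still remains and hence is its parent.\<close>

lemma edges: "E = edge ` {..<H}"
proof
  show "edge ` {..<H} \<subseteq> E" using edge_in by auto
  show "E \<subseteq> edge ` {..<H}"
  proof
    fix e assume e: "e \<in> E"
    then have "e \<subseteq> {..<m}" "card e = 2" using simple by (auto simp: simple_graph_def)
    then obtain a b where ab: "e = {a, b}" "a \<noteq> b" "a < m" "b < m"
      by (metis card_2_iff insert_subset lessThan_iff)
    then have "\<exists>h. h < H \<and> Q h \<in> e"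
      using Q_image by (metis DiffI empty_iff imageE insertCI insert_iff lessThan_iff)
    then obtain h where h: "h < H" "Q h \<in> e" and min: "\<And>h'. h' < h \<Longrightarrow> Q h' \<notin> e"
      using first_index[of H "\<lambda>h. Q h \<in> e"] by metis
    obtain c where c: "e = {Q h, c}" "c \<in> {..<m}" 
      using h(2) ab by (metis insertE insert_commute lessThan_iff singletonD)
    then have "c \<notin> Q ` {..<h}" using min by auto
    then have "c = par (Q h)" using leaf_seqD(7)[OF leaves h(1) c(2)] e c(1) by simp
    then show "e \<in> edge ` {..<H}" using c h by auto
  qed
qed

text \<open>Once eliminated, \<open>Q h\<close> is neither a later child nor a later parent.\<close>

lemma edge_inj: "inj_on edge {..<H}"
proof (rule linorder_inj_onI)
  fix h h' assume *: "h < h'" "h \<in> {..<H}" "h' \<in> {..<H}"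
  have "Q h \<noteq> Q h'" using leaf_seqD(3)[OF leaves, of h'] * by (metis imageI lessThan_iff)
  moreover have "par (Q h') \<noteq> Q h" using leaf_seqD(5)[OF leaves, of h'] * by auto
  ultimately show "edge h \<noteq> edge h'" by (auto simp: doubleton_eq_iff)
qed auto

lemma card_edges: "card E = H"
  unfolding edges using card_image[OF edge_inj] by simp

text \<open>On a cycle, both neighbours of the vertex eliminated first still remain, so that vertex
  was not a leaf.\<close>

lemma acyclic: "\<not> is_cycle {..<m} E p"
proof
  assume "is_cycle {..<m} E p"
  then have p: "length p \<ge> 3" "p \<noteq> []" "distinct p" "set p \<subseteq> {..<m}" "{last p, hd p} \<in> E"
    "\<And>i. Suc i < length p \<Longrightarrow> {p ! i, p ! Suc i} \<in> E"
    by (auto simp: is_cycle_def is_path_def)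
  have "\<exists>h. h < H \<and> Q h \<in> set p"
  proof (rule ccontr)
    assume "\<nexists>h. h < H \<and> Q h \<in> set p"
    then have "set p \<inter> Q ` {..<H} = {}" by auto
    then have "set p \<subseteq> {0}" using p(4) unfolding Q_image by blast
    then have "card (set p) \<le> 1" using card_mono[of "{0}" "set p"] by simp
    then show False using p(1,3) by (simp add: distinct_card)
  qed
  then obtain h where h: "h < H" "Q h \<in> set p" and min: "\<And>h'. h' < h \<Longrightarrow> Q h' \<notin> set p"
    using first_index[of H "\<lambda>h. Q h \<in> set p"] by metis
  obtain i where i: "i < length p" "p ! i = Q h" using h(2) by (metis in_set_conv_nth)
  have nb: "p ! j = par (Q h)" if "j < length p" "{Q h, p ! j} \<in> E" for j
    using leaf_seqD(7)[OF leaves h(1), of "p ! j"] that p(4) min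
    by (metis image_iff lessThan_iff nth_mem subsetD)
  have last: "last p = p ! (length p - 1)" "hd p = p ! 0"
    using p(2) by (auto simp: last_conv_nth hd_conv_nth)
  \<comment> \<open>Positions of the cyclic successor and predecessor of \<open>i\<close>; they
    differ because the cycle has at least three vertices.\<close>
  define a where "a = (if Suc i < length p then Suc i else 0)"
  define b where "b = (if i = 0 then length p - 1 else i - 1)"
  have ab: "a < length p" "b < length p" "a \<noteq> b" using i p(1) by (auto simp: a_def b_def)
  have "Suc i < length p \<or> i = length p - 1" using i by auto
  then have "{Q h, p ! a} \<in> E" using p(5) p(6)[of i] i last by (auto simp: a_def)
  moreover have "{Q h, p ! b} \<in> E"
    using p(5) p(6)[of "i - 1"] i last unfolding b_def
    by (cases "i = 0") (simp_all add: insert_commute)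
  ultimately have "p ! a = p ! b" using nb[OF ab(1)] nb[OF ab(2)] by metis
  then show False using ab p(3) nth_eq_iff_index_eq by blast
qed

subsection \<open>Contraction\<close>

text \<open>The vertex into which \<open>x\<close> has been contracted after the first \<open>h\<close> leaves were merged into
  their parents. The vertices with \<open>rep h x = Q h\<close> form the subtree below \<open>Q h\<close>.\<close>

primrec rep :: "nat \<Rightarrow> nat \<Rightarrow> nat" where
  "rep 0 x = x"
| "rep (Suc h) x = (if rep h x = Q h then par (Q h) else rep h x)"

lemma rep_remaining: "x < m \<Longrightarrow> h \<le> H \<Longrightarrow> rep h x \<in> remaining h"
  by (induction h) (auto simp: remaining_0 Q_remaining par_remaining, auto simp: remaining_Suc)

lemma rep_id: "x \<in> remaining h \<Longrightarrow> h \<le> H \<Longrightarrow> rep h x = x"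
  by (induction h) (auto simp: remaining_Suc)

text \<open>The ends of an edge contracted before time \<open>h\<close> share their representative;
  the ends of an edge contracted later still represent themselves and differ from
  \<open>Q h\<close>.\<close>

lemma rep_edge:
  assumes "j < H" "h < H" "j \<noteq> h"
  shows "rep h (Q j) = Q h \<longleftrightarrow> rep h (par (Q j)) = Q h"
proof (cases "j < h")
  case True
  have eq: "rep h' (Q j) = rep h' (par (Q j))" if "Suc j \<le> h'" for h'
    using that
  proof (induction h' rule: dec_induct)
    case base
    have "rep j (Q j) = Q j" using rep_id Q_remaining assms(1) by simp
    moreover have "rep j (par (Q j)) = par (Q j)"
      using rep_id par_remaining[OF assms(1)] assms(1) by (auto simp: remaining_Suc)
    ultimately show ?case by simp
  qed simp
  show ?thesis using eq[of h] True by simp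
next
  case False
  then have "h < j" using assms by simp
  have "Q j \<in> remaining (Suc h)" "par (Q j) \<in> remaining (Suc h)"
    using Q_remaining par_remaining assms(1) remaining_subset[of "Suc h" j]
      remaining_subset[of "Suc h" "Suc j"] \<open>h < j\<close> by auto
  then show ?thesis using rep_id assms(2) by (auto simp: remaining_Suc)
qed

lemma rep_parent: "h < H \<Longrightarrow> rep h (Q h) = Q h" "h < H \<Longrightarrow> rep h (par (Q h)) \<noteq> Q h"
  using rep_id Q_remaining par_remaining par_neq by (auto simp: remaining_Suc)

lemma path_edges_Cons: "path_edges (x # y # p) = insert {x, y} (path_edges (y # p))"
proof -
  have "{{(x # y # p) ! i, (x # y # p) ! Suc i} | i. Suc i < length (x # y # p)} =
      insert {x, y} {{(y # p) ! i, (y # p) ! Suc i} | i. Suc i < length (y # p)}"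
    (is "?L = insert _ ?R")
  proof (intro equalityI subsetI)
    fix e assume "e \<in> ?L"
    then obtain i where "e = {(x # y # p) ! i, (x # y # p) ! Suc i}" "Suc i < length (x # y # p)"
      by blast
    then show "e \<in> insert {x, y} ?R" by (cases i) auto
  next
    fix e assume "e \<in> insert {x, y} ?R"
    then consider "e = {x, y}"
      | i where "e = {(y # p) ! i, (y # p) ! Suc i}" "Suc i < length (y # p)" by blast
    then show "e \<in> ?L"
    proof cases
      case 1
      then show ?thesis by (intro CollectI exI[of _ 0]) simp
    next
      case (2 i)
      then show ?thesis by (intro CollectI exI[of _ "Suc i"]) simp
    qed
  qed
  then show ?thesis by (simp add: path_edges_def)
qed

lemma path_edges_subset: "is_path V E p \<Longrightarrow> path_edges p \<subseteq> E"
  by (auto simp: path_edges_def is_path_def)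

lemma is_path_tl: "is_path V E (x # y # p) \<Longrightarrow> is_path V E (y # p)"
  using is_path_drop[of V E "x # y # p" 1] by simp

text \<open>\<open>edge h\<close> is the only edge between the subtree below \<open>Q h\<close> and the rest, and a loop-free path
  uses it at most once.\<close>

lemma crossing:
  assumes "is_path {..<m} E p" "h < H"
  shows "edge h \<in> path_edges p \<longleftrightarrow> (rep h (hd p) = Q h) \<noteq> (rep h (last p) = Q h)"
  using assms(1)
proof (induction p)
  case Nil
  then show ?case by (simp add: is_path_def)
next
  case (Cons x p)
  show ?case
  proof (cases p)
    case Nil
    then show ?thesis by (simp add: path_edges_def)
  next
    case (Cons y q)
    have IH: "edge h \<in> path_edges p \<longleftrightarrow> (rep h y = Q h) \<noteq> (rep h (last p) = Q h)"
      using Cons.IH Cons.prems is_path_tl by (simp add: \<open>p = y # q\<close>)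
    have xy: "{x, y} \<in> E" "x \<notin> set p"
      using Cons.prems \<open>p = y # q\<close> by (auto simp: is_path_def)
    have last: "last (x # p) = last p" using \<open>p = y # q\<close> by simp
    show ?thesis
    proof (cases "{x, y} = edge h")
      case True
      have "edge h \<notin> path_edges p"
      proof
        assume "edge h \<in> path_edges p"
        then obtain i where "edge h = {p ! i, p ! Suc i}" "Suc i < length p"
          by (auto simp: path_edges_def)
        then have "edge h \<subseteq> set p" by auto
        then show False using True xy(2) by (metis insert_subset)
      qed
      then have "(rep h y = Q h) = (rep h (last p) = Q h)" using IH by simp
      moreover have "(rep h x = Q h) \<noteq> (rep h y = Q h)"
        using True rep_parent[OF assms(2)] by (auto simp: doubleton_eq_iff)
      ultimately show ?thesis
        using True last by (simp add: path_edges_Cons \<open>p = y # q\<close>)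
    next
      case False
      obtain j where j: "j < H" "{x, y} = edge j" using xy(1) edges by auto
      then have "j \<noteq> h" using False by auto
      then have "(rep h x = Q h) = (rep h y = Q h)"
        using rep_edge[OF j(1) assms(2)] j(2) by (auto simp: doubleton_eq_iff)
      then show ?thesis
        using IH False last by (auto simp: path_edges_Cons \<open>p = y # q\<close>)
    qed
  qed
qed

end

context elimination
begin

subsection \<open>Paths\<close>

text \<open>\<open>F\<close> lists the vertices left behind by the first end point, \<open>B\<close>
  those left behind by the second in reverse, so that \<open>F @ a # B\<close> runs from
  \<open>x\<close> to \<open>y\<close> once the end points coincide. The test
  \<open>a \<noteq> b\<close> freezes them when they have met.\<close>

primrec sweep :: "nat \<Rightarrow> nat \<Rightarrow> nat \<Rightarrow> nat \<times> nat \<times> nat list \<times> nat list" where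
  "sweep 0 x y = (x, y, [], [])"
| "sweep (Suc h) x y = (case sweep h x y of (a, b, F, B) \<Rightarrow>
     if a \<noteq> b \<and> a = Q h then (par a, b, F @ [a], B)
     else if a \<noteq> b \<and> b = Q h then (a, par b, F, b # B)
     else (a, b, F, B))"

definition path_between :: "nat \<Rightarrow> nat \<Rightarrow> nat list" where
  "path_between x y = (case sweep H x y of (a, b, F, B) \<Rightarrow> F @ a # B)"

definition adjacent :: "nat \<Rightarrow> nat \<Rightarrow> bool" where
  "adjacent u v \<longleftrightarrow> {u, v} \<in> E"

text \<open>Vertices left behind have been eliminated, whereas end points that still differ remain;
  so a move to a parent never revisits a vertex. After the end points have met, their common vertex
  may itself be eliminated, hence the disjunction.\<close>

lemma sweep_invariant:
  assumes "x < m" "y < m" "h \<le> H" "sweep h x y = (a, b, F, B)"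
  shows "(a = b \<or> a \<in> remaining h \<and> b \<in> remaining h) \<and> a < m \<and> b < m \<and> distinct (F @ B) \<and>
    a \<notin> set (F @ B) \<and> b \<notin> set (F @ B) \<and> set (F @ B) \<subseteq> Q ` {..<h} \<and>
    hd (F @ [a]) = x \<and> last (b # B) = y \<and>
    successively adjacent (F @ [a]) \<and> successively adjacent (b # B)"
  using assms(3,4)
proof (induction h arbitrary: a b F B)
  case 0
  then show ?case using assms(1,2) by (auto simp: remaining_0)
next
  case (Suc h)
  obtain a' b' F' B' where s: "sweep h x y = (a', b', F', B')" by (metis prod_cases4)
  have h: "h < H" "h \<le> H" using Suc.prems by simp_all
  note IH = Suc.IH[OF h(2) s]
  let ?v = "Q h"
  have par: "par ?v \<in> remaining (Suc h)" using par_remaining[OF h(1)] .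
  then have par': "par ?v < m" "par ?v \<notin> Q ` {..<Suc h}" by (auto simp: remaining_def)
  have v: "?v \<notin> Q ` {..<h}" using Q_remaining[OF h(1)] by (auto simp: remaining_def)
  have sub: "Q ` {..<h} \<subseteq> Q ` {..<Suc h}" "?v \<in> Q ` {..<Suc h}" by auto
  have adj: "adjacent ?v (par ?v)" "adjacent (par ?v) ?v"
    using edge_in[OF h(1)] by (simp_all add: adjacent_def insert_commute)
  consider (left) "a' \<noteq> b'" "a' = ?v" | (right) "a' \<noteq> b'" "b' = ?v" "a' \<noteq> ?v"
    | (keep) "a' = b' \<or> a' \<noteq> ?v \<and> b' \<noteq> ?v" by blast
  then show ?case
  proof cases
    case left
    then have eq: "a = par ?v" "b = b'" "F = F' @ [?v]" "B = B'"
      using Suc.prems(2) s by simp_all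
    have "b' \<in> remaining (Suc h)" using IH left by (auto simp: remaining_Suc)
    moreover have "par ?v \<notin> set (F @ B)" using par'(2) IH eq sub by auto
    moreover have "set (F @ B) \<subseteq> Q ` {..<Suc h}" using IH eq sub by auto
    moreover have "successively adjacent (F @ [a])"
      using IH left(2) adj(1) by (simp add: eq successively_append_iff)
    moreover have "hd (F @ [a]) = x" using IH left(2) by (auto simp: eq hd_append)
    ultimately show ?thesis using IH left par par' unfolding eq by auto
  next
    case right
    then have eq: "a = a'" "b = par ?v" "F = F'" "B = ?v # B'"
      using Suc.prems(2) s by simp_all
    have "a' \<in> remaining (Suc h)" using IH right by (auto simp: remaining_Suc)
    moreover have "par ?v \<notin> set (F @ B)" using par'(2) IH eq sub by auto
    moreover have "set (F @ B) \<subseteq> Q ` {..<Suc h}" using IH eq sub by auto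
    moreover have "successively adjacent (b # B)"
      using IH right(2) adj(2) by (simp add: eq)
    moreover have "last (b # B) = y" using IH right(2) by (simp add: eq)
    ultimately show ?thesis using IH right par par' unfolding eq by auto
  next
    case keep
    then have eq: "a = a'" "b = b'" "F = F'" "B = B'"
      using Suc.prems(2) s by (simp_all split: if_splits)
    have "a = b \<or> a \<in> remaining (Suc h) \<and> b \<in> remaining (Suc h)"
      using IH keep unfolding eq by (auto simp: remaining_Suc)
    moreover have "set (F @ B) \<subseteq> Q ` {..<Suc h}" using IH sub(1) unfolding eq by blast
    ultimately show ?thesis using IH unfolding eq by blast
  qed
qed

lemma path_between:
  assumes "x < m" "y < m"
  shows "is_path {..<m} E (path_between x y)" "hd (path_between x y) = x"
    "last (path_between x y) = y"
proof -
  obtain a b F B where s: "sweep H x y = (a, b, F, B)" by (metis prod_cases4)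
  note inv = sweep_invariant[OF assms order_refl s]
  \<comment> \<open>After \<open>H\<close> eliminations only the root remains, so distinct remaining
    end points are impossible.\<close>
  have ab: "a = b" using inv remaining_H by auto
  have p: "path_between x y = F @ a # B" by (simp add: path_between_def s)
  have 1: "successively adjacent (F @ a # B)"
    using inv ab by (cases B) (auto simp: successively_append_iff)
  have "set (F @ B) \<subseteq> {..<m} - {0}" using inv unfolding Q_image by blast
  moreover have "a < m" using inv by blast
  ultimately have "set (F @ a # B) \<subseteq> {..<m}" by auto
  moreover have "distinct (F @ a # B)" using inv by auto
  ultimately show "is_path {..<m} E (path_between x y)"
    using 1 unfolding is_path_def p successively_conv_nth adjacent_def by simp
  show "hd (path_between x y) = x" using inv by (cases F) (simp_all add: p)
  show "last (path_between x y) = y" using inv ab by (simp add: p)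
qed

lemma tree: "is_tree {..<m} E"
proof -
  have "graph_connected {..<m} E"
    unfolding graph_connected_def using path_between m by (metis ex_in_conv lessThan_iff zero_less_Suc)
  then show ?thesis using simple acyclic by (simp add: is_tree_def)
qed

end

subsection \<open>Dynamic programming\<close>

text \<open>An abstract allocation problem: \<open>nd u k\<close> is the cost of placing
  \<open>k\<close> nodes at \<open>u\<close>, and \<open>g v k\<close> the cost of the edge above
  \<open>v\<close> when \<open>k\<close> nodes lie below it. Infinite values are meant for violated
  capacities.\<close>

locale elimination_dp = elimination +
  fixes n :: nat and nd g :: "nat \<Rightarrow> nat \<Rightarrow> enat"
begin

text \<open>For a remaining \<open>u\<close>, \<open>D h u k\<close> is the least cost of placing
  \<open>k\<close> nodes in the part contracted into \<open>u\<close> after \<open>h\<close> merges,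
  edges inside this part included. The row of an eliminated vertex stays frozen.\<close>

primrec D :: "nat \<Rightarrow> nat \<Rightarrow> nat \<Rightarrow> enat" where
  "D 0 = nd"
| "D (Suc h) = (D h)(par (Q h) := (\<lambda>k. MIN j\<in>{..k}.
     D h (par (Q h)) (k - j) + (D h (Q h) j + g (Q h) j)))"

definition flow :: "(nat \<Rightarrow> nat) \<Rightarrow> nat \<Rightarrow> nat \<Rightarrow> nat" where
  "flow cnt h u = (\<Sum>x | x < m \<and> rep h x = u. cnt x)"

definition total :: "(nat \<Rightarrow> nat) \<Rightarrow> enat" where
  "total cnt = (\<Sum>u<m. nd u (cnt u)) + (\<Sum>h<H. g (Q h) (flow cnt h (Q h)))"

lemma flow_0: "u < m \<Longrightarrow> flow cnt 0 u = cnt u"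
proof -
  assume "u < m"
  then have "{x. x < m \<and> rep 0 x = u} = {u}" by auto
  then show ?thesis by (simp add: flow_def)
qed

lemma flow_Suc:
  assumes "h < H" "u \<in> remaining (Suc h)"
  shows "flow cnt (Suc h) u = (if u = par (Q h) then flow cnt h u + flow cnt h (Q h) else flow cnt h u)"
proof -
  have u: "u \<noteq> Q h" using assms by (simp add: remaining_Suc)
  show ?thesis
  proof (cases "u = par (Q h)")
    case True
    have "{x. x < m \<and> rep (Suc h) x = u} = {x. x < m \<and> rep h x = u} \<union> {x. x < m \<and> rep h x = Q h}"
      using True u by auto
    moreover have "{x. x < m \<and> rep h x = u} \<inter> {x. x < m \<and> rep h x = Q h} = {}" using u by auto
    ultimately show ?thesis
      using True by (simp add: flow_def sum.union_disjoint)
  next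
    case False
    have "{x. x < m \<and> rep (Suc h) x = u} = {x. x < m \<and> rep h x = u}"
      using False u by auto
    then show ?thesis using False by (simp add: flow_def)
  qed
qed

lemma flow_H: "flow cnt H 0 = sum cnt {..<m}"
proof -
  have "{x. x < m \<and> rep H x = 0} = {..<m}"
    using rep_remaining[OF _ order_refl] remaining_H by auto
  then show ?thesis by (simp add: flow_def)
qed

lemma sum_remaining:
  fixes f :: "nat \<Rightarrow> 'a::comm_monoid_add"
  assumes "h < H"
  shows "sum f (remaining h) = f (Q h) + sum f (remaining (Suc h))"
    and "sum f (remaining (Suc h)) = f (par (Q h)) + sum f (remaining (Suc h) - {par (Q h)})"
proof -
  show "sum f (remaining h) = f (Q h) + sum f (remaining (Suc h))"
    unfolding remaining_Suc using Q_remaining[OF assms] by (simp add: sum.remove)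
  show "sum f (remaining (Suc h)) = f (par (Q h)) + sum f (remaining (Suc h) - {par (Q h)})"
    using par_remaining[OF assms] by (simp add: sum.remove)
qed

lemma D_Suc_le:
  "j \<le> k \<Longrightarrow> D (Suc h) (par (Q h)) k \<le> D h (par (Q h)) (k - j) + (D h (Q h) j + g (Q h) j)"
  by simp

lemma D_Suc_other: "u \<noteq> par (Q h) \<Longrightarrow> D (Suc h) u = D h u"
  by simp

text \<open>A merge minimises over all splits and \<open>cnt\<close> itself provides one of them;
  hence each merge raises the sum of the remaining tables by at most the price of the contracted
  edge.\<close>

lemma partial_total:
  assumes "h \<le> H"
  shows "(\<Sum>u\<in>remaining h. D h u (flow cnt h u)) \<le>
    (\<Sum>u<m. nd u (cnt u)) + (\<Sum>i<h. g (Q i) (flow cnt i (Q i)))"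
  using assms
proof (induction h)
  case 0
  then show ?case by (simp add: remaining_0 flow_0)
next
  case (Suc h)
  then have h: "h < H" by simp
  let ?p = "par (Q h)" and ?v = "Q h"
  let ?rest = "remaining (Suc h) - {?p}"
  have "(\<Sum>u\<in>?rest. D (Suc h) u (flow cnt (Suc h) u)) = (\<Sum>u\<in>?rest. D h u (flow cnt h u))"
    by (rule sum.cong) (auto simp: flow_Suc[OF h])
  moreover have "flow cnt (Suc h) ?p = flow cnt h ?p + flow cnt h ?v"
    using flow_Suc[OF h par_remaining[OF h]] by simp
  then have "D (Suc h) ?p (flow cnt (Suc h) ?p) \<le>
      D h ?p (flow cnt h ?p) + (D h ?v (flow cnt h ?v) + g ?v (flow cnt h ?v))"
    using D_Suc_le[of "flow cnt h ?v" "flow cnt (Suc h) ?p" h] by simp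
  ultimately have "(\<Sum>u\<in>remaining (Suc h). D (Suc h) u (flow cnt (Suc h) u)) \<le>
      D h ?p (flow cnt h ?p) + (D h ?v (flow cnt h ?v) + g ?v (flow cnt h ?v)) +
      (\<Sum>u\<in>?rest. D h u (flow cnt h u))"
    unfolding sum_remaining(2)[OF h] by (simp add: add_right_mono)
  also have "\<dots> = (\<Sum>u\<in>remaining h. D h u (flow cnt h u)) + g ?v (flow cnt h ?v)"
    unfolding sum_remaining(1)[OF h] sum_remaining(2)[OF h] by (simp add: add_ac)
  also have "\<dots> \<le> (\<Sum>u<m. nd u (cnt u)) + (\<Sum>i<h. g (Q i) (flow cnt i (Q i))) + g ?v (flow cnt h ?v)"
    using Suc by (intro add_right_mono) simp
  finally show ?case by (simp add: add_ac)
qed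

lemma D_le_total:
  assumes "sum cnt {..<m} = n"
  shows "D H 0 n \<le> total cnt"
  using partial_total[OF order_refl, of cnt] assms
  by (simp add: remaining_H flow_H total_def)

text \<open>The merges are undone from the last to the first: after \<open>i\<close> steps
  \<open>n\<close> is distributed over the vertices that remain after \<open>H - i\<close>
  eliminations, and the next step splits the share of a parent with its child.\<close>

primrec alloc :: "(nat \<Rightarrow> nat \<Rightarrow> nat) \<Rightarrow> nat \<Rightarrow> nat \<Rightarrow> nat" where
  "alloc ch 0 = (\<lambda>_. 0)(0 := n)"
| "alloc ch (Suc i) = (let v = Q (H - Suc i); p = par v; K = alloc ch i; j = ch v (K p) in
     K(v := j, p := K p - j))"

text \<open>Only \<open>k \<le> n\<close> is constrained, because the tables of the program have the
  columns 0 to \<open>n\<close>.\<close>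

definition optimal_choice :: "(nat \<Rightarrow> nat \<Rightarrow> nat) \<Rightarrow> bool" where
  "optimal_choice ch \<longleftrightarrow> (\<forall>h<H. \<forall>k\<le>n. ch (Q h) k \<le> k \<and>
     D (Suc h) (par (Q h)) k = D h (par (Q h)) (k - ch (Q h) k) +
       (D h (Q h) (ch (Q h) k) + g (Q h) (ch (Q h) k)))"

lemma alloc_step:
  assumes "h < H"
  shows "alloc ch (H - h) = (let K = alloc ch (H - Suc h); j = ch (Q h) (K (par (Q h))) in
    K(Q h := j, par (Q h) := K (par (Q h)) - j))"
proof -
  have "H - h = Suc (H - Suc h)" "H - Suc (H - Suc h) = h" using assms by simp_all
  then show ?thesis by (simp add: Let_def)
qed

text \<open>For an optimal split the inequality of \<open>partial_total\<close> becomes an equality;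
  the induction descends from the root, which alone carries all \<open>n\<close> nodes.\<close>

lemma alloc_invariant:
  assumes ch: "optimal_choice ch" and "h \<le> H"
  shows "(\<Sum>u\<in>remaining h. alloc ch (H - h) u) = n \<and>
    (\<Sum>u\<in>remaining h. D h u (alloc ch (H - h) u)) + (\<Sum>i=h..<H. g (Q i) (alloc ch (H - i) (Q i)))
      = D H 0 n"
  using assms(2)
proof (induction h rule: inc_induct)
  case base
  then show ?case by (simp add: remaining_H)
next
  case (step h)
  then have h: "h < H" by simp
  let ?p = "par (Q h)" and ?v = "Q h" and ?K = "alloc ch (H - Suc h)" and ?K' = "alloc ch (H - h)"
  let ?j = "ch ?v (?K ?p)" and ?rest = "remaining (Suc h) - {?p}"
  have pv: "?p \<noteq> ?v" using par_neq[OF h] .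
  have K': "?K' ?v = ?j" "?K' ?p = ?K ?p - ?j" "\<And>u. u \<noteq> ?v \<Longrightarrow> u \<noteq> ?p \<Longrightarrow> ?K' u = ?K u"
    using pv unfolding alloc_step[OF h] Let_def by auto
  \<comment> \<open>The share of a single vertex is a summand of \<open>n\<close>, so the choice
    function is only consulted where it is known to be optimal.\<close>
  have "?K ?p \<le> n"
    using step.IH[THEN conjunct1] member_le_sum[of ?p "remaining (Suc h)" ?K] par_remaining[OF h]
    by simp
  then have j: "?j \<le> ?K ?p"
    "D (Suc h) ?p (?K ?p) = D h ?p (?K ?p - ?j) + (D h ?v ?j + g ?v ?j)"
    using ch h unfolding optimal_choice_def by blast+
  have rest: "sum (\<lambda>u. f u (?K' u)) ?rest = sum (\<lambda>u. f u (?K u)) ?rest"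
    for f :: "nat \<Rightarrow> nat \<Rightarrow> 'a::comm_monoid_add"
    by (rule sum.cong) (auto simp: remaining_Suc K'(3))
  have "(\<Sum>u\<in>remaining h. ?K' u) = (\<Sum>u\<in>remaining (Suc h). ?K u)"
    unfolding sum_remaining(1)[OF h] sum_remaining(2)[OF h] K'(1,2) using rest[of "\<lambda>u k. k"] j(1)
    by simp
  moreover have restD: "(\<Sum>u\<in>?rest. D h u (?K' u)) = (\<Sum>u\<in>?rest. D (Suc h) u (?K u))"
    by (rule sum.cong) (auto simp: remaining_Suc K'(3))
  have "(\<Sum>u\<in>remaining h. D h u (?K' u)) + g ?v ?j = (\<Sum>u\<in>remaining (Suc h). D (Suc h) u (?K u))"
    unfolding sum_remaining(1)[OF h] sum_remaining(2)[OF h] K'(1,2) j(2) restD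
    by (simp only: add_ac)
  moreover have "(\<Sum>i=h..<H. g (Q i) (alloc ch (H - i) (Q i))) =
      g ?v ?j + (\<Sum>i=Suc h..<H. g (Q i) (alloc ch (H - i) (Q i)))"
    using h K'(1) by (simp add: sum.atLeast_Suc_lessThan)
  ultimately show ?case
    using step.IH by (metis (no_types, lifting) add.assoc)
qed

text \<open>The splits made after a vertex has received its share only redistribute that share
  within its contracted part.\<close>

lemma flow_alloc:
  assumes ch: "optimal_choice ch" and "h \<le> H" "u \<in> remaining h"
  shows "flow (alloc ch H) h u = alloc ch (H - h) u"
  using assms(2,3)
proof (induction h arbitrary: u)
  case 0
  then show ?case by (simp add: flow_0 remaining_0)
next
  case (Suc h)
  then have h: "h < H" "h \<le> H" by simp_all
  let ?p = "par (Q h)" and ?v = "Q h" and ?K = "alloc ch (H - Suc h)" and ?K' = "alloc ch (H - h)"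
  let ?j = "ch ?v (?K ?p)"
  have pv: "?p \<noteq> ?v" using par_neq[OF h(1)] .
  have K': "?K' ?v = ?j" "?K' ?p = ?K ?p - ?j" "\<And>u. u \<noteq> ?v \<Longrightarrow> u \<noteq> ?p \<Longrightarrow> ?K' u = ?K u"
    using pv unfolding alloc_step[OF h(1)] Let_def by auto
  have "?K ?p \<le> n"
    using alloc_invariant[OF ch Suc.prems(1)] member_le_sum[of ?p "remaining (Suc h)" ?K]
      par_remaining[OF h(1)] by simp
  then have j: "?j \<le> ?K ?p" using ch h unfolding optimal_choice_def by blast
  have IH: "flow (alloc ch H) h w = ?K' w" if "w \<in> remaining h" for w
    using Suc.IH[OF h(2) that] .
  have u: "u \<in> remaining h" "u \<noteq> ?v" using Suc.prems by (auto simp: remaining_Suc)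
  show ?case
    using flow_Suc[OF h(1) Suc.prems(2)] IH[OF u(1)] IH[OF Q_remaining[OF h(1)]] K' j u(2)
    by (cases "u = ?p") simp_all
qed

lemma total_alloc:
  assumes ch: "optimal_choice ch"
  shows "sum (alloc ch H) {..<m} = n" "total (alloc ch H) = D H 0 n"
proof -
  have inv: "(\<Sum>u<m. alloc ch H u) = n \<and>
    (\<Sum>u<m. nd u (alloc ch H u)) + (\<Sum>i=0..<H. g (Q i) (alloc ch (H - i) (Q i))) = D H 0 n"
    using alloc_invariant[OF ch, of 0] by (simp add: remaining_0)
  then show "sum (alloc ch H) {..<m} = n" by simp
  have "flow (alloc ch H) i (Q i) = alloc ch (H - i) (Q i)" if "i < H" for i
    using flow_alloc[OF ch] Q_remaining that by simp
  then show "total (alloc ch H) = D H 0 n"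
    using inv unfolding total_def by (simp add: atLeast0LessThan)
qed

end

subsection \<open>Embeddings of cliques into trees\<close>

text \<open>\<open>P\<close> determines which end of a cut edge comes first, so the cut edges of a
  clique correspond bijectively to pairs of a node inside and a node outside.\<close>

lemma card_cut_edges:
  assumes "is_clique {..<n} F"
  shows "card {f \<in> F. \<exists>a b. f = {a, b} \<and> P a \<and> \<not> P b} =
    card {a. a < n \<and> P a} * (n - card {a. a < n \<and> P a})"
proof -
  let ?A = "{a. a < n \<and> P a}" and ?B = "{b. b < n \<and> \<not> P b}"
  have sg: "simple_graph {..<n} F" using assms by (simp add: is_clique_def)
  have "{f \<in> F. \<exists>a b. f = {a, b} \<and> P a \<and> \<not> P b} = (\<lambda>(a, b). {a, b}) ` (?A \<times> ?B)"
  proof (intro equalityI subsetI)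
    fix f assume "f \<in> {f \<in> F. \<exists>a b. f = {a, b} \<and> P a \<and> \<not> P b}"
    then obtain a b where f: "{a, b} \<in> F" "f = {a, b}" "P a" "\<not> P b" by auto
    then have "a < n" "b < n" using simple_graphD(1,2)[OF sg f(1)] by auto
    then show "f \<in> (\<lambda>(a, b). {a, b}) ` (?A \<times> ?B)" using f by auto
  next
    fix f assume "f \<in> (\<lambda>(a, b). {a, b}) ` (?A \<times> ?B)"
    then obtain a b where f: "f = {a, b}" "P a" "\<not> P b" "a < n" "b < n" by auto
    then have "{a, b} \<in> F" using assms unfolding is_clique_def by (metis lessThan_iff)
    then show "f \<in> {f \<in> F. \<exists>a b. f = {a, b} \<and> P a \<and> \<not> P b}" using f by auto
  qed
  moreover have "inj_on (\<lambda>(a, b). {a, b}) (?A \<times> ?B)"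
    by (auto simp: inj_on_def doubleton_eq_iff)
  moreover have "?B = {..<n} - ?A" by auto
  then have "card ?B = n - card ?A" using card_Diff_subset[of ?A "{..<n}"] by auto
  ultimately show ?thesis by (simp add: card_image card_cartesian_product)
qed

lemma sum_enat: "(\<Sum>x\<in>A. enat (f x)) = enat (\<Sum>x\<in>A. f x)"
  by (induction A rule: infinite_finite_induct) (auto simp: zero_enat_def)

lemma sum_enat_finite:
  fixes f :: "'a \<Rightarrow> enat"
  assumes "finite A" "sum f A \<noteq> \<infinity>" "x \<in> A"
  shows "f x \<noteq> \<infinity>"
proof
  assume "f x = \<infinity>"
  then have "sum f A = \<infinity>" using assms by (simp add: sum.remove)
  then show False using assms by simp
qed

lemma sum_card_fibres:
  assumes "finite A" "finite X"
  shows "(\<Sum>x\<in>X. card {a \<in> A. f a = x}) = card {a \<in> A. f a \<in> X}"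
proof -
  have "{a \<in> A. f a \<in> X} = (\<Union>x\<in>X. {a \<in> A. f a = x})" by auto
  also have "card \<dots> = (\<Sum>x\<in>X. card {a \<in> A. f a = x})"
    by (rule card_UN_disjoint) (use assms in auto)
  finally show ?thesis by simp
qed

lemma sum_over_fibres:
  fixes w :: "nat \<Rightarrow> nat"
  assumes "finite A" "\<And>a. a \<in> A \<Longrightarrow> f a \<in> X" "finite X"
  shows "(\<Sum>a\<in>A. w (f a)) = (\<Sum>x\<in>X. card {a \<in> A. f a = x} * w x)"
proof -
  have "(\<Sum>x\<in>X. card {a \<in> A. f a = x} * w x) = (\<Sum>x\<in>X. \<Sum>a\<in>{a \<in> A. f a = x}. w (f a))"
    by (intro sum.cong) auto
  also have "\<dots> = (\<Sum>a\<in>A. w (f a))"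
    using assms by (intro sum.group) auto
  finally show ?thesis by simp
qed

locale clique_tree = elimination m "ES I" Q par H
  for I :: "(nat, nat) uniVNE" and m Q par H +
  fixes n :: nat
  assumes VR: "VR I = {..<n}" and VS: "VS I = {..<m}"
    and clique: "is_clique {..<n} (ER I)"
begin

definition nd :: "nat \<Rightarrow> nat \<Rightarrow> enat" where
  "nd u k = (if k \<le> node_cap I u then enat (k * node_cost I u) else \<infinity>)"

definition gc :: "nat \<Rightarrow> nat \<Rightarrow> enat" where
  "gc v k = (if k * (n - k) \<le> edge_cap I {v, par v}
     then enat (k * (n - k) * edge_cost I {v, par v}) else \<infinity>)"

sublocale elimination_dp m "ES I" Q par H n nd gc
  by unfold_locales

definition load :: "(nat \<Rightarrow> nat) \<Rightarrow> nat \<Rightarrow> nat" where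
  "load f u = card {a \<in> {..<n}. f a = u}"

lemma sum_load: "(\<And>a. a < n \<Longrightarrow> f a < m) \<Longrightarrow> sum (load f) {..<m} = n"
  using sum_card_fibres[of "{..<n}" "{..<m}" f]
  by (simp add: load_def) (metis (no_types, lifting) Collect_cong card_Collect_less_nat)

lemma flow_load: "flow (load f) h u = card {a. a < n \<and> f a < m \<and> rep h (f a) = u}"
  using sum_card_fibres[of "{..<n}" "{x. x < m \<and> rep h x = u}" f]
  by (simp add: flow_def load_def)

lemma traffic:
  assumes map: "is_mapping I (f, p)" and h: "h < H"
  shows "card {e \<in> ER I. edge h \<in> path_edges (p e)} =
    flow (load f) h (Q h) * (n - flow (load f) h (Q h))"
proof -
  let ?P = "\<lambda>a. rep h (f a) = Q h"
  have fm: "f a < m" if "a < n" for a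
    using map that by (auto simp: is_mapping_def VR VS)
  have "edge h \<in> path_edges (p e) \<longleftrightarrow> (\<exists>a b. e = {a, b} \<and> ?P a \<and> \<not> ?P b)" if e: "e \<in> ER I" for e
  proof -
    have path: "is_path {..<m} (ES I) (p e)" and ends: "{hd (p e), last (p e)} = f ` e"
      using map e by (auto simp: is_mapping_def VS)
    have "card e = 2" using clique e by (auto simp: is_clique_def simple_graph_def)
    then obtain a b where ab: "e = {a, b}" by (meson card_2_iff)
    have "edge h \<in> path_edges (p e) \<longleftrightarrow> ?P a \<noteq> ?P b"
      using crossing[OF path h] ends ab by (auto simp: doubleton_eq_iff)
    also have "\<dots> \<longleftrightarrow> (\<exists>a b. e = {a, b} \<and> ?P a \<and> \<not> ?P b)"
      unfolding ab doubleton_eq_iff by blast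
    finally show ?thesis .
  qed
  then have "{e \<in> ER I. edge h \<in> path_edges (p e)} = {e \<in> ER I. \<exists>a b. e = {a, b} \<and> ?P a \<and> \<not> ?P b}"
    by auto
  moreover have "{a. a < n \<and> f a < m \<and> ?P a} = {a. a < n \<and> ?P a}" using fm by auto
  ultimately show ?thesis
    using card_cut_edges[OF clique, of ?P] by (simp add: flow_load)
qed

text \<open>Summing over substrate edges instead of virtual edges turns the cost of the paths into
  traffic times edge cost, and the traffic is given by the loads.\<close>

lemma mapping_cost_eq:
  assumes map: "is_mapping I (f, p)"
  shows "mapping_cost I (f, p) = (\<Sum>u<m. load f u * node_cost I u) +
    (\<Sum>h<H. flow (load f) h (Q h) * (n - flow (load f) h (Q h)) * edge_cost I (edge h))"
proof -
  have fm: "f a < m" if "a < n" for a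
    using map that by (auto simp: is_mapping_def VR VS)
  have fin: "finite (ER I)"
    using clique finite_subset[of "ER I" "Pow {..<n}"] by (auto simp: is_clique_def simple_graph_def)
  have finS: "finite (ES I)" unfolding edges by simp
  have nodes: "(\<Sum>a\<in>VR I. node_cost I (f a)) = (\<Sum>u<m. load f u * node_cost I u)"
    unfolding VR load_def by (rule sum_over_fibres) (use fm in auto)
  have "(\<Sum>e\<in>ER I. \<Sum>x\<in>path_edges (p e). edge_cost I x) =
      (\<Sum>e\<in>ER I. \<Sum>x\<in>ES I. if x \<in> path_edges (p e) then edge_cost I x else 0)"
  proof (rule sum.cong[OF refl])
    fix e assume "e \<in> ER I"
    then have "path_edges (p e) \<subseteq> ES I"
      using map path_edges_subset by (auto simp: is_mapping_def)
    then have "path_edges (p e) = {x \<in> ES I. x \<in> path_edges (p e)}" by auto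
    then show "(\<Sum>x\<in>path_edges (p e). edge_cost I x) =
        (\<Sum>x\<in>ES I. if x \<in> path_edges (p e) then edge_cost I x else 0)"
      using sum.inter_filter[OF finS, of "edge_cost I" "\<lambda>x. x \<in> path_edges (p e)"] by simp
  qed
  also have "\<dots> = (\<Sum>x\<in>ES I. \<Sum>e\<in>ER I. if x \<in> path_edges (p e) then edge_cost I x else 0)"
    by (rule sum.swap)
  also have "\<dots> = (\<Sum>x\<in>ES I. card {e \<in> ER I. x \<in> path_edges (p e)} * edge_cost I x)"
    by (rule sum.cong[OF refl]) (simp add: sum.inter_filter[OF fin, symmetric])
  also have "\<dots> = (\<Sum>h<H. card {e \<in> ER I. edge h \<in> path_edges (p e)} * edge_cost I (edge h))"
    unfolding edges by (subst sum.reindex[OF edge_inj]) simp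
  also have "\<dots> = (\<Sum>h<H. flow (load f) h (Q h) * (n - flow (load f) h (Q h)) * edge_cost I (edge h))"
    by (rule sum.cong[OF refl]) (simp add: traffic[OF map])
  finally show ?thesis using nodes by (simp add: mapping_cost_def)
qed

text \<open>A finite sum in \<open>enat\<close> is finite exactly if all its terms are, and the
  infinite terms of \<open>total\<close> are the violated capacities.\<close>

lemma feasible_iff:
  assumes map: "is_mapping I (f, p)"
  shows "feasible I (f, p) \<longleftrightarrow> total (load f) \<noteq> \<infinity>"
    and "feasible I (f, p) \<Longrightarrow> total (load f) = enat (mapping_cost I (f, p))"
proof -
  let ?t = "\<lambda>h. flow (load f) h (Q h) * (n - flow (load f) h (Q h))"
  have feas: "feasible I (f, p) \<longleftrightarrow>
      (\<forall>u<m. load f u \<le> node_cap I u) \<and> (\<forall>h<H. ?t h \<le> edge_cap I (edge h))"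
  proof -
    have "(\<forall>e\<in>ES I. card {x \<in> ER I. e \<in> path_edges (p x)} \<le> edge_cap I e) \<longleftrightarrow>
        (\<forall>h<H. card {x \<in> ER I. edge h \<in> path_edges (p x)} \<le> edge_cap I (edge h))"
      unfolding edges by auto
    also have "\<dots> \<longleftrightarrow> (\<forall>h<H. ?t h \<le> edge_cap I (edge h))" using traffic[OF map] by simp
    finally show ?thesis
      using map by (simp add: feasible_def VR VS load_def Ball_def)
  qed
  show 1: "total (load f) = enat (mapping_cost I (f, p))" if "feasible I (f, p)"
  proof -
    have "(\<Sum>u<m. nd u (load f u)) = (\<Sum>u<m. enat (load f u * node_cost I u))"
      using that feas by (intro sum.cong) (auto simp: nd_def)
    moreover have "(\<Sum>h<H. gc (Q h) (flow (load f) h (Q h))) =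
        (\<Sum>h<H. enat (?t h * edge_cost I (edge h)))"
      using that feas by (intro sum.cong) (auto simp: gc_def)
    ultimately show ?thesis
      unfolding total_def mapping_cost_eq[OF map] by (simp add: sum_enat)
  qed
  show "feasible I (f, p) \<longleftrightarrow> total (load f) \<noteq> \<infinity>"
  proof
    assume "total (load f) \<noteq> \<infinity>"
    then have fin: "(\<Sum>u<m. nd u (load f u)) \<noteq> \<infinity>"
      "(\<Sum>h<H. gc (Q h) (flow (load f) h (Q h))) \<noteq> \<infinity>"
      unfolding total_def by (metis plus_eq_infty_iff_enat)+
    have "load f u \<le> node_cap I u" if "u < m" for u
      using sum_enat_finite[OF _ fin(1), of u] that by (auto simp: nd_def split: if_splits)
    moreover have "?t h \<le> edge_cap I (edge h)" if "h < H" for h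
      using sum_enat_finite[OF _ fin(2), of h] that by (auto simp: gc_def split: if_splits)
    ultimately show "feasible I (f, p)" using feas by blast
  qed (use 1 in simp)
qed

lemma D_le_mapping_cost:
  assumes "feasible I (f, p)"
  shows "D H 0 n \<le> enat (mapping_cost I (f, p))"
proof -
  have map: "is_mapping I (f, p)" using assms by (simp add: feasible_def)
  then have "sum (load f) {..<m} = n" by (intro sum_load) (auto simp: is_mapping_def VR VS)
  then show ?thesis using D_le_total feasible_iff(2)[OF map assms] by metis
qed

text \<open>A virtual edge is unordered, so a direction has to be fixed: from the larger to the
  smaller end point, which is how the program enumerates pairs.\<close>

definition route :: "(nat \<Rightarrow> nat) \<Rightarrow> nat set \<Rightarrow> nat list" where
  "route f e = path_between (f (Max e)) (f (Min e))"

lemma is_mapping_route: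
  assumes "\<And>a. a < n \<Longrightarrow> f a < m"
  shows "is_mapping I (f, route f)"
proof -
  have "is_path {..<m} (ES I) (route f e) \<and> {hd (route f e), last (route f e)} = f ` e"
    if e: "e \<in> ER I" for e
  proof -
    have "card e = 2" "e \<subseteq> {..<n}" using clique e by (auto simp: is_clique_def simple_graph_def)
    then obtain a b where ab: "e = {a, b}" "a < b" "a < n" "b < n"
      by (metis card_2_iff insert_commute insert_subset lessThan_iff linorder_neqE_nat)
    then have "Max e = b" "Min e = a" by auto
    then show ?thesis
      using path_between[of "f b" "f a"] assms ab by (auto simp: route_def)
  qed
  then show ?thesis using assms by (auto simp: is_mapping_def VR VS)
qed

text \<open>Cost and feasibility depend on the loads alone, so every placement with the traced loads
  attains \<open>D H 0 n\<close>, the lower bound for all feasible mappings.\<close>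

lemma min_cost_feasible_alloc:
  assumes ch: "optimal_choice ch" and f: "\<And>a. a < n \<Longrightarrow> f a < m"
    and load: "\<And>u. u < m \<Longrightarrow> load f u = alloc ch H u" and fin: "D H 0 n \<noteq> \<infinity>"
  shows "min_cost_feasible I (f, route f)" "D H 0 n = enat (mapping_cost I (f, route f))"
proof -
  have "flow (load f) h u = flow (alloc ch H) h u" for h u
    unfolding flow_def by (rule sum.cong) (auto simp: load)
  then have "total (load f) = total (alloc ch H)"
    using load by (simp add: total_def)
  then have tot: "total (load f) = D H 0 n" using total_alloc(2)[OF ch] by simp
  have map: "is_mapping I (f, route f)" using f by (rule is_mapping_route)
  have feas: "feasible I (f, route f)" using feasible_iff(1)[OF map] tot fin by simp
  then show eq: "D H 0 n = enat (mapping_cost I (f, route f))"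
    using feasible_iff(2)[OF map] tot by simp
  then show "min_cost_feasible I (f, route f)"
    unfolding min_cost_feasible_def using feas D_le_mapping_cost by fastforce
qed

end

section \<open>A structured language and its compiler\<close>

datatype exp = N nat | V nat | Arr nat exp | Plus exp exp | Minus exp exp

datatype com =
    Skip
  | Assign nat exp
  | Update nat exp exp
  | Input nat
  | Output exp
  | Seq com com  (infixr \<open>;;\<close> 60)
  | If exp com com
  | While exp com
  | WhileInput com

record store =
  vars :: "nat \<Rightarrow> nat"
  arrs :: "nat \<Rightarrow> nat \<Rightarrow> nat"
  inputs :: "nat list"
  outputs :: "nat list"

primrec eval :: "exp \<Rightarrow> store \<Rightarrow> nat" where
  "eval (N n) s = n"
| "eval (V x) s = vars s x"
| "eval (Arr a e) s = arrs s a (eval e s)"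
| "eval (Plus e f) s = eval e s + eval f s"
| "eval (Minus e f) s = eval e s - eval f s"

definition set_var :: "nat \<Rightarrow> nat \<Rightarrow> store \<Rightarrow> store" where
  "set_var x n s = s\<lparr>vars := (vars s)(x := n)\<rparr>"

definition set_arr :: "nat \<Rightarrow> nat \<Rightarrow> nat \<Rightarrow> store \<Rightarrow> store" where
  "set_arr a i n s = s\<lparr>arrs := (arrs s)(a := (arrs s a)(i := n))\<rparr>"

lemma set_var_sel [simp]:
  "vars (set_var x n s) = (vars s)(x := n)" "arrs (set_var x n s) = arrs s"
  "inputs (set_var x n s) = inputs s" "outputs (set_var x n s) = outputs s"
  by (simp_all add: set_var_def)

lemma set_arr_sel [simp]:
  "vars (set_arr a i n s) = vars s" "arrs (set_arr a i n s) = (arrs s)(a := (arrs s a)(i := n))"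
  "inputs (set_arr a i n s) = inputs s" "outputs (set_arr a i n s) = outputs s"
  by (simp_all add: set_arr_def)

text \<open>The number counts assignments and tests; up to the factor \<open>unit_cost\<close> below it is the
  number of machine steps.\<close>

inductive big :: "com \<Rightarrow> store \<Rightarrow> nat \<Rightarrow> store \<Rightarrow> bool" where
  big_Skip: "big Skip s 0 s"
| big_Assign: "big (Assign x e) s 1 (set_var x (eval e s) s)"
| big_Update: "big (Update a e f) s 1 (set_arr a (eval e s) (eval f s) s)"
| big_Input: "big (Input x) s 1
    ((set_var x (case inputs s of [] \<Rightarrow> 0 | y # _ \<Rightarrow> y) s)\<lparr>inputs := tl (inputs s)\<rparr>)"
| big_Output: "big (Output e) s 1 (s\<lparr>outputs := outputs s @ [eval e s]\<rparr>)"
| big_Seq: "big c s t s' \<Longrightarrow> big d s' t' s'' \<Longrightarrow> big (c ;; d) s (t + t') s''"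
| big_If_True: "eval e s \<noteq> 0 \<Longrightarrow> big c s t s' \<Longrightarrow> big (If e c d) s (Suc t) s'"
| big_If_False: "eval e s = 0 \<Longrightarrow> big d s t s' \<Longrightarrow> big (If e c d) s (Suc t) s'"
| big_While_False: "eval e s = 0 \<Longrightarrow> big (While e c) s 1 s"
| big_While_True: "eval e s \<noteq> 0 \<Longrightarrow> big c s t s' \<Longrightarrow> big (While e c) s' t' s'' \<Longrightarrow>
    big (While e c) s (Suc (t + t')) s''"
| big_WhileInput_Nil: "inputs s = [] \<Longrightarrow> big (WhileInput c) s 1 s"
| big_WhileInput_Cons: "inputs s \<noteq> [] \<Longrightarrow> big c s t s' \<Longrightarrow> big (WhileInput c) s' t' s'' \<Longrightarrow>
    big (WhileInput c) s (Suc (t + t')) s''"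

text \<open>Memory is interleaved with stride 32: residue 0 holds the variables, residue 1 the
  temporaries of expression evaluation, and residue \<open>a + 2\<close> the unbounded array \<open>a\<close>. Thus an
  array access needs only a constant number of additions and arrays never collide.\<close>

abbreviation reg :: "nat \<Rightarrow> nat" where "reg x \<equiv> 32 * x"
abbreviation tmp :: "nat \<Rightarrow> nat" where "tmp d \<equiv> 32 * d + 1"
abbreviation cell :: "nat \<Rightarrow> nat \<Rightarrow> nat" where "cell a i \<equiv> 32 * i + a + 2"

text \<open>Five doublings multiply the index by the stride 32. The offset passes through the next
  temporary because addition takes registers only.\<close>

definition address :: "nat \<Rightarrow> nat \<Rightarrow> instr list" where
  "address a d = replicate 5 (Add (tmp d) (tmp d) (tmp d)) @
     [Const (tmp (Suc d)) (a + 2), Add (tmp d) (tmp d) (tmp (Suc d))]"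

primrec code_exp :: "exp \<Rightarrow> nat \<Rightarrow> instr list" where
  "code_exp (N n) d = [Const (tmp d) n]"
| "code_exp (V x) d = [Move (tmp d) (reg x)]"
| "code_exp (Arr a e) d = code_exp e d @ address a d @ [Load (tmp d) (tmp d)]"
| "code_exp (Plus e f) d =
     code_exp e d @ code_exp f (Suc d) @ [Add (tmp d) (tmp d) (tmp (Suc d))]"
| "code_exp (Minus e f) d =
     code_exp e d @ code_exp f (Suc d) @ [Sub (tmp d) (tmp d) (tmp (Suc d))]"

text \<open>Forward jumps need the length of code that is yet to be generated; this length does not
  depend on where the code is placed.\<close>

primrec code_size :: "com \<Rightarrow> nat" where
  "code_size Skip = 0"
| "code_size (Assign x e) = length (code_exp e 0) + 1"
| "code_size (Update a e f) =
     length (code_exp e 0) + length (address a 0) + length (code_exp f 1) + 1"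
| "code_size (Input x) = 1"
| "code_size (Output e) = length (code_exp e 0) + 1"
| "code_size (c ;; d) = code_size c + code_size d"
| "code_size (If e c d) = length (code_exp e 0) + code_size c + code_size d + 2"
| "code_size (While e c) = length (code_exp e 0) + code_size c + 2"
| "code_size (WhileInput c) = code_size c + 2"

primrec compile :: "nat \<Rightarrow> com \<Rightarrow> instr list" where
  "compile k Skip = []"
| "compile k (Assign x e) = code_exp e 0 @ [Move (reg x) (tmp 0)]"
| "compile k (Update a e f) =
     code_exp e 0 @ address a 0 @ code_exp f 1 @ [Store (tmp 0) (tmp 1)]"
| "compile k (Input x) = [Read (reg x)]"
| "compile k (Output e) = code_exp e 0 @ [Write (tmp 0)]"
| "compile k (c ;; d) = compile k c @ compile (k + code_size c) d"
| "compile k (If e c d) = (let l = k + length (code_exp e 0) in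
     code_exp e 0 @ [JZero (tmp 0) (l + code_size c + 2)] @ compile (l + 1) c @
     [Jump (l + code_size c + code_size d + 2)] @ compile (l + code_size c + 2) d)"
| "compile k (While e c) = (let l = k + length (code_exp e 0) in
     code_exp e 0 @ [JZero (tmp 0) (l + code_size c + 2)] @ compile (l + 1) c @ [Jump k])"
| "compile k (WhileInput c) = [JEof (k + code_size c + 2)] @ compile (k + 1) c @ [Jump k]"

lemma length_compile [simp]: "length (compile k c) = code_size c"
  by (induction c arbitrary: k) (simp_all add: Let_def)

text \<open>Machine steps paid by one unit of \<open>big\<close>. A test pays for evaluating its
  expression, for the conditional jump and for the jump behind the body. Parts are combined by a
  maximum, since their units are counted separately.\<close>

primrec unit_cost :: "com \<Rightarrow> nat" where
  "unit_cost Skip = 0"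
| "unit_cost (Assign x e) = length (code_exp e 0) + 1"
| "unit_cost (Update a e f) =
     length (code_exp e 0) + length (address a 0) + length (code_exp f 1) + 1"
| "unit_cost (Input x) = 1"
| "unit_cost (Output e) = length (code_exp e 0) + 1"
| "unit_cost (c ;; d) = max (unit_cost c) (unit_cost d)"
| "unit_cost (If e c d) = max (length (code_exp e 0) + 2) (max (unit_cost c) (unit_cost d))"
| "unit_cost (While e c) = max (length (code_exp e 0) + 2) (unit_cost c)"
| "unit_cost (WhileInput c) = max 2 (unit_cost c)"

text \<open>Arrays occupy the residues 2 to 31 modulo 32, which leaves room for 30 of them.\<close>

primrec exp_fits :: "exp \<Rightarrow> bool" where
  "exp_fits (N n) \<longleftrightarrow> True"
| "exp_fits (V x) \<longleftrightarrow> True"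
| "exp_fits (Arr a e) \<longleftrightarrow> a < 30 \<and> exp_fits e"
| "exp_fits (Plus e f) \<longleftrightarrow> exp_fits e \<and> exp_fits f"
| "exp_fits (Minus e f) \<longleftrightarrow> exp_fits e \<and> exp_fits f"

primrec com_fits :: "com \<Rightarrow> bool" where
  "com_fits Skip \<longleftrightarrow> True"
| "com_fits (Assign x e) \<longleftrightarrow> exp_fits e"
| "com_fits (Update a e f) \<longleftrightarrow> a < 30 \<and> exp_fits e \<and> exp_fits f"
| "com_fits (Input x) \<longleftrightarrow> True"
| "com_fits (Output e) \<longleftrightarrow> exp_fits e"
| "com_fits (c ;; d) \<longleftrightarrow> com_fits c \<and> com_fits d"
| "com_fits (If e c d) \<longleftrightarrow> exp_fits e \<and> com_fits c \<and> com_fits d"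
| "com_fits (While e c) \<longleftrightarrow> exp_fits e \<and> com_fits c"
| "com_fits (WhileInput c) \<longleftrightarrow> com_fits c"

section \<open>Simulation of the structured language by the machine\<close>

definition represents :: "ram \<Rightarrow> store \<Rightarrow> bool" where
  "represents \<sigma> s \<longleftrightarrow> (\<forall>x. mem \<sigma> (reg x) = vars s x) \<and>
     (\<forall>a i. a < 30 \<longrightarrow> mem \<sigma> (cell a i) = arrs s a i) \<and>
     inp \<sigma> = inputs s \<and> out \<sigma> = outputs s"

definition code_at :: "instr list \<Rightarrow> nat \<Rightarrow> instr list \<Rightarrow> bool" where
  "code_at P k is \<longleftrightarrow> k + length is \<le> length P \<and> (\<forall>i<length is. P ! (k + i) = is ! i)"

lemma code_at_append [simp]:
  "code_at P k (is @ js) \<longleftrightarrow> code_at P k is \<and> code_at P (k + length is) js"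
proof (intro iffI conjI)
  assume *: "code_at P k (is @ js)"
  show "code_at P k is"
    unfolding code_at_def
  proof (intro conjI allI impI)
    show "k + length is \<le> length P" using * by (simp add: code_at_def)
    fix i assume "i < length is"
    then show "P ! (k + i) = is ! i" using * by (auto simp: code_at_def nth_append)
  qed
  show "code_at P (k + length is) js"
    unfolding code_at_def
  proof (intro conjI allI impI)
    show "k + length is + length js \<le> length P" using * by (simp add: code_at_def)
    fix i assume "i < length js"
    then have "P ! (k + (length is + i)) = (is @ js) ! (length is + i)"
      using * unfolding code_at_def by (metis length_append nat_add_left_cancel_less)
    then show "P ! (k + length is + i) = js ! i" by (simp add: add.assoc)
  qed
next
  assume *: "code_at P k is \<and> code_at P (k + length is) js"
  show "code_at P k (is @ js)"
    unfolding code_at_def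
  proof (intro conjI allI impI)
    show "k + length (is @ js) \<le> length P" using * by (simp add: code_at_def)
    fix i assume i: "i < length (is @ js)"
    show "P ! (k + i) = (is @ js) ! i"
    proof (cases "i < length is")
      case True
      then show ?thesis using * by (simp add: code_at_def nth_append)
    next
      case False
      then have "i - length is < length js" using i by auto
      then have "P ! (k + length is + (i - length is)) = js ! (i - length is)"
        using * unfolding code_at_def by blast
      then show ?thesis using False by (simp add: nth_append)
    qed
  qed
qed

lemma code_at_Cons:
  "code_at P k (i # is) \<longleftrightarrow> code_at P k [i] \<and> code_at P (Suc k) is"
  using code_at_append[of P k "[i]" "is"] by simp

lemma step_code_at: "code_at P k [i] \<Longrightarrow> pc \<sigma> = k \<Longrightarrow> step P \<sigma> = exec i \<sigma>"
  by (simp add: code_at_def step_def halted_def)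

fun sequential :: "instr \<Rightarrow> bool" where
  "sequential (Jump l) \<longleftrightarrow> False"
| "sequential (JZero r l) \<longleftrightarrow> False"
| "sequential (JEof l) \<longleftrightarrow> False"
| "sequential _ \<longleftrightarrow> True"

lemma pc_exec: "sequential i \<Longrightarrow> pc (exec i \<sigma>) = Suc (pc \<sigma>)"
  by (cases i) (simp_all add: set_reg_def)

lemma run_sequential:
  assumes "list_all sequential is" "code_at P (pc \<sigma>) is"
  shows "(step P ^^ length is) \<sigma> = fold exec is \<sigma> \<and> pc (fold exec is \<sigma>) = pc \<sigma> + length is"
  using assms
proof (induction "is" arbitrary: \<sigma>)
  case Nil
  then show ?case by simp
next
  case (Cons i "is")
  have 1: "step P \<sigma> = exec i \<sigma>" "pc (exec i \<sigma>) = Suc (pc \<sigma>)"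
    using Cons.prems code_at_Cons[of P _ i "is"] by (auto intro: step_code_at pc_exec)
  then show ?case
    using Cons.IH[of "exec i \<sigma>"] Cons.prems code_at_Cons[of P _ i "is"]
    by (simp add: funpow_swap1)
qed

lemma address_eq:
  "address a d = (let i = Add (tmp d) (tmp d) (tmp d) in
     [i, i, i, i, i, Const (tmp (Suc d)) (a + 2), Add (tmp d) (tmp d) (tmp (Suc d))])"
proof -
  have "replicate 5 i = [i, i, i, i, i]" for i :: instr by (simp add: eval_nat_numeral)
  then show ?thesis by (simp add: address_def Let_def)
qed

lemma sequential_code_exp: "list_all sequential (code_exp e d)"
  by (induction e arbitrary: d) (auto simp: address_eq Let_def)

lemma sequential_address: "list_all sequential (address a d)"
  by (auto simp: address_eq Let_def)

text \<open>Evaluation at depth \<open>d\<close> may overwrite temporaries from \<open>d\<close> on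
  only; so the left operand in \<open>tmp d\<close> survives the evaluation of the right one at
  depth \<open>Suc d\<close>.\<close>

definition same_upto_tmp :: "nat \<Rightarrow> ram \<Rightarrow> ram \<Rightarrow> bool" where
  "same_upto_tmp d \<sigma> \<sigma>' \<longleftrightarrow> (\<forall>x. (\<forall>d'\<ge>d. x \<noteq> tmp d') \<longrightarrow> mem \<sigma>' x = mem \<sigma> x) \<and>
     inp \<sigma>' = inp \<sigma> \<and> out \<sigma>' = out \<sigma>"

lemma same_upto_tmp_trans:
  "same_upto_tmp d \<sigma> \<sigma>' \<Longrightarrow> same_upto_tmp d' \<sigma>' \<sigma>'' \<Longrightarrow> d \<le> d' \<Longrightarrow> same_upto_tmp d \<sigma> \<sigma>''"
  unfolding same_upto_tmp_def by (metis le_trans)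

lemma same_upto_tmp_less: "same_upto_tmp d \<sigma> \<sigma>' \<Longrightarrow> d' < d \<Longrightarrow> mem \<sigma>' (tmp d') = mem \<sigma> (tmp d')"
  unfolding same_upto_tmp_def by auto

lemma cell_mod_div: "a < 30 \<Longrightarrow> cell a i mod 32 = a + 2 \<and> cell a i div 32 = i"
proof -
  assume "a < 30"
  then have "(32 * i + (a + 2)) mod 32 = a + 2" "(32 * i + (a + 2)) div 32 = i"
    by (simp_all del: add_2_eq_Suc')
  then show ?thesis by (simp only: add.assoc)
qed

lemma tmp_mod: "tmp d mod 32 = 1" and reg_mod: "reg x mod 32 = 0"
  by presburger+

lemma cell_neq_tmp: "a < 30 \<Longrightarrow> cell a i \<noteq> tmp d"
  using cell_mod_div[of a i] tmp_mod[of d] by force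

lemma cell_neq_reg: "a < 30 \<Longrightarrow> cell a i \<noteq> reg x"
  using cell_mod_div[of a i] reg_mod[of x] by force

lemma reg_neq_tmp: "reg x \<noteq> tmp d"
  by presburger

lemma cell_eq_iff: "a < 30 \<Longrightarrow> b < 30 \<Longrightarrow> cell a i = cell b j \<longleftrightarrow> a = b \<and> i = j"
  using cell_mod_div[of a i] cell_mod_div[of b j] by force

lemma represents_same_upto_tmp:
  "represents \<sigma> s \<Longrightarrow> same_upto_tmp d \<sigma> \<sigma>' \<Longrightarrow> represents \<sigma>' s"
  unfolding represents_def same_upto_tmp_def
  using cell_neq_tmp reg_neq_tmp by metis

lemma fold_address:
  "mem (fold exec (address a d) \<sigma>) (tmp d) = cell a (mem \<sigma> (tmp d))"
  "same_upto_tmp d \<sigma> (fold exec (address a d) \<sigma>)"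
proof -
  have "tmp d \<noteq> tmp (Suc d)" by simp
  then show "mem (fold exec (address a d) \<sigma>) (tmp d) = cell a (mem \<sigma> (tmp d))"
    by (simp add: address_eq Let_def set_reg_def del: mult_Suc_right)
  have "x \<noteq> tmp d \<and> x \<noteq> tmp (Suc d)" if "\<forall>d'\<ge>d. x \<noteq> tmp d'" for x
    using that[rule_format, of d] that[rule_format, of "Suc d"] by simp
  then show "same_upto_tmp d \<sigma> (fold exec (address a d) \<sigma>)"
    by (simp add: same_upto_tmp_def address_eq Let_def set_reg_def del: mult_Suc_right)
qed

lemma fold_code_exp:
  assumes "represents \<sigma> s" "exp_fits e"
  shows "mem (fold exec (code_exp e d) \<sigma>) (tmp d) = eval e s \<and>
    same_upto_tmp d \<sigma> (fold exec (code_exp e d) \<sigma>)"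
  using assms
proof (induction e arbitrary: \<sigma> d)
  case (N n)
  then show ?case by (auto simp: set_reg_def same_upto_tmp_def)
next
  case (V x)
  then show ?case by (auto simp: set_reg_def same_upto_tmp_def represents_def)
next
  case (Arr a e)
  let ?\<sigma>1 = "fold exec (code_exp e d) \<sigma>" and ?\<sigma>2 = "fold exec (code_exp e d @ address a d) \<sigma>"
  have 1: "mem ?\<sigma>1 (tmp d) = eval e s" "same_upto_tmp d \<sigma> ?\<sigma>1"
    using Arr by auto
  have 2: "mem ?\<sigma>2 (tmp d) = cell a (eval e s)" "same_upto_tmp d ?\<sigma>1 ?\<sigma>2"
    using fold_address[where a = a and d = d and \<sigma> = ?\<sigma>1] 1 by simp_all
  have 3: "same_upto_tmp d \<sigma> ?\<sigma>2"
    using 1 2 same_upto_tmp_trans by blast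
  have 4: "mem ?\<sigma>2 (cell a (eval e s)) = arrs s a (eval e s)"
    using represents_same_upto_tmp[OF Arr.prems(1) 3] Arr.prems(2) by (simp add: represents_def)
  have 5: "fold exec (code_exp (Arr a e) d) \<sigma> = exec (Load (tmp d) (tmp d)) ?\<sigma>2"
    by simp
  show ?case
    unfolding 5 using 2(1) 3 4 by (auto simp: set_reg_def same_upto_tmp_def)
next
  case (Plus e f)
  let ?\<sigma>1 = "fold exec (code_exp e d) \<sigma>"
  let ?\<sigma>2 = "fold exec (code_exp f (Suc d)) ?\<sigma>1"
  have 1: "mem ?\<sigma>1 (tmp d) = eval e s" "same_upto_tmp d \<sigma> ?\<sigma>1"
    using Plus by auto
  have 2: "mem ?\<sigma>2 (tmp (Suc d)) = eval f s" "same_upto_tmp (Suc d) ?\<sigma>1 ?\<sigma>2"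
    using Plus.IH(2)[of ?\<sigma>1 "Suc d"] Plus.prems represents_same_upto_tmp[OF Plus.prems(1) 1(2)]
    by auto
  have 3: "same_upto_tmp d \<sigma> ?\<sigma>2"
    using 1 2 same_upto_tmp_trans by (meson le_SucI order_refl)
  have 4: "mem ?\<sigma>2 (tmp d) = eval e s"
    using same_upto_tmp_less[OF 2(2), of d] 1 by simp
  have 5: "fold exec (code_exp (Plus e f) d) \<sigma> = exec (Add (tmp d) (tmp d) (tmp (Suc d))) ?\<sigma>2"
    by simp
  show ?case
    unfolding 5 using 2(1) 3 4 by (auto simp: set_reg_def same_upto_tmp_def)
next
  case (Minus e f)
  let ?\<sigma>1 = "fold exec (code_exp e d) \<sigma>"
  let ?\<sigma>2 = "fold exec (code_exp f (Suc d)) ?\<sigma>1"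
  have 1: "mem ?\<sigma>1 (tmp d) = eval e s" "same_upto_tmp d \<sigma> ?\<sigma>1"
    using Minus by auto
  have 2: "mem ?\<sigma>2 (tmp (Suc d)) = eval f s" "same_upto_tmp (Suc d) ?\<sigma>1 ?\<sigma>2"
    using Minus.IH(2)[of ?\<sigma>1 "Suc d"] Minus.prems represents_same_upto_tmp[OF Minus.prems(1) 1(2)]
    by auto
  have 3: "same_upto_tmp d \<sigma> ?\<sigma>2"
    using 1 2 same_upto_tmp_trans by (meson le_SucI order_refl)
  have 4: "mem ?\<sigma>2 (tmp d) = eval e s"
    using same_upto_tmp_less[OF 2(2), of d] 1 by simp
  have 5: "fold exec (code_exp (Minus e f) d) \<sigma> = exec (Sub (tmp d) (tmp d) (tmp (Suc d))) ?\<sigma>2"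
    by simp
  show ?case
    unfolding 5 using 2(1) 3 4 by (auto simp: set_reg_def same_upto_tmp_def)
qed

lemma run_code_exp:
  assumes "represents \<sigma> s" "exp_fits e" "code_at P (pc \<sigma>) (code_exp e d)"
  obtains \<sigma>' where "(step P ^^ length (code_exp e d)) \<sigma> = \<sigma>'" "mem \<sigma>' (tmp d) = eval e s"
    "same_upto_tmp d \<sigma> \<sigma>'" "represents \<sigma>' s" "pc \<sigma>' = pc \<sigma> + length (code_exp e d)"
  using run_sequential[OF sequential_code_exp assms(3)] fold_code_exp[OF assms(1,2), of d]
    represents_same_upto_tmp[OF assms(1)] by metis

lemma run_address:
  assumes "represents \<sigma> s" "code_at P (pc \<sigma>) (address a d)"
  obtains \<sigma>' where "(step P ^^ length (address a d)) \<sigma> = \<sigma>'"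
    "mem \<sigma>' (tmp d) = cell a (mem \<sigma> (tmp d))"
    "same_upto_tmp d \<sigma> \<sigma>'" "represents \<sigma>' s" "pc \<sigma>' = pc \<sigma> + length (address a d)"
  using run_sequential[OF sequential_address assms(2)] fold_address[where a = a and d = d and \<sigma> = \<sigma>]
    represents_same_upto_tmp[OF assms(1)] by metis


lemma run_test:
  assumes "represents \<sigma> s" "exp_fits e" "code_at P (pc \<sigma>) (code_exp e 0)"
    "code_at P (pc \<sigma> + length (code_exp e 0)) [JZero (tmp 0) l]"
  obtains \<sigma>' where "(step P ^^ (length (code_exp e 0) + 1)) \<sigma> = \<sigma>'" "represents \<sigma>' s"
    "pc \<sigma>' = (if eval e s = 0 then l else pc \<sigma> + length (code_exp e 0) + 1)"
proof -
  obtain \<sigma>1 where 1: "(step P ^^ length (code_exp e 0)) \<sigma> = \<sigma>1" "mem \<sigma>1 (tmp 0) = eval e s"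
    "represents \<sigma>1 s" "pc \<sigma>1 = pc \<sigma> + length (code_exp e 0)"
    using run_code_exp[OF assms(1-3)] by metis
  have "step P \<sigma>1 = exec (JZero (tmp 0) l) \<sigma>1"
    using step_code_at assms(4) 1(4) by simp
  then show ?thesis
    using that[of "step P \<sigma>1"] 1 by (simp add: represents_def)
qed

lemma represents_set_var:
  "represents \<sigma> s \<Longrightarrow> represents (set_reg (reg x) n \<sigma>) (set_var x n s)"
  unfolding represents_def set_reg_def using cell_neq_reg by simp

lemma represents_set_arr:
  "represents \<sigma> s \<Longrightarrow> a < 30 \<Longrightarrow> represents (set_reg (cell a i) n \<sigma>) (set_arr a i n s)"
  unfolding represents_def set_reg_def
  using cell_neq_reg[of a i, symmetric] cell_eq_iff[of _ a _ i] by simp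

text \<open>\<open>W\<close> is any upper bound of the unit cost rather than the unit cost itself,
  so that the induction hypotheses for the parts hold with the bound of the whole command.\<close>

lemma compile_correct:
  assumes "big c s t s'" "com_fits c" "unit_cost c \<le> W"
    "code_at P (pc \<sigma>) (compile (pc \<sigma>) c)" "represents \<sigma> s"
  shows "\<exists>k \<sigma>'. k \<le> W * t \<and> (step P ^^ k) \<sigma> = \<sigma>' \<and> pc \<sigma>' = pc \<sigma> + code_size c \<and>
    represents \<sigma>' s'"
  using assms
proof (induction arbitrary: \<sigma> rule: big.induct)
  case (big_Skip s)
  then show ?case by (intro exI[of _ 0]) auto
next
  case (big_Assign x e s)
  then obtain \<sigma>1 where 1: "(step P ^^ length (code_exp e 0)) \<sigma> = \<sigma>1" "mem \<sigma>1 (tmp 0) = eval e s"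
    "represents \<sigma>1 s" "pc \<sigma>1 = pc \<sigma> + length (code_exp e 0)"
    using run_code_exp[of \<sigma> s e P 0] by (metis code_at_append com_fits.simps(2) compile.simps(2))
  have "step P \<sigma>1 = exec (Move (reg x) (tmp 0)) \<sigma>1"
    by (rule step_code_at[OF _ refl]) (use big_Assign.prems 1(4) in simp)
  then show ?case
    using 1 big_Assign.prems represents_set_var[OF 1(3), of x "eval e s"]
    by (intro exI[of _ "Suc (length (code_exp e 0))"] exI[of _ "step P \<sigma>1"]) (simp add: set_reg_def)
next
  case (big_Update a e f s)
  then have fits: "a < 30" "exp_fits e" "exp_fits f" by auto
  have code: "code_at P (pc \<sigma>) (code_exp e 0)"
    "code_at P (pc \<sigma> + length (code_exp e 0)) (address a 0)"
    "code_at P (pc \<sigma> + length (code_exp e 0) + length (address a 0)) (code_exp f 1)"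
    "code_at P (pc \<sigma> + length (code_exp e 0) + length (address a 0) + length (code_exp f 1))
       [Store (tmp 0) (tmp 1)]"
    using big_Update.prems(3) by (simp_all add: add.assoc)
  obtain \<sigma>1 where 1: "(step P ^^ length (code_exp e 0)) \<sigma> = \<sigma>1" "mem \<sigma>1 (tmp 0) = eval e s"
    "represents \<sigma>1 s" "pc \<sigma>1 = pc \<sigma> + length (code_exp e 0)"
    using run_code_exp[OF big_Update.prems(4) fits(2) code(1)] by metis
  obtain \<sigma>2 where 2: "(step P ^^ length (address a 0)) \<sigma>1 = \<sigma>2" "mem \<sigma>2 (tmp 0) = cell a (eval e s)"
    "represents \<sigma>2 s" "pc \<sigma>2 = pc \<sigma> + length (code_exp e 0) + length (address a 0)"
    using run_address[of \<sigma>1 s P a 0] 1 code(2) by metis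
  obtain \<sigma>3 where 3: "(step P ^^ length (code_exp f 1)) \<sigma>2 = \<sigma>3" "mem \<sigma>3 (tmp 1) = eval f s"
    "same_upto_tmp 1 \<sigma>2 \<sigma>3" "represents \<sigma>3 s"
    "pc \<sigma>3 = pc \<sigma> + length (code_exp e 0) + length (address a 0) + length (code_exp f 1)"
    using run_code_exp[of \<sigma>2 s f P 1] 2 fits(3) code(3) by metis
  \<comment> \<open>The value to be stored was evaluated at depth 1, which leaves the address in
    \<open>tmp 0\<close> untouched.\<close>
  have 4: "mem \<sigma>3 (tmp 0) = cell a (eval e s)"
    using same_upto_tmp_less[OF 3(3), of 0] 2(2) by simp
  have 5: "step P \<sigma>3 = exec (Store (tmp 0) (tmp 1)) \<sigma>3"
    using step_code_at code(4) 3(5) by blast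
  have 6: "step P \<sigma>3 = set_reg (cell a (eval e s)) (eval f s) \<sigma>3"
    unfolding 5 exec.simps 4 3(2) ..
  let ?k = "Suc (length (code_exp f 1) + (length (address a 0) + length (code_exp e 0)))"
  have 7: "(step P ^^ ?k) \<sigma> = step P \<sigma>3"
    using 1(1) 2(1) 3(1) by (simp only: funpow.simps funpow_add o_apply)
  show ?case
    by (intro exI[of _ ?k] exI[of _ "step P \<sigma>3"], unfold 7)
      (use big_Update.prems 3(5) 6 represents_set_arr[OF 3(4) fits(1)] in
        \<open>simp add: set_reg_def\<close>)
next
  case (big_Input x s)
  then have "step P \<sigma> = exec (Read (reg x)) \<sigma>"
    using step_code_at by simp
  moreover have "represents (exec (Read (reg x)) \<sigma>)
      ((set_var x (case inputs s of [] \<Rightarrow> 0 | y # _ \<Rightarrow> y) s)\<lparr>inputs := tl (inputs s)\<rparr>)"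
    using represents_set_var[OF big_Input.prems(4)] big_Input.prems(4)
    by (simp add: represents_def next_input_def)
  ultimately show ?case
    using big_Input.prems
    by (intro exI[of _ 1] exI[of _ "step P \<sigma>"]) (simp add: set_reg_def)
next
  case (big_Output e s)
  then obtain \<sigma>1 where 1: "(step P ^^ length (code_exp e 0)) \<sigma> = \<sigma>1" "mem \<sigma>1 (tmp 0) = eval e s"
    "represents \<sigma>1 s" "pc \<sigma>1 = pc \<sigma> + length (code_exp e 0)"
    using run_code_exp[of \<sigma> s e P 0] by (metis code_at_append com_fits.simps(5) compile.simps(5))
  have "step P \<sigma>1 = exec (Write (tmp 0)) \<sigma>1"
    by (rule step_code_at[OF _ refl]) (use big_Output.prems 1(4) in simp)
  then show ?case
    using 1 big_Output.prems
    by (intro exI[of _ "Suc (length (code_exp e 0))"] exI[of _ "step P \<sigma>1"])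
      (simp add: represents_def)
next
  case (big_Seq c s t s' d t' s'')
  obtain k1 \<sigma>1 where 1: "k1 \<le> W * t" "(step P ^^ k1) \<sigma> = \<sigma>1" "pc \<sigma>1 = pc \<sigma> + code_size c"
    "represents \<sigma>1 s'"
    using big_Seq.IH(1)[of \<sigma>] big_Seq.prems by auto
  obtain k2 \<sigma>2 where 2: "k2 \<le> W * t'" "(step P ^^ k2) \<sigma>1 = \<sigma>2" "pc \<sigma>2 = pc \<sigma>1 + code_size d"
    "represents \<sigma>2 s''"
    using big_Seq.IH(2)[of \<sigma>1] big_Seq.prems 1 by auto
  have "(step P ^^ (k2 + k1)) \<sigma> = \<sigma>2" using 1 2 by (simp add: funpow_add)
  then show ?case
    using 1 2 by (intro exI[of _ "k2 + k1"] exI[of _ \<sigma>2]) (simp add: add_mult_distrib2)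
next
  case (big_If_True e s c t s' d)
  let ?l = "length (code_exp e 0)"
  obtain \<sigma>1 where 1: "(step P ^^ (?l + 1)) \<sigma> = \<sigma>1" "represents \<sigma>1 s" "pc \<sigma>1 = pc \<sigma> + ?l + 1"
    using run_test[of \<sigma> s e P] big_If_True.prems big_If_True.hyps(1)
    by (simp add: Let_def code_at_Cons[of P _ _ "compile _ _ @ _"]) metis
  obtain k2 \<sigma>2 where 2: "k2 \<le> W * t" "(step P ^^ k2) \<sigma>1 = \<sigma>2" "pc \<sigma>2 = pc \<sigma>1 + code_size c"
    "represents \<sigma>2 s'"
    using big_If_True.IH[of \<sigma>1] big_If_True.prems 1
    by (auto simp: Let_def code_at_Cons[of P _ _ "compile _ _ @ _"])
  have "code_at P (pc \<sigma>2) [Jump (pc \<sigma> + ?l + code_size c + code_size d + 2)]"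
    using big_If_True.prems 1 2
    by (simp add: Let_def code_at_Cons[of P _ _ "compile _ _ @ _"]
      code_at_Cons[of P _ _ "compile _ _"] add_ac)
  then have 3: "step P \<sigma>2 = \<sigma>2\<lparr>pc := pc \<sigma> + ?l + code_size c + code_size d + 2\<rparr>"
    using step_code_at by simp
  have "(step P ^^ (1 + (k2 + (?l + 1)))) \<sigma> = step P \<sigma>2"
    using 1(1) 2(2) by (simp only: funpow_add o_apply) simp
  then show ?case
    using 2 3 big_If_True.prems
    by (intro exI[of _ "1 + (k2 + (?l + 1))"] exI[of _ "step P \<sigma>2"]) (simp add: represents_def)
next
  case (big_If_False e s d t s' c)
  let ?l = "length (code_exp e 0)"
  obtain \<sigma>1 where 1: "(step P ^^ (?l + 1)) \<sigma> = \<sigma>1" "represents \<sigma>1 s"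
    "pc \<sigma>1 = pc \<sigma> + ?l + code_size c + 2"
    using run_test[of \<sigma> s e P] big_If_False.prems big_If_False.hyps(1)
    by (simp add: Let_def code_at_Cons[of P _ _ "compile _ _ @ _"]) metis
  have code: "code_at P (pc \<sigma>1) (compile (pc \<sigma>1) d)"
    using big_If_False.prems 1
    by (simp add: Let_def code_at_Cons[of P _ _ "compile _ _ @ _"]
      code_at_Cons[of P _ _ "compile _ _"] add_ac)
  obtain k2 \<sigma>2 where 2: "k2 \<le> W * t" "(step P ^^ k2) \<sigma>1 = \<sigma>2" "pc \<sigma>2 = pc \<sigma>1 + code_size d"
    "represents \<sigma>2 s'"
    using big_If_False.IH[OF _ _ code] big_If_False.prems 1 by auto
  have "(step P ^^ (k2 + (?l + 1))) \<sigma> = \<sigma>2"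
    using 1(1) 2(2) by (simp only: funpow_add o_apply)
  then show ?case
    using 1 2 big_If_False.prems
    by (intro exI[of _ "k2 + (?l + 1)"] exI[of _ \<sigma>2]) simp
next
  case (big_While_False e s c)
  let ?l = "length (code_exp e 0)"
  obtain \<sigma>1 where 1: "(step P ^^ (?l + 1)) \<sigma> = \<sigma>1" "represents \<sigma>1 s"
    "pc \<sigma>1 = pc \<sigma> + ?l + code_size c + 2"
    using run_test[of \<sigma> s e P] big_While_False.prems big_While_False.hyps(1)
    by (simp add: Let_def code_at_Cons[of P _ _ "compile _ _ @ _"]) metis
  then show ?case
    using big_While_False.prems by (intro exI[of _ "?l + 1"] exI[of _ \<sigma>1]) simp
next
  case (big_While_True e s c t s' t' s'')
  let ?l = "length (code_exp e 0)"
  obtain \<sigma>1 where 1: "(step P ^^ (?l + 1)) \<sigma> = \<sigma>1" "represents \<sigma>1 s" "pc \<sigma>1 = pc \<sigma> + ?l + 1"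
    using run_test[of \<sigma> s e P] big_While_True.prems big_While_True.hyps(1)
    by (simp add: Let_def code_at_Cons[of P _ _ "compile _ _ @ _"]) metis
  obtain k2 \<sigma>2 where 2: "k2 \<le> W * t" "(step P ^^ k2) \<sigma>1 = \<sigma>2" "pc \<sigma>2 = pc \<sigma>1 + code_size c"
    "represents \<sigma>2 s'"
    using big_While_True.IH(1)[of \<sigma>1] big_While_True.prems 1
    by (auto simp: Let_def code_at_Cons[of P _ _ "compile _ _ @ _"])
  have "code_at P (pc \<sigma>2) [Jump (pc \<sigma>)]"
    using big_While_True.prems 1 2
    by (simp add: Let_def code_at_Cons[of P _ _ "compile _ _ @ _"] add_ac)
  then have 3: "step P \<sigma>2 = \<sigma>2\<lparr>pc := pc \<sigma>\<rparr>"
    using step_code_at by simp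
  obtain k4 \<sigma>4 where 4: "k4 \<le> W * t'" "(step P ^^ k4) (step P \<sigma>2) = \<sigma>4"
    "pc \<sigma>4 = pc \<sigma> + code_size (While e c)" "represents \<sigma>4 s''"
    using big_While_True.IH(2)[of "step P \<sigma>2"] big_While_True.prems 2(4) 3
    by (auto simp: represents_def)
  have "(step P ^^ (k4 + (1 + (k2 + (?l + 1))))) \<sigma> = \<sigma>4"
    using 1(1) 2(2) 4(2) by (simp only: funpow_add o_apply) simp
  moreover have "k4 + (1 + (k2 + (?l + 1))) \<le> W * Suc (t + t')"
    using 2(1) 4(1) big_While_True.prems(2) by (simp add: algebra_simps)
  ultimately show ?case
    using 4 by blast
next
  case (big_WhileInput_Nil s c)
  then have "step P \<sigma> = exec (JEof (pc \<sigma> + code_size c + 2)) \<sigma>"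
    using step_code_at code_at_Cons[of P "pc \<sigma>" _ "compile _ _ @ _"] by auto
  then show ?case
    using big_WhileInput_Nil by (intro exI[of _ 1] exI[of _ "step P \<sigma>"]) (simp add: represents_def)
next
  case (big_WhileInput_Cons s c t s' t' s'')
  have code: "code_at P (pc \<sigma>) [JEof (pc \<sigma> + code_size c + 2)]"
    "code_at P (Suc (pc \<sigma>)) (compile (Suc (pc \<sigma>)) c)"
    "code_at P (pc \<sigma> + 1 + code_size c) [Jump (pc \<sigma>)]"
    using big_WhileInput_Cons.prems code_at_Cons[of P "pc \<sigma>" _ "compile _ _ @ _"] by auto
  have 1: "step P \<sigma> = \<sigma>\<lparr>pc := Suc (pc \<sigma>)\<rparr>"
    using step_code_at[OF code(1)] big_WhileInput_Cons.prems(4) big_WhileInput_Cons.hyps(1)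
    by (simp add: represents_def)
  obtain k2 \<sigma>2 where 2: "k2 \<le> W * t" "(step P ^^ k2) (step P \<sigma>) = \<sigma>2"
    "pc \<sigma>2 = Suc (pc \<sigma>) + code_size c" "represents \<sigma>2 s'"
    using big_WhileInput_Cons.IH(1)[of "step P \<sigma>"] big_WhileInput_Cons.prems 1 code(2)
    by (auto simp: represents_def)
  have 3: "step P \<sigma>2 = \<sigma>2\<lparr>pc := pc \<sigma>\<rparr>"
    using step_code_at[OF code(3), of \<sigma>2] 2 by simp
  obtain k4 \<sigma>4 where 4: "k4 \<le> W * t'" "(step P ^^ k4) (step P \<sigma>2) = \<sigma>4"
    "pc \<sigma>4 = pc \<sigma> + code_size (WhileInput c)" "represents \<sigma>4 s''"
    using big_WhileInput_Cons.IH(2)[of "step P \<sigma>2"] big_WhileInput_Cons.prems 2(4) 3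
    by (auto simp: represents_def)
  have "(step P ^^ (k4 + (1 + (k2 + 1)))) \<sigma> = \<sigma>4"
    using 2(2) 4(2) by (simp only: funpow_add o_apply) simp
  moreover have "k4 + (1 + (k2 + 1)) \<le> W * Suc (t + t')"
    using 2(1) 4(1) big_WhileInput_Cons.prems(2) by (simp add: algebra_simps)
  ultimately show ?case
    using 4 by blast
qed

definition init :: "nat list \<Rightarrow> store" where
  "init xs = \<lparr>vars = (\<lambda>_. 0), arrs = (\<lambda>_ _. 0), inputs = xs, outputs = []\<rparr>"

lemma halted_step: "halted P \<sigma> \<Longrightarrow> (step P ^^ k) \<sigma> = \<sigma>"
  by (induction k) (simp_all add: step_def)

lemma computes_within_compile:
  assumes "big c (init xs) t s'" "com_fits c" "unit_cost c * t \<le> T"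
  shows "computes_within (compile 0 c) xs T (outputs s')"
proof -
  have "represents (initial xs) (init xs)"
    by (simp add: represents_def initial_def init_def)
  moreover have "code_at (compile 0 c) 0 (compile 0 c)" by (simp add: code_at_def)
  ultimately obtain k \<sigma> where k: "k \<le> unit_cost c * t" "(step (compile 0 c) ^^ k) (initial xs) = \<sigma>"
    "pc \<sigma> = code_size c" "represents \<sigma> s'"
    using compile_correct[OF assms(1,2) order_refl, of "compile 0 c" "initial xs"]
    by (auto simp: initial_def)
  \<comment> \<open>The machine has halted after \<open>k\<close> steps, so running it for the
    remaining \<open>T - k\<close> steps changes nothing.\<close>
  have "T = (T - k) + k" using k(1) assms(3) by simp
  then have "run (compile 0 c) xs T = (step (compile 0 c) ^^ (T - k)) \<sigma>"
    using k(2) unfolding run_def by (metis comp_apply funpow_add)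
  also have "\<dots> = \<sigma>" using k(3) by (intro halted_step) (simp add: halted_def)
  finally show ?thesis
    using k(3,4) by (simp add: computes_within_def halted_def represents_def)
qed

section \<open>Logarithmic cost\<close>

lemma bits_le: "n < 2 ^ k \<Longrightarrow> bits n \<le> Suc k"
  unfolding bits_def using floorlog_leI[of n 2 k] by simp

lemma less_two_power_bits: "n < 2 ^ bits n"
proof -
  have "n < 2 ^ floorlog 2 n" by (rule floorlog_leD) simp_all
  also have "\<dots> \<le> 2 ^ bits n" unfolding bits_def by (intro power_increasing) simp_all
  finally show ?thesis .
qed

definition bounded_by :: "nat \<Rightarrow> ram \<Rightarrow> bool" where
  "bounded_by k \<sigma> \<longleftrightarrow> (\<forall>x. mem \<sigma> x < 2 ^ k) \<and> (\<forall>x\<in>set (inp \<sigma>). x < 2 ^ k)"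

text \<open>Jump targets are left out: they never enter a register and the logarithmic cost does not
  charge for them.\<close>

fun literals :: "instr \<Rightarrow> nat list" where
  "literals (Const r n) = [r, n]"
| "literals (Move r a) = [r, a]"
| "literals (Add r a b) = [r, a, b]"
| "literals (Sub r a b) = [r, a, b]"
| "literals (Load r a) = [r, a]"
| "literals (Store r a) = [r, a]"
| "literals (Jump l) = []"
| "literals (JZero r l) = [r]"
| "literals (JEof l) = []"
| "literals (Read r) = [r]"
| "literals (Write r) = [r]"

lemma bounded_by_set_reg:
  "bounded_by k \<sigma> \<Longrightarrow> n < 2 ^ Suc k \<Longrightarrow> bounded_by (Suc k) (set_reg r n \<sigma>)"
  unfolding bounded_by_def set_reg_def by (auto intro: less_trans[of _ "2 ^ k"])

lemma next_input_less: "bounded_by k \<sigma> \<Longrightarrow> next_input \<sigma> < 2 ^ k"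
  unfolding bounded_by_def next_input_def by (cases "inp \<sigma>") auto

lemma bounded_by_exec:
  assumes b: "bounded_by k \<sigma>" and l: "\<forall>n\<in>set (literals i). n < 2 ^ k"
  shows "bounded_by (Suc k) (exec i \<sigma>)"
proof -
  have m: "mem \<sigma> x < 2 ^ k" for x using b by (simp add: bounded_by_def)
  have m': "mem \<sigma> x < 2 ^ Suc k" "mem \<sigma> x + mem \<sigma> y < 2 ^ Suc k" "mem \<sigma> x - mem \<sigma> y < 2 ^ Suc k"
    for x y
    using m[of x] m[of y] by auto
  have b': "bounded_by (Suc k) \<sigma>"
    using b unfolding bounded_by_def by (auto intro: less_trans[of _ "2 ^ k"])
  show ?thesis
  proof (cases i)
    case (Read r)
    have "bounded_by (Suc k) (set_reg r (next_input \<sigma>) \<sigma>)"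
      using bounded_by_set_reg[OF b] next_input_less[OF b] by simp
    moreover have "set (tl (inp \<sigma>)) \<subseteq> set (inp \<sigma>)"
      by (cases "inp \<sigma>") auto
    ultimately show ?thesis
      using Read by (auto simp: bounded_by_def set_reg_def)
  qed (use m' b' l in \<open>auto simp: bounded_by_def set_reg_def\<close>)
qed

text \<open>An instruction is charged 1 and the lengths of at most five numbers of at most
  \<open>k + 1\<close> bits each.\<close>

lemma instr_cost_le:
  assumes b: "bounded_by k \<sigma>" and l: "\<forall>n\<in>set (literals i). n < 2 ^ k"
  shows "instr_cost i \<sigma> \<le> 5 * k + 6"
proof -
  have m: "bits (mem \<sigma> x) \<le> Suc k" for x using b by (simp add: bounded_by_def bits_le)
  have n: "bits (next_input \<sigma>) \<le> Suc k" using next_input_less[OF b] by (rule bits_le)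
  have l': "\<forall>n\<in>set (literals i). bits n \<le> Suc k" using l bits_le by blast
  show ?thesis
  proof (cases i)
    case (Add r x y)
    then show ?thesis using l' m[of x] m[of y] by simp
  next
    case (Sub r x y)
    then show ?thesis using l' m[of x] m[of y] by simp
  next
    case (Load r x)
    then show ?thesis using l' m[of x] m[of "mem \<sigma> x"] by simp
  next
    case (Store r x)
    then show ?thesis using l' m[of x] m[of r] by simp
  next
    case (Move r x)
    then show ?thesis using l' m[of x] by simp
  next
    case (JZero r x)
    then show ?thesis using l' m[of r] by simp
  next
    case (Write r)
    then show ?thesis using l' m[of r] by simp
  qed (use l' n in auto)
qed

lemma input_size_ge:
  "x \<in> set xs \<Longrightarrow> bits x \<le> input_size xs" "length xs \<le> input_size xs"
proof -
  show "x \<in> set xs \<Longrightarrow> bits x \<le> input_size xs"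
    unfolding input_size_def by (induction xs) auto
  have "Suc 0 \<le> bits x" for x unfolding bits_def by simp
  then have "Suc n \<le> bits x + m" if "n \<le> m" for n m x
    using add_mono[OF _ that] by fastforce
  then show "length xs \<le> input_size xs"
    unfolding input_size_def by (induction xs) auto
qed

text \<open>The arithmetic operations at most double the largest number, so after \<open>t\<close> steps every
  number has at most \<open>t\<close> bits more than the input and the program.\<close>

lemma log_cost_le: "\<exists>B. \<forall>xs t. log_cost P xs t \<le> t * (5 * (B + input_size xs + t) + 6)"
proof -
  define B where "B = (\<Sum>i\<leftarrow>P. \<Sum>n\<leftarrow>literals i. bits n)"
  have B: "bits n \<le> B" if "i \<in> set P" "n \<in> set (literals i)" for i n
  proof -
    have "bits n \<le> (\<Sum>n\<leftarrow>literals i. bits n)"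
      using that(2) by (simp add: member_le_sum_list)
    also have "\<dots> \<le> B"
      unfolding B_def using that(1) by (simp add: member_le_sum_list)
    finally show ?thesis .
  qed
  have "log_cost P xs t \<le> t * (5 * (B + input_size xs + t) + 6)" for xs t
  proof -
    let ?k = "B + input_size xs"
    have lit: "\<forall>n\<in>set (literals i). n < 2 ^ (?k + j)" if "i \<in> set P" for i j
    proof
      fix n assume n: "n \<in> set (literals i)"
      have "n < 2 ^ bits n" by (rule less_two_power_bits)
      also have "\<dots> \<le> 2 ^ (?k + j)" using B[OF that n] by (intro power_increasing) simp_all
      finally show "n < 2 ^ (?k + j)" .
    qed
    have bnd: "bounded_by (?k + j) (run P xs j)" for j
    proof (induction j)
      case 0
      have "x < 2 ^ ?k" if "x \<in> set xs" for x
      proof -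
        have "x < 2 ^ bits x" by (rule less_two_power_bits)
        also have "\<dots> \<le> 2 ^ ?k" using input_size_ge(1)[OF that] by (intro power_increasing) simp_all
        finally show ?thesis .
      qed
      then show ?case by (simp add: run_def initial_def bounded_by_def)
    next
      case (Suc j)
      show ?case
      proof (cases "halted P (run P xs j)")
        case True
        then show ?thesis
          using Suc unfolding run_def bounded_by_def
          by (auto simp: step_def intro: less_trans[of _ "2 ^ (?k + j)"])
      next
        case False
        then have "P ! pc (run P xs j) \<in> set P" by (simp add: halted_def)
        from bounded_by_exec[OF Suc lit[OF this]] False show ?thesis
          by (simp add: run_def step_def)
      qed
    qed
    have "step_cost P (run P xs j) \<le> 5 * (?k + t) + 6" if "j < t" for j
    proof (cases "halted P (run P xs j)")
      case False
      then have "P ! pc (run P xs j) \<in> set P" by (simp add: halted_def)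
      from instr_cost_le[OF bnd lit[OF this], of j] False that show ?thesis
        by (simp add: step_cost_def)
    qed (simp add: step_cost_def)
    then have "log_cost P xs t \<le> (\<Sum>i<t. 5 * (?k + t) + 6)"
      unfolding log_cost_def by (intro sum_mono) simp
    then show ?thesis by simp
  qed
  then show ?thesis by blast
qed

text \<open>Every number occupies at least one bit, so a step count quadratic in the length is
  quadratic in the input size; multiplied by the cost of a single step, which is linear in input
  size and time, it stays polynomial.\<close>

lemma class_P_I:
  fixes c :: com and C :: nat
  assumes "com_fits c"
    and "\<And>xs. \<exists>t s. big c (init xs) t s \<and> outputs s = [if xs \<in> L then 1 else 0] \<and>
      t \<le> C * (length xs + 1)\<^sup>2"
  shows "L \<in> class_P"
proof -
  obtain B where B: "\<And>xs t. log_cost (compile 0 c) xs t \<le> t * (5 * (B + input_size xs + t) + 6)"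
    using log_cost_le by blast
  define D where "D = unit_cost c * C"
  \<comment> \<open>The bound of \<open>log_cost_le\<close> with
    \<open>D * (k + 1) * (k + 1)\<close> substituted for the time, as a polynomial in the input size
    \<open>k\<close>.\<close>
  define q :: "nat poly" where "q = [:D:] * [:1, 1:]\<^sup>2 *
    ([:5:] * ([:B, 1:] + [:D:] * [:1, 1:]\<^sup>2) + [:6:])"
  show ?thesis
    unfolding class_P_def mem_Collect_eq
  proof (intro exI[of _ "compile 0 c"] exI[of _ q] allI)
    fix xs
    let ?n = "input_size xs"
    obtain t s where t: "big c (init xs) t s" "outputs s = [if xs \<in> L then 1 else 0]"
      "t \<le> C * (length xs + 1)\<^sup>2"
      using assms(2) by blast
    define T where "T = D * (?n + 1)\<^sup>2"
    have "t \<le> C * (?n + 1)\<^sup>2"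
      using t(3) input_size_ge(2)[of xs]
      by (meson add_le_mono1 le_trans mult_le_mono2 power_mono zero_le)
    then have "unit_cost c * t \<le> T"
      unfolding T_def D_def by (simp add: mult.assoc)
    from computes_within_compile[OF t(1) assms(1) this]
    have "computes_within (compile 0 c) xs T [if xs \<in> L then 1 else 0]"
      using t(2) by simp
    moreover have "log_cost (compile 0 c) xs T \<le> poly q ?n"
      using B[of xs T] unfolding q_def T_def by (simp add: algebra_simps power2_eq_square)
    ultimately show "\<exists>t. computes_within (compile 0 c) xs t [if xs \<in> L then 1 else 0] \<and>
        log_cost (compile 0 c) xs t \<le> poly q ?n" by blast
  qed
qed

section \<open>Weakest preconditions with time\<close>

text \<open>Total correctness with a clock: \<open>t\<close> is the time before the command, and the
  postcondition sees the time after it.\<close>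

definition wp :: "com \<Rightarrow> (store \<Rightarrow> nat \<Rightarrow> bool) \<Rightarrow> store \<Rightarrow> nat \<Rightarrow> bool" where
  "wp c Q s t \<longleftrightarrow> (\<exists>t' s'. big c s t' s' \<and> Q s' (t + t'))"

inductive_cases big_elims:
  "big Skip s t s'" "big (Assign x e) s t s'" "big (Update a e f) s t s'" "big (Input x) s t s'"
  "big (Output e) s t s'" "big (c ;; d) s t s'" "big (If e c d) s t s'"

lemma big_atomic:
  "big Skip s t s' \<longleftrightarrow> t = 0 \<and> s' = s"
  "big (Assign x e) s t s' \<longleftrightarrow> t = 1 \<and> s' = set_var x (eval e s) s"
  "big (Update a e f) s t s' \<longleftrightarrow> t = 1 \<and> s' = set_arr a (eval e s) (eval f s) s"
  "big (Input x) s t s' \<longleftrightarrow> t = 1 \<and> s' = (set_var x (case inputs s of [] \<Rightarrow> 0 | y # _ \<Rightarrow> y) s)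
      \<lparr>inputs := tl (inputs s)\<rparr>"
  "big (Output e) s t s' \<longleftrightarrow> t = 1 \<and> s' = s\<lparr>outputs := outputs s @ [eval e s]\<rparr>"
  by (auto elim: big_elims intro: big_Skip big_Assign[unfolded One_nat_def]
    big_Update[unfolded One_nat_def] big_Input[unfolded One_nat_def]
    big_Output[unfolded One_nat_def])

lemma wp_simps [simp]:
  "wp Skip Q = Q"
  "wp (Assign x e) Q = (\<lambda>s t. Q (set_var x (eval e s) s) (Suc t))"
  "wp (Update a e f) Q = (\<lambda>s t. Q (set_arr a (eval e s) (eval f s) s) (Suc t))"
  "wp (Input x) Q = (\<lambda>s t. Q ((set_var x (case inputs s of [] \<Rightarrow> 0 | y # _ \<Rightarrow> y) s)
      \<lparr>inputs := tl (inputs s)\<rparr>) (Suc t))"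
  "wp (Output e) Q = (\<lambda>s t. Q (s\<lparr>outputs := outputs s @ [eval e s]\<rparr>) (Suc t))"
  "wp (c ;; d) Q = wp c (wp d Q)"
  "wp (If e c d) Q = (\<lambda>s t. if eval e s \<noteq> 0 then wp c Q s (Suc t) else wp d Q s (Suc t))"
proof -
  have seq: "big (c ;; d) s t s'' \<longleftrightarrow> (\<exists>t1 t2 s'. t = t1 + t2 \<and> big c s t1 s' \<and> big d s' t2 s'')"
    for s t s''
    by (rule iffI, erule big_elims, blast, blast intro: big_Seq)
  show "wp (c ;; d) Q = wp c (wp d Q)"
    unfolding wp_def seq fun_eq_iff by (metis add.assoc)
  have if': "big (If e c d) s t s' \<longleftrightarrow>
      (\<exists>t'. t = Suc t' \<and> (if eval e s \<noteq> 0 then big c s t' s' else big d s t' s'))" for s t s'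
    by (auto elim: big_elims intro: big_If_True big_If_False)
  show "wp (If e c d) Q = (\<lambda>s t. if eval e s \<noteq> 0 then wp c Q s (Suc t) else wp d Q s (Suc t))"
    unfolding wp_def if' fun_eq_iff
  proof (intro allI)
    have shift: "(\<exists>t' s'. (\<exists>u. t' = Suc u \<and> R u s') \<and> Q s' (t + t')) \<longleftrightarrow>
        (\<exists>u s'. R u s' \<and> Q s' (Suc t + u))" for R :: "nat \<Rightarrow> store \<Rightarrow> bool" and t
      by (metis add_Suc add_Suc_right)
    show "(\<exists>t' s'. (\<exists>t''. t' = Suc t'' \<and> (if eval e s \<noteq> 0 then big c s t'' s' else big d s t'' s')) \<and>
        Q s' (t + t')) = (if eval e s \<noteq> 0 then \<exists>t' s'. big c s t' s' \<and> Q s' (Suc t + t')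
        else \<exists>t' s'. big d s t' s' \<and> Q s' (Suc t + t'))" for s t
      unfolding shift by simp
  qed
qed (auto simp: wp_def big_atomic fun_eq_iff)

lemma wp_mono: "wp c Q s t \<Longrightarrow> (\<And>s' t'. Q s' t' \<Longrightarrow> Q' s' t') \<Longrightarrow> wp c Q' s t"
  unfolding wp_def by blast

section \<open>Frame conditions and counting loops\<close>

primrec changed_vars :: "com \<Rightarrow> nat set" where
  "changed_vars Skip = {}"
| "changed_vars (Assign x e) = {x}"
| "changed_vars (Update a e f) = {}"
| "changed_vars (Input x) = {x}"
| "changed_vars (Output e) = {}"
| "changed_vars (c ;; d) = changed_vars c \<union> changed_vars d"
| "changed_vars (If e c d) = changed_vars c \<union> changed_vars d"
| "changed_vars (While e c) = changed_vars c"
| "changed_vars (WhileInput c) = changed_vars c"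

primrec changed_arrs :: "com \<Rightarrow> nat set" where
  "changed_arrs Skip = {}"
| "changed_arrs (Assign x e) = {}"
| "changed_arrs (Update a e f) = {a}"
| "changed_arrs (Input x) = {}"
| "changed_arrs (Output e) = {}"
| "changed_arrs (c ;; d) = changed_arrs c \<union> changed_arrs d"
| "changed_arrs (If e c d) = changed_arrs c \<union> changed_arrs d"
| "changed_arrs (While e c) = changed_arrs c"
| "changed_arrs (WhileInput c) = changed_arrs c"

primrec silent :: "com \<Rightarrow> bool" where
  "silent Skip \<longleftrightarrow> True"
| "silent (Assign x e) \<longleftrightarrow> True"
| "silent (Update a e f) \<longleftrightarrow> True"
| "silent (Input x) \<longleftrightarrow> True"
| "silent (Output e) \<longleftrightarrow> False"
| "silent (c ;; d) \<longleftrightarrow> silent c \<and> silent d"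
| "silent (If e c d) \<longleftrightarrow> silent c \<and> silent d"
| "silent (While e c) \<longleftrightarrow> silent c"
| "silent (WhileInput c) \<longleftrightarrow> silent c"

text \<open>A syntactic bound on what a command can change, so that loop invariants only need to
  mention what their loop modifies.\<close>

definition frame :: "com \<Rightarrow> store \<Rightarrow> store \<Rightarrow> bool" where
  "frame c s s' \<longleftrightarrow> (\<forall>x. x \<notin> changed_vars c \<longrightarrow> vars s' x = vars s x) \<and>
     (\<forall>a. a \<notin> changed_arrs c \<longrightarrow> arrs s' a = arrs s a) \<and>
     (silent c \<longrightarrow> outputs s' = outputs s)"

lemma frameD:
  assumes "frame c s s'"
  shows "x \<notin> changed_vars c \<Longrightarrow> vars s' x = vars s x"
    and "a \<notin> changed_arrs c \<Longrightarrow> arrs s' a = arrs s a"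
    and "silent c \<Longrightarrow> outputs s' = outputs s"
  using assms unfolding frame_def by auto

lemma big_frame: "big c s t s' \<Longrightarrow> frame c s s'"
  by (induction rule: big.induct) (simp_all add: frame_def)

lemma wp_frame: "wp c Q s t \<Longrightarrow> wp c (\<lambda>s' t'. Q s' t' \<and> frame c s s') s t"
  unfolding wp_def using big_frame by blast

lemma wp_While_False: "eval e s = 0 \<Longrightarrow> Q s (Suc t) \<Longrightarrow> wp (While e c) Q s t"
  unfolding wp_def using big_While_False by (metis Suc_eq_plus1)

lemma wp_While_True:
  "eval e s \<noteq> 0 \<Longrightarrow> wp c (wp (While e c) Q) s (Suc t) \<Longrightarrow> wp (While e c) Q s t"
  unfolding wp_def by (metis add_Suc add_Suc_right add.assoc big_While_True)

text \<open>Subtraction is truncated, so \<open>b - i\<close> is nonzero exactly while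
  \<open>i < b\<close>.\<close>

definition For :: "nat \<Rightarrow> nat \<Rightarrow> com \<Rightarrow> com" where
  "For i b c = Assign i (N 0) ;; While (Minus (V b) (V i)) (c ;; Assign i (Plus (V i) (N 1)))"

lemma For_simps [simp]:
  "changed_vars (For i b c) = insert i (changed_vars c)"
  "changed_arrs (For i b c) = changed_arrs c"
  "silent (For i b c) = silent c"
  "com_fits (For i b c) = com_fits c"
  by (auto simp: For_def)

text \<open>Every iteration pays \<open>B\<close> for the body and 2 for the test and the increment;
  the initial assignment and the failing test account for the other 2. The invariant is stated for
  states in which the counter has already been advanced.\<close>

lemma wp_For:
  assumes ib: "i \<notin> changed_vars c" "b \<notin> changed_vars c" "i \<noteq> b"
    and n: "vars s b = n"
    and I0: "I 0 (set_var i 0 s)"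
    and body: "\<And>j s' t'. j < n \<Longrightarrow> frame (For i b c) s s' \<Longrightarrow> vars s' i = j \<Longrightarrow> I j s' \<Longrightarrow>
      wp c (\<lambda>s'' t''. t'' \<le> t' + B \<and> I (Suc j) (set_var i (Suc j) s'')) s' t'"
    and post: "\<And>s' t'. t' \<le> t + 2 + n * (B + 2) \<Longrightarrow> frame (For i b c) s s' \<Longrightarrow> vars s' i = n \<Longrightarrow>
      I n s' \<Longrightarrow> Q s' t'"
  shows "wp (For i b c) Q s t"
proof -
  let ?w = "While (Minus (V b) (V i)) (c ;; Assign i (Plus (V i) (N 1)))"
  have "wp ?w Q s' t'" if "j \<le> n" "frame (For i b c) s s'" "vars s' i = j" "I j s'"
    "t' \<le> t + 1 + j * (B + 2)" for j s' t'
    using that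
  proof (induction "n - j" arbitrary: j s' t')
    case 0
    have "vars s' b = n" using frameD(1)[OF 0(3), of b] ib n by simp
    then show ?case using 0 by (intro wp_While_False post) auto
  next
    case (Suc k)
    have b: "vars s' b = n" using frameD(1)[OF Suc(4), of b] ib n by simp
    have j: "j < n" using Suc(2) by simp
    show ?case
    proof (rule wp_While_True)
      show "eval (Minus (V b) (V i)) s' \<noteq> 0" using b j Suc by simp
      have "wp c (\<lambda>s'' t''. wp ?w Q (set_var i (Suc j) s'') (Suc t'')) s' (Suc t')"
      proof (rule wp_mono[OF wp_frame[OF body[OF j Suc(4,5,6), of "Suc t'"]]], elim conjE)
        fix s'' t'' assume *: "t'' \<le> Suc t' + B" "I (Suc j) (set_var i (Suc j) s'')" "frame c s' s''"
        show "wp ?w Q (set_var i (Suc j) s'') (Suc t'')"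
        proof (rule Suc(1))
          show "frame (For i b c) s (set_var i (Suc j) s'')"
            using Suc(4) *(3) by (auto simp: frame_def)
        qed (use Suc(2,7) * j in auto)
      qed
      then have "wp c (\<lambda>s'' t''. wp ?w Q (set_var i (Suc (vars s'' i)) s'') (Suc t'')) s' (Suc t')"
        by (rule wp_mono[OF wp_frame]) (use ib Suc(5) in \<open>auto simp: frame_def\<close>)
      then show "wp (c ;; Assign i (Plus (V i) (N 1))) (wp ?w Q) s' (Suc t')"
        by simp
    qed
  qed
  from this[of 0 "set_var i 0 s" "Suc t"] I0 show ?thesis
    by (simp add: For_def frame_def)
qed

section \<open>The algorithm\<close>

text \<open>With truncated subtraction \<open>1 - (1 - a)\<close> is 0 for \<open>a = 0\<close> and
  1 otherwise, which gives tests with values 0 and 1.\<close>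

definition lt :: "exp \<Rightarrow> exp \<Rightarrow> exp" where
  "lt e f = Minus (N 1) (Minus (N 1) (Minus f e))"

definition neq :: "exp \<Rightarrow> exp \<Rightarrow> exp" where
  "neq e f = Minus (N 1) (Minus (N 1) (Plus (Minus e f) (Minus f e)))"

lemma eval_test [simp]:
  "eval (lt e f) s = (if eval e s < eval f s then 1 else 0)"
  "eval (neq e f) s = (if eval e s \<noteq> eval f s then 1 else 0)"
  "exp_fits (lt e f) \<longleftrightarrow> exp_fits e \<and> exp_fits f"
  "exp_fits (neq e f) \<longleftrightarrow> exp_fits e \<and> exp_fits f"
  by (auto simp: lt_def neq_def)

abbreviation incr :: "nat \<Rightarrow> exp \<Rightarrow> com" where
  "incr x e \<equiv> Assign x (Plus (V x) e)"

abbreviation add_arr :: "nat \<Rightarrow> exp \<Rightarrow> exp \<Rightarrow> com" where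
  "add_arr a e f \<equiv> Update a e (Plus (Arr a e) f)"

abbreviation sub_arr :: "nat \<Rightarrow> exp \<Rightarrow> exp \<Rightarrow> com" where
  "sub_arr a e f \<equiv> Update a e (Minus (Arr a e) f)"

text \<open>Variables and arrays are numbered from 2 on, since the simplifier turns 1 into \<open>Suc 0\<close>.\<close>

abbreviation (input) "vL \<equiv> 2 :: nat"
abbreviation (input) "vn \<equiv> 3 :: nat"
abbreviation (input) "vN \<equiv> 4 :: nat"
abbreviation (input) "vsq \<equiv> 5 :: nat"
abbreviation (input) "vm \<equiv> 6 :: nat"
abbreviation (input) "vH \<equiv> 7 :: nat"
abbreviation (input) "vpe \<equiv> 9 :: nat"
abbreviation (input) "vok \<equiv> 10 :: nat"
abbreviation (input) "vtail \<equiv> 11 :: nat"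
abbreviation (input) "vbest \<equiv> 12 :: nat"
abbreviation (input) "vG \<equiv> 13 :: nat"
abbreviation (input) "vi \<equiv> 14 :: nat"
abbreviation (input) "vj \<equiv> 15 :: nat"
abbreviation (input) "vk \<equiv> 16 :: nat"
abbreviation (input) "vh \<equiv> 17 :: nat"
abbreviation (input) "vu \<equiv> 18 :: nat"
abbreviation (input) "vv \<equiv> 19 :: nat"
abbreviation (input) "vp \<equiv> 20 :: nat"
abbreviation (input) "vw \<equiv> 21 :: nat"
abbreviation (input) "vc \<equiv> 22 :: nat"
abbreviation (input) "va \<equiv> 23 :: nat"
abbreviation (input) "vb \<equiv> 24 :: nat"
abbreviation (input) "vd \<equiv> 25 :: nat"
abbreviation (input) "vz \<equiv> 26 :: nat"
abbreviation (input) "vrv \<equiv> 27 :: nat"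
abbreviation (input) "vru \<equiv> 28 :: nat"
abbreviation (input) "vbj \<equiv> 29 :: nat"
abbreviation (input) "vx \<equiv> 30 :: nat"
abbreviation (input) "vy \<equiv> 31 :: nat"
abbreviation (input) "vjw \<equiv> 32 :: nat"
abbreviation (input) "vk1 \<equiv> 33 :: nat"
abbreviation (input) "vlf \<equiv> 34 :: nat"
abbreviation (input) "vlb \<equiv> 35 :: nat"

abbreviation (input) "aX \<equiv> 2 :: nat"
abbreviation (input) "aDeg \<equiv> 3 :: nat"
abbreviation (input) "aS \<equiv> 4 :: nat"
abbreviation (input) "aQ \<equiv> 5 :: nat"
abbreviation (input) "aP \<equiv> 6 :: nat"
abbreviation (input) "aRow \<equiv> 7 :: nat"
abbreviation (input) "aD \<equiv> 8 :: nat"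
abbreviation (input) "aC \<equiv> 9 :: nat"
abbreviation (input) "aE \<equiv> 10 :: nat"
abbreviation (input) "aF \<equiv> 11 :: nat"
abbreviation (input) "aK \<equiv> 12 :: nat"
abbreviation (input) "aM \<equiv> 13 :: nat"
abbreviation (input) "aPF \<equiv> 14 :: nat"
abbreviation (input) "aPB \<equiv> 15 :: nat"

subsection \<open>Reading and validating the input\<close>

text \<open>The default 0 agrees with untouched memory, so the input array of the program equals
  \<open>entry xs\<close> at all indices.\<close>

definition entry :: "nat list \<Rightarrow> nat \<Rightarrow> nat" where
  "entry xs i = (if i < length xs then xs ! i else 0)"

definition slurp :: com where
  "slurp = WhileInput (Input vz ;; Update aX (V vL) (V vz) ;; incr vL (N 1))"

lemma slurp_simps [simp]:
  "changed_vars slurp = {vz, vL}" "changed_arrs slurp = {aX}" "silent slurp" "com_fits slurp"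
  by (auto simp: slurp_def)

lemma wp_WhileInput_Nil: "inputs s = [] \<Longrightarrow> Q s (Suc t) \<Longrightarrow> wp (WhileInput c) Q s t"
  unfolding wp_def using big_WhileInput_Nil by (metis Suc_eq_plus1)

lemma wp_WhileInput_Cons:
  "inputs s \<noteq> [] \<Longrightarrow> wp c (wp (WhileInput c) Q) s (Suc t) \<Longrightarrow> wp (WhileInput c) Q s t"
  unfolding wp_def by (metis add_Suc add_Suc_right add.assoc big_WhileInput_Cons)

lemma wp_slurp:
  assumes "vars s vL = length us" "arrs s aX = entry us" "inputs s = ys"
    and "\<And>s' t'. t' \<le> t + 1 + 4 * length ys \<Longrightarrow> frame slurp s s' \<Longrightarrow>
      vars s' vL = length (us @ ys) \<Longrightarrow> arrs s' aX = entry (us @ ys) \<Longrightarrow> Q s' t'"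
  shows "wp slurp Q s t"
  using assms
proof (induction ys arbitrary: s t us)
  case Nil
  show ?case
    unfolding slurp_def by (rule wp_WhileInput_Nil) (use Nil in \<open>auto simp: frame_def\<close>)
next
  case (Cons y ys)
  define s1 where "s1 = set_var vL (Suc (length us)) (set_arr aX (length us) y
    ((set_var vz y s)\<lparr>inputs := ys\<rparr>))"
  have X: "(entry us)(length us := y) = entry (us @ [y])"
    by (auto simp: entry_def nth_append)
  have "wp slurp Q s1 (t + 4)"
  proof (rule Cons.IH[of _ "us @ [y]"])
    fix s' t' assume "t' \<le> t + 4 + 1 + 4 * length ys" "frame slurp s1 s'"
      "vars s' vL = length ((us @ [y]) @ ys)" "arrs s' aX = entry ((us @ [y]) @ ys)"
    then show "Q s' t'"
      by (intro Cons.prems(4)) (auto simp: frame_def s1_def set_var_def set_arr_def)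
  qed (use Cons.prems X in \<open>auto simp: s1_def set_var_def set_arr_def\<close>)
  then show ?case
    unfolding slurp_def
    by (intro wp_WhileInput_Cons)
      (use Cons.prems in \<open>simp_all add: s1_def set_var_def set_arr_def numeral_eq_Suc\<close>)
qed

text \<open>The length of the input is \<open>L = 1 + n * n + 1 + 2 * m + 1 + 4 * (m - 1)\<close>, as a tree has
  \<open>m - 1\<close> edges; the capacity and the cost of node \<open>u\<close> are at positions \<open>n * n + 2 + 2 * u\<close> and
  \<open>n * n + 3 + 2 * u\<close>.\<close>

definition instance_size_ok :: "(nat \<Rightarrow> nat) \<Rightarrow> nat \<Rightarrow> nat \<Rightarrow> nat \<Rightarrow> bool" where
  "instance_size_ok x L n m \<longleftrightarrow> n \<noteq> 0 \<and> m \<noteq> 0 \<and> x 0 = n \<and> x (n * n + 1) = m \<and>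
     L + 1 = n * n + 6 * m \<and> x (n * n + 2 + 2 * m) + 1 = m"

definition first_edge :: "nat \<Rightarrow> nat \<Rightarrow> nat" where
  "first_edge n m = n * n + 3 + 2 * m"

definition matrix_entry_ok :: "(nat \<Rightarrow> nat) \<Rightarrow> nat \<Rightarrow> nat \<Rightarrow> nat \<Rightarrow> bool" where
  "matrix_entry_ok x n i j \<longleftrightarrow> x (1 + i * n + j) = (if i = j then 0 else 1)"

definition node_ok :: "(nat \<Rightarrow> nat) \<Rightarrow> nat \<Rightarrow> nat \<Rightarrow> bool" where
  "node_ok x n u \<longleftrightarrow> x (n * n + 2 + 2 * u) \<noteq> 0"

definition edge_ok :: "(nat \<Rightarrow> nat) \<Rightarrow> nat \<Rightarrow> nat \<Rightarrow> nat \<Rightarrow> bool" where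
  "edge_ok x n m e \<longleftrightarrow> (let p = first_edge n m + 4 * e in
     x p < m \<and> x (p + 1) < m \<and> x p \<noteq> x (p + 1) \<and> x (p + 2) \<noteq> 0)"

definition well_formed :: "(nat \<Rightarrow> nat) \<Rightarrow> nat \<Rightarrow> nat \<Rightarrow> nat \<Rightarrow> bool" where
  "well_formed x L n m \<longleftrightarrow> instance_size_ok x L n m \<and> (\<forall>i<n. \<forall>j<n. matrix_entry_ok x n i j) \<and>
     (\<forall>u<m. node_ok x n u) \<and> (\<forall>e<m - 1. edge_ok x n m e)"

definition fail_if :: "exp \<Rightarrow> com" where
  "fail_if e = If e (Assign vok (N 0)) Skip"

lemma fail_if_simps [simp]:
  "changed_vars (fail_if e) = {vok}" "changed_arrs (fail_if e) = {}" "silent (fail_if e)"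
  "com_fits (fail_if e) = exp_fits e"
  by (auto simp: fail_if_def)

lemma wp_fail_if [simp]:
  "wp (fail_if e) Q s t \<longleftrightarrow>
     (if eval e s \<noteq> 0 then Q (set_var vok 0 s) (Suc (Suc t)) else Q s (Suc t))"
  by (simp add: fail_if_def)

text \<open>A pointer advancing by one per entry replaces the index computation
  \<open>1 + i * n + j\<close>.\<close>

definition check_matrix :: com where
  "check_matrix = Assign vp (N 1) ;; For vi vn (For vj vn (
     If (neq (V vi) (V vj)) (fail_if (neq (Arr aX (V vp)) (N 1))) (fail_if (Arr aX (V vp))) ;;
     incr vp (N 1)))"

lemma check_matrix_simps [simp]:
  "changed_vars check_matrix = {vp, vi, vj, vok}" "changed_arrs check_matrix = {}"
  "silent check_matrix" "com_fits check_matrix"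
  by (auto simp: check_matrix_def)

lemma wp_check_matrix:
  assumes "vars s vn = n" "arrs s aX = x" "vars s vok = 1"
    and "\<And>s' t'. t' \<le> t + 3 + n * (n * 6 + 4) \<Longrightarrow> frame check_matrix s s' \<Longrightarrow>
      vars s' vok = (if \<forall>i<n. \<forall>j<n. matrix_entry_ok x n i j then 1 else 0) \<Longrightarrow> Q s' t'"
  shows "wp check_matrix Q s t"
  unfolding check_matrix_def wp_simps
proof (rule wp_For[where n = n and B = "n * 6 + 2" and I = "\<lambda>i s. vars s vp = 1 + i * n \<and>
    vars s vok = (if \<forall>i'<i. \<forall>j<n. matrix_entry_ok x n i' j then 1 else 0)"], goal_cases)
  case (6 i s1 t1)
  note fr = frameD[OF 6(2)]
  show ?case
  proof (rule wp_For[where n = n and B = 4 and I = "\<lambda>j s. vars s vp = 1 + i * n + j \<and>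
      vars s vok = (if (\<forall>i'<i. \<forall>j<n. matrix_entry_ok x n i' j) \<and>
        (\<forall>j'<j. matrix_entry_ok x n i j') then 1 else 0)"], goal_cases)
    case (6 j s2 t2)
    note fr2 = frameD[OF 6(2)]
    show ?case
      using 6 assms \<open>vars s1 vi = i\<close>
      by (simp add: fr fr2 matrix_entry_ok_def[of x n i j] All_less_Suc; blast)
  next
    case (7 s2 t2)
    then show ?case by (simp add: All_less_Suc algebra_simps)
  qed (use 6 assms in \<open>simp_all add: fr\<close>)
next
  case (7 s1 t1)
  note fr = frameD[OF 7(2)]
  show ?case by (rule assms(4)) (use 7 fr in \<open>simp_all add: frame_def algebra_simps\<close>)
qed (use assms in simp_all)


definition check_nodes :: com where
  "check_nodes = Assign vp (Plus (V vsq) (N 2)) ;; For vu vm (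
     If (Arr aX (V vp)) Skip (fail_if (N 1)) ;; incr vp (N 2))"

lemma check_nodes_simps [simp]:
  "changed_vars check_nodes = {vp, vu, vok}" "changed_arrs check_nodes = {}"
  "silent check_nodes" "com_fits check_nodes"
  by (auto simp: check_nodes_def)

lemma wp_check_nodes:
  assumes "vars s vsq = n * n" "vars s vm = m" "arrs s aX = x" "vars s vok = (if b then 1 else 0)"
    and "\<And>s' t'. t' \<le> t + 3 + m * 6 \<Longrightarrow> frame check_nodes s s' \<Longrightarrow>
      vars s' vok = (if b \<and> (\<forall>u<m. node_ok x n u) then 1 else 0) \<Longrightarrow> Q s' t'"
  shows "wp check_nodes Q s t"
  unfolding check_nodes_def wp_simps
proof (rule wp_For[where n = m and B = 4 and I = "\<lambda>u s. vars s vp = n * n + 2 + 2 * u \<and>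
    vars s vok = (if b \<and> (\<forall>u'<u. node_ok x n u') then 1 else 0)"], goal_cases)
  case (6 u s1 t1)
  note fr = frameD[OF 6(2)]
  show ?case using 6 assms by (simp add: fr node_ok_def[of x n u] All_less_Suc)
next
  case (7 s1 t1)
  note fr = frameD[OF 7(2)]
  show ?case by (rule assms(5)) (use 7 fr in \<open>simp_all add: frame_def algebra_simps\<close>)
qed (use assms in simp_all)

definition check_edges :: com where
  "check_edges = Assign vp (V vpe) ;; For vu vH (
     Assign vx (Arr aX (V vp)) ;; Assign vy (Arr aX (Plus (V vp) (N 1))) ;;
     If (lt (V vx) (V vm)) Skip (fail_if (N 1)) ;;
     If (lt (V vy) (V vm)) Skip (fail_if (N 1)) ;;
     If (neq (V vx) (V vy)) Skip (fail_if (N 1)) ;;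
     If (Arr aX (Plus (V vp) (N 2))) Skip (fail_if (N 1)) ;; incr vp (N 4))"

lemma check_edges_simps [simp]:
  "changed_vars check_edges = {vp, vu, vok, vx, vy}" "changed_arrs check_edges = {}"
  "silent check_edges" "com_fits check_edges"
  by (auto simp: check_edges_def)

lemma wp_check_edges:
  assumes "vars s vpe = first_edge n m" "vars s vm = m" "vars s vH = m - 1" "arrs s aX = x"
    "vars s vok = (if b then 1 else 0)"
    and "\<And>s' t'. t' \<le> t + 3 + (m - 1) * 17 \<Longrightarrow> frame check_edges s s' \<Longrightarrow>
      vars s' vok = (if b \<and> (\<forall>e<m - 1. edge_ok x n m e) then 1 else 0) \<Longrightarrow> Q s' t'"
  shows "wp check_edges Q s t"
  unfolding check_edges_def wp_simps
proof (rule wp_For[where n = "m - 1" and B = 15 and I = "\<lambda>u s. vars s vp = first_edge n m + 4 * u \<and>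
    vars s vok = (if b \<and> (\<forall>u'<u. edge_ok x n m u') then 1 else 0)"], goal_cases)
  case (6 u s1 t1)
  note fr = frameD[OF 6(2)]
  show ?case using 6 assms 
    by (simp add: fr edge_ok_def[of x n m u] Let_def All_less_Suc; blast)
next
  case (7 s1 t1)
  note fr = frameD[OF 7(2)]
  show ?case by (rule assms(6)) (use 7 fr in \<open>simp_all add: frame_def algebra_simps\<close>)
qed (use assms in simp_all)

definition check_body :: com where
  "check_body = Assign vok (N 1) ;; check_matrix ;; check_nodes ;; check_edges"

text \<open>\<open>va\<close> holds \<open>3 * m\<close>, so that the length can be compared with
  \<open>n * n + 6 * m\<close> by additions alone.\<close>

definition check_sizes :: com where
  "check_sizes = Assign vm (Arr aX (Plus (V vsq) (N 1))) ;; Assign vH (Minus (V vm) (N 1)) ;;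
     Assign vpe (Plus (Plus (V vsq) (N 3)) (Plus (V vm) (V vm))) ;;
     Assign va (Plus (V vm) (Plus (V vm) (V vm))) ;;
     If (V vn)
       (If (V vm)
         (If (neq (Plus (V vL) (N 1)) (Plus (V vsq) (Plus (V va) (V va)))) Skip
           (If (neq (Plus (Arr aX (Minus (V vpe) (N 1))) (N 1)) (V vm)) Skip check_body))
         Skip)
       Skip"

text \<open>The square of \<open>n\<close> is accumulated in \<open>n\<close> rounds. Comparing
  \<open>n\<close> with the length of the input beforehand prevents a malformed input with a huge
  first number from running for a time exponential in its size.\<close>

definition check :: com where
  "check = Assign vok (N 0) ;; Assign vn (Arr aX (N 0)) ;; Assign vN (Plus (V vn) (N 1)) ;;
     Assign vsq (N 0) ;;
     If (lt (V vn) (Plus (V vL) (N 1))) (For vi vn (incr vsq (V vn)) ;; check_sizes) Skip"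

lemma check_simps [simp]:
  "changed_vars check = {vok, vn, vN, vsq, vi, vm, vH, vpe, va, vj, vp, vu, vx, vy}"
  "changed_arrs check = {}" "silent check" "com_fits check"
  by (auto simp: check_def check_sizes_def check_body_def)

lemma well_formed_size:
  assumes "well_formed x L n m"
  shows "n \<le> L" "1 \<le> n" "1 \<le> m" "L + 1 = n * n + 6 * m" "n = x 0" "m = x (n * n + 1)"
proof -
  have *: "n \<noteq> 0" "m \<noteq> 0" "L + 1 = n * n + 6 * m" "x 0 = n" "x (n * n + 1) = m"
    using assms by (auto simp: well_formed_def instance_size_ok_def)
  moreover have "n \<le> n * n" using *(1) by simp
  ultimately show "n \<le> L" "1 \<le> n" "1 \<le> m" "L + 1 = n * n + 6 * m" "n = x 0" "m = x (n * n + 1)"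
    by linarith+
qed

definition loaded :: "(nat \<Rightarrow> nat) \<Rightarrow> nat \<Rightarrow> nat \<Rightarrow> store \<Rightarrow> bool" where
  "loaded x n m s \<longleftrightarrow> arrs s aX = x \<and> vars s vn = n \<and> vars s vN = n + 1 \<and> vars s vsq = n * n \<and>
     vars s vm = m \<and> vars s vH = m - 1 \<and> vars s vpe = first_edge n m"

lemma wp_check_aux:
  fixes x :: "nat \<Rightarrow> nat" and L :: nat
  defines "n \<equiv> x 0"
  defines "m \<equiv> x (n * n + 1)"
  assumes "vars s vL = L" "arrs s aX = x"
    and post: "\<And>s' t'. t' \<le> t + 50 * (L + 1) \<Longrightarrow>
      vars s' vok = (if well_formed x L n m then 1 else 0) \<Longrightarrow>
      (well_formed x L n m \<Longrightarrow> loaded x n m s') \<Longrightarrow> Q s' t'"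
  shows "wp check Q s t"
proof (cases "n \<le> L")
  case False
  then have "\<not> well_formed x L n m" using well_formed_size(1) by blast
  then show ?thesis
    using False assms(3,4)
    by (simp add: check_def n_def) (rule post, auto simp: n_def)
next
  case True
  then have nL: "x 0 < Suc L" by (simp add: n_def)
  show ?thesis
    unfolding check_def
    apply (simp add: assms(3,4) nL)
  proof (rule wp_For[where n = n and B = 1 and I = "\<lambda>i s. vars s vsq = i * n"], goal_cases)
    case (6 i s1 t1)
    then show ?case by (simp add: frameD(1)[OF 6(2)] n_def)
  next
    case (7 s1 t1)
    note fr = frameD[OF 7(2)]
    have sq: "vars s1 vsq = n * n" using 7 by simp
    have vs: "vars s1 vn = n" "vars s1 vN = n + 1" "vars s1 vok = 0" "arrs s1 aX = x" "vars s1 vL = L"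
      using assms(3,4) by (simp_all add: fr n_def)
    have xm: "x (Suc (n * n)) = m" by (simp add: m_def)
    have t1: "t1 \<le> t + 8 + 3 * L" using 7(1) True by simp
    \<comment> \<open>\<open>C\<close> keeps the conditions that are tested; the two others in
      \<open>instance_size_ok\<close> hold by the choice of \<open>n\<close> and
      \<open>m\<close>.\<close>
    define C where "C \<longleftrightarrow> n \<noteq> 0 \<and> m \<noteq> 0 \<and> L + 1 = n * n + 6 * m \<and>
      x (n * n + 2 + 2 * m) + 1 = m"
    have C: "instance_size_ok x L n m \<longleftrightarrow> C"
      by (auto simp: instance_size_ok_def C_def n_def m_def)
    have m6: "n * n + (m + (m + m) + (m + (m + m))) = n * n + 6 * m" by simp
    show ?case
    proof (cases C)
      case False
      then have "\<not> well_formed x L n m" by (simp add: well_formed_def C)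
      then have Q: "Q s' t'" if "t' \<le> t1 + 10" "vars s' vok = 0" for s' t'
        using that t1 by (intro post) auto
      consider "n = 0" | "n \<noteq> 0" "m = 0" | "n \<noteq> 0" "m \<noteq> 0" "Suc L \<noteq> n * n + 6 * m"
        | "n \<noteq> 0" "m \<noteq> 0" "Suc L = n * n + 6 * m" "Suc (x (Suc (Suc (n * n + 2 * m)))) \<noteq> m"
        using False unfolding C_def by fastforce
      then have "wp check_sizes (\<lambda>s' t'. t' \<le> t1 + 10 \<and> vars s' vok = 0) s1 t1"
        by cases (simp_all add: check_sizes_def sq vs xm m6 mult_2[symmetric])
      then show ?thesis
        by (rule wp_mono) (simp add: Q)
    next
      case True
      then have nm: "0 < n" "0 < m" "L + 1 = n * n + 6 * m" "x (n * n + 2 + 2 * m) + 1 = m"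
        by (auto simp: C_def)
      have m6: "Suc L = n * n + (m + (m + m) + (m + (m + m)))" using nm(3) by simp
      have x2: "Suc (x (Suc (Suc (2 * m + n * n)))) = m" "Suc (x (Suc (Suc (n * n + 2 * m)))) = m"
        using nm(4) by (simp_all add: add.commute)
      \<comment> \<open>With \<open>q\<close> in place of \<open>n * n\<close> the time bound is
        linear arithmetic; since \<open>L + 1 = q + 6 * m\<close>, inspecting the whole matrix is
        linear in the length.\<close>
      have "t1 + 15 + 3 + r + 3 + m * 6 + 3 + z \<le> t + 50 * (L + 1)"
        if "n \<le> q" "r = 6 * q + 4 * n" "z \<le> 17 * m" "L + 1 = q + 6 * m" for q r z
        using that t1 nm(2) by simp
      from this[OF _ _ _ nm(3), of "n * (n * 6 + 4)" "(m - 1) * 17"]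
      have time: "t1 + 15 + 3 + n * (n * 6 + 4) + 3 + m * 6 + 3 + (m - 1) * 17 \<le> t + 50 * (L + 1)"
        by (simp add: distrib_left)
      show ?thesis
        apply (simp add: check_sizes_def sq vs xm nm(1,2) m6 x2 check_body_def)
        apply (rule wp_check_matrix[where n = n and x = x])
           apply (simp_all add: vs)[3]
        apply (rule wp_check_nodes[where n = n and m = m and x = x])
            apply (simp_all add: sq vs frameD)[4]
        subgoal for s2 t2 s3 t3
          apply (rule wp_check_edges[where n = n and m = m and x = x])
               apply (simp_all add: sq vs frameD first_edge_def)[5]
          subgoal premises p for s4 t4
            apply (rule post)
            using p time True
            by (simp_all add: well_formed_def C loaded_def frameD[OF p(2)] frameD[OF p(5)]
              frameD[OF p(8)] sq vs first_edge_def)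
          done
        done
    qed
  qed (simp_all add: n_def)
qed

lemma wp_check:
  fixes x :: "nat \<Rightarrow> nat" and L :: nat
  defines "n \<equiv> x 0"
  defines "m \<equiv> x (n * n + 1)"
  assumes "vars s vL = L" "arrs s aX = x"
    and post: "\<And>s' t'. t' \<le> t + 50 * (L + 1) \<Longrightarrow> frame check s s' \<Longrightarrow>
      vars s' vok = (if well_formed x L n m then 1 else 0) \<Longrightarrow>
      (well_formed x L n m \<Longrightarrow> loaded x n m s') \<Longrightarrow> Q s' t'"
  shows "wp check Q s t"
proof -
  have "wp check (\<lambda>s' t'. t' \<le> t + 50 * (L + 1) \<and>
      vars s' vok = (if well_formed x L n m then 1 else 0) \<and>
      (well_formed x L n m \<longrightarrow> loaded x n m s')) s t"
    unfolding n_def m_def by (rule wp_check_aux) (use assms(3,4) in auto)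
  then show ?thesis
    by (rule wp_mono[OF wp_frame]) (use post in blast)
qed

subsection \<open>Elimination of leaves\<close>

definition edge_ptr :: "nat \<Rightarrow> nat \<Rightarrow> nat \<Rightarrow> nat" where
  "edge_ptr n m e = first_edge n m + 4 * e"

definition ends :: "(nat \<Rightarrow> nat) \<Rightarrow> nat \<Rightarrow> nat set" where
  "ends x p = {x p, x (p + 1)}"

definition input_edges :: "(nat \<Rightarrow> nat) \<Rightarrow> nat \<Rightarrow> nat \<Rightarrow> nat set set" where
  "input_edges x n m = (\<lambda>e. ends x (edge_ptr n m e)) ` {..<m - 1}"

text \<open>Edges are counted by their position in the list, because the program sums positions. The
  bound \<open>k\<close> lets the same notion describe the arrays while the list is still being
  read.\<close>

definition incident :: "(nat \<Rightarrow> nat) \<Rightarrow> nat \<Rightarrow> nat \<Rightarrow> nat \<Rightarrow> nat set \<Rightarrow> nat \<Rightarrow> nat set" where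
  "incident x n m k R v = {e. e < k \<and> (\<exists>y\<in>R. ends x (edge_ptr n m e) = {v, y})}"

lemma finite_incident [simp]: "finite (incident x n m k R v)"
  by (simp add: incident_def)

lemma well_formed_edge:
  assumes "well_formed x L n m" "e < m - 1"
  shows "x (edge_ptr n m e) < m" "x (edge_ptr n m e + 1) < m"
    "x (edge_ptr n m e) \<noteq> x (edge_ptr n m e + 1)" "x (edge_ptr n m e + 2) \<noteq> 0"
  using assms by (auto simp: well_formed_def edge_ok_def edge_ptr_def Let_def)

lemma simple_input_edges:
  assumes "well_formed x L n m"
  shows "simple_graph {..<m} (input_edges x n m)"
  using well_formed_edge[OF assms] by (auto simp: simple_graph_def input_edges_def ends_def)

lemma incident_Suc:
  assumes "well_formed x L n m" "k < m - 1"
  shows "incident x n m (Suc k) {..<m} v =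
    (if v = x (edge_ptr n m k) \<or> v = x (edge_ptr n m k + 1) then insert k (incident x n m k {..<m} v)
     else incident x n m k {..<m} v)"
proof -
  have "(\<exists>y\<in>{..<m}. ends x (edge_ptr n m k) = {v, y}) \<longleftrightarrow>
      v = x (edge_ptr n m k) \<or> v = x (edge_ptr n m k + 1)"
    using well_formed_edge[OF assms] by (auto simp: ends_def doubleton_eq_iff)
  then show ?thesis by (auto simp: incident_def less_Suc_eq)
qed

lemma not_incident: "k \<notin> incident x n m k R v"
  by (simp add: incident_def)

text \<open>\<open>Q\<close> is the elimination order and a queue at once: positions below
  \<open>h\<close> are done, those from \<open>h\<close> to \<open>tail\<close> are waiting. A
  waiting vertex drops to degree 0 if its only neighbour is eliminated before it, hence the bound 1
  instead of equality. For an eliminated vertex, \<open>S\<close> keeps the position of the edge to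
  its parent.\<close>

definition elim_invariant ::
  "(nat \<Rightarrow> nat) \<Rightarrow> nat \<Rightarrow> nat \<Rightarrow> (nat \<Rightarrow> nat) \<Rightarrow> (nat \<Rightarrow> nat) \<Rightarrow> (nat \<Rightarrow> nat) \<Rightarrow> (nat \<Rightarrow> nat) \<Rightarrow>
    nat \<Rightarrow> nat \<Rightarrow> bool" where
  "elim_invariant x n m Q P deg S h tail \<longleftrightarrow>
     leaf_seq {..<m} (input_edges x n m) Q P h \<and> h \<le> tail \<and> inj_on Q {..<tail} \<and>
     (\<forall>t<tail. Q t < m \<and> Q t \<noteq> 0) \<and>
     (\<forall>w\<in>{..<m} - Q ` {..<h}. let I = incident x n m (m - 1) ({..<m} - Q ` {..<h}) w in
        deg w = card I \<and> S w = (\<Sum>e\<in>I. edge_ptr n m e)) \<and>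
     (\<forall>w\<in>{..<m} - Q ` {..<h}. w \<noteq> 0 \<longrightarrow> deg w = 1 \<longrightarrow> w \<in> Q ` {..<tail}) \<and>
     (\<forall>t<tail. h \<le> t \<longrightarrow> deg (Q t) \<le> 1) \<and>
     (\<forall>j<h. \<exists>e<m - 1. S (Q j) = edge_ptr n m e \<and> ends x (S (Q j)) = {Q j, P (Q j)})"

lemma leaf_seq_cong:
  assumes "leaf_seq U E Q par H" "\<And>h. h < H \<Longrightarrow> Q' h = Q h"
  shows "leaf_seq U E Q' par H"
proof -
  have "Q' ` {..<h} = Q ` {..<h}" if "h < H" for h
    using assms(2) that by (intro image_cong) auto
  then show ?thesis using assms by (simp add: leaf_seq_def)
qed

text \<open>Subtracting \<open>Q h\<close> from the sum of the two ends of its only edge yields the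
  other end, whichever of the two is listed first.\<close>

lemma elim_step:
  assumes wf: "well_formed x L n m" and inv: "elim_invariant x n m Q P deg S h tail"
    and h: "h < tail" and deg1: "deg (Q h) = 1"
  defines "p \<equiv> S (Q h)"
  defines "u \<equiv> x p + x (p + 1) - Q h"
  defines "deg' \<equiv> deg(u := deg u - 1)"
  defines "S' \<equiv> S(u := S u - p)"
  shows "elim_invariant x n m
    (if u \<noteq> 0 \<and> deg' u = 1 then Q(tail := u) else Q) (P(Q h := u)) deg' S' (Suc h)
    (if u \<noteq> 0 \<and> deg' u = 1 then Suc tail else tail)"
proof -
  let ?E = "input_edges x n m" and ?v = "Q h"
  define R where "R = {..<m} - Q ` {..<h}"
  define I where "I = (\<lambda>R w. incident x n m (m - 1) R w)"
  have ls: "leaf_seq {..<m} ?E Q P h" and "h \<le> tail" and inj: "inj_on Q {..<tail}"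
    and Q: "\<And>t. t < tail \<Longrightarrow> Q t < m \<and> Q t \<noteq> 0"
    and deg: "\<And>w. w \<in> R \<Longrightarrow> deg w = card (I R w)"
    and S: "\<And>w. w \<in> R \<Longrightarrow> S w = (\<Sum>e\<in>I R w. edge_ptr n m e)"
    and queued: "\<And>w. w \<in> R \<Longrightarrow> w \<noteq> 0 \<Longrightarrow> deg w = 1 \<Longrightarrow> w \<in> Q ` {..<tail}"
    and le1: "\<And>t. t < tail \<Longrightarrow> h \<le> t \<Longrightarrow> deg (Q t) \<le> 1"
    and ptr: "\<And>j. j < h \<Longrightarrow> \<exists>e<m - 1. S (Q j) = edge_ptr n m e \<and> ends x (S (Q j)) = {Q j, P (Q j)}"
    using inv unfolding elim_invariant_def R_def I_def Let_def by blast+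
  have Qneq: "Q t \<noteq> Q t'" if "t < t'" "t' < tail" for t t'
    using inj_onD[OF inj, of t t'] that by auto
  have vR: "?v \<in> R"
  proof -
    have "Q h \<noteq> Q t" if "t < h" for t using Qneq[OF that h] by simp
    then show ?thesis using Q[OF h] by (auto simp: R_def)
  qed
  have Im: "e \<in> I R' w \<longleftrightarrow> e < m - 1 \<and> (\<exists>y\<in>R'. ends x (edge_ptr n m e) = {w, y})" for e R' w
    by (simp add: I_def incident_def)
  have "card (I R ?v) = 1" using deg[OF vR] deg1 by simp
  then obtain e where e: "I R ?v = {e}" by (rule card_1_singletonE)
  then have p: "p = edge_ptr n m e" using S[OF vR] by (simp add: p_def)
  have "e \<in> I R ?v" using e by simp
  then obtain y where y: "e < m - 1" "y \<in> R" "ends x p = {?v, y}" unfolding Im p by blast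
  have uy: "u = y"
    using y(3) by (auto simp: u_def ends_def doubleton_eq_iff)
  note y = y[folded uy]
  have sg: "simple_graph {..<m} ?E" by (rule simple_input_edges[OF wf])
  have "{?v, u} \<in> ?E" using y(1,3) p by (auto simp: input_edges_def)
  then have vu: "?v \<noteq> u" using simple_graphD(3)[OF sg] by blast
  have nbrs: "{y \<in> {..<m} - Q ` {..<h}. {?v, y} \<in> ?E} = {u}"
  proof -
    have "z = u" if z: "z \<in> R" "{?v, z} \<in> ?E" for z
    proof -
      obtain e' where e': "e' < m - 1" "{?v, z} = ends x (edge_ptr n m e')"
        using z(2) by (auto simp: input_edges_def)
      then have "e' \<in> I R ?v" unfolding Im using z(1) by metis
      then have "e' = e" using e by simp
      then show ?thesis using e'(2) y(3) p by (auto simp: doubleton_eq_iff)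
    qed
    then show ?thesis using y(2) \<open>{?v, u} \<in> ?E\<close> unfolding R_def by blast
  qed
  define R' where "R' = R - {?v}"
  have R': "{..<m} - Q ` {..<Suc h} = R'" by (auto simp: R'_def R_def lessThan_Suc)
  have uR': "u \<in> R'" using y(2) vu by (simp add: R'_def)
  \<comment> \<open>Removing \<open>?v\<close> deletes the single position \<open>e\<close>, and it
    does so only from the incidences of \<open>u\<close>.\<close>
  have I_other: "I R' w = I R w" if w: "w \<in> R'" "w \<noteq> u" for w
  proof -
    have False if "e' < m - 1" "ends x (edge_ptr n m e') = {w, ?v}" for e'
    proof -
      have "e' \<in> I R ?v" unfolding Im using that w(1) by (auto simp: R'_def insert_commute)
      then show False using e that y(3) p w by (auto simp: doubleton_eq_iff R'_def)
    qed
    then show ?thesis unfolding I_def incident_def R'_def by fastforce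
  qed
  have eu: "e \<in> I R u" unfolding Im using y p vR by (auto simp: insert_commute)
  have I_u: "I R' u = I R u - {e}"
  proof -
    have "e' \<in> I R' u \<longleftrightarrow> e' \<in> I R u \<and> e' \<noteq> e" for e'
    proof
      assume *: "e' \<in> I R' u"
      then obtain z where "z \<in> R'" "ends x (edge_ptr n m e') = {u, z}" unfolding Im by blast
      then have "e' \<noteq> e" using y(3) p vu by (auto simp: R'_def doubleton_eq_iff)
      then show "e' \<in> I R u \<and> e' \<noteq> e" using * unfolding Im R'_def by blast
    next
      assume *: "e' \<in> I R u \<and> e' \<noteq> e"
      then obtain z where z: "e' < m - 1" "z \<in> R" "ends x (edge_ptr n m e') = {u, z}"
        unfolding Im by blast
      have "z \<noteq> ?v"
      proof
        assume "z = ?v"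
        then have "e' \<in> I R ?v" unfolding Im using z y(2) by (auto simp: insert_commute)
        then show False using e * by simp
      qed
      then show "e' \<in> I R' u" unfolding Im R'_def using z by blast
    qed
    then show ?thesis by blast
  qed
  have fin: "finite (I R w)" for w by (simp add: I_def)
  have deg': "deg' w = card (I R' w)" if "w \<in> R'" for w
    using that deg[of w] I_other[of w] I_u eu fin[of u]
    by (cases "w = u") (auto simp: deg'_def R'_def)
  have S': "S' w = (\<Sum>e\<in>I R' w. edge_ptr n m e)" if "w \<in> R'" for w
    using that S[of w] I_other[of w] I_u eu fin[of u] sum.remove[OF fin[of u] eu, of "edge_ptr n m"]
    by (cases "w = u") (auto simp: S'_def R'_def p)
  define c where "c \<longleftrightarrow> u \<noteq> 0 \<and> deg' u = 1"
  define Q' where "Q' = (if c then Q(tail := u) else Q)"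
  define tail' where "tail' = (if c then Suc tail else tail)"
  have Q'eq: "Q' t = Q t" if "t < tail" for t using that by (simp add: Q'_def)
  have Q'im: "Q' ` {..<k} = Q ` {..<k}" if "k \<le> tail" for k
    using Q'eq that by (intro image_cong) auto
  \<comment> \<open>A degree that has just fallen to 1 was 2 before, while waiting vertices have
    degree at most 1; so no vertex is queued twice.\<close>
  have u_new: "u \<notin> Q ` {..<tail}" if c
  proof
    assume "u \<in> Q ` {..<tail}"
    then obtain t where t: "t < tail" "u = Q t" by auto
    then have "h \<le> t" using y(2) by (force simp: R_def)
    then have "deg u \<le> 1" using le1 t by simp
    then show False using that by (simp add: c_def deg'_def)
  qed
  have Q'tail: "Q' ` {..<tail'} = (if c then insert u (Q ` {..<tail}) else Q ` {..<tail})"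
    using Q'im[OF order_refl] by (auto simp: tail'_def lessThan_Suc Q'_def)
  have "elim_invariant x n m Q' (P(Q h := u)) deg' S' (Suc h) tail'"
    unfolding elim_invariant_def Q'im[OF Suc_leI[OF h]] R' Let_def I_def[symmetric]
  proof (intro conjI allI ballI impI)
    have "leaf_seq {..<m} ?E (Q(h := ?v)) (P(?v := u)) (Suc h)"
      using leaf_seq_extend[OF ls vR[unfolded R_def] _ nbrs] Q[OF h] by blast
    then show "leaf_seq {..<m} ?E Q' (P(?v := u)) (Suc h)"
      by (rule leaf_seq_cong) (use Q'eq h in simp)
    show "Suc h \<le> tail'" using h by (simp add: tail'_def)
    show "inj_on Q' {..<tail'}"
    proof (cases c)
      case True
      have "inj_on Q' (insert tail {..<tail})"
        using inj u_new[OF True] True unfolding Q'_def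
        by (subst inj_on_insert) (auto simp: inj_on_def)
      then show ?thesis using True by (simp add: tail'_def lessThan_Suc)
    next
      case False
      then show ?thesis using inj by (simp add: Q'_def tail'_def)
    qed
    fix t assume t: "t < tail'"
    show "Q' t < m" "Q' t \<noteq> 0"
      using t Q[of t] uR' by (auto simp: Q'_def tail'_def c_def R'_def R_def split: if_splits)
    assume "Suc h \<le> t"
    then show "deg' (Q' t) \<le> 1"
      using t le1[of t] by (auto simp: Q'_def tail'_def c_def deg'_def split: if_splits)
  next
    fix w assume w: "w \<in> R'"
    show "deg' w = card (I R' w)" using deg'[OF w] .
    show "S' w = (\<Sum>e\<in>I R' w. edge_ptr n m e)" using S'[OF w] .
    assume "w \<noteq> 0" "deg' w = 1"
    then show "w \<in> Q' ` {..<tail'}"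
      using queued[of w] w unfolding Q'tail
      by (cases "w = u") (auto simp: c_def deg'_def R'_def)
  next
    fix j assume "j < Suc h"
    then consider "j < h" | "j = h" by fastforce
    then show "\<exists>e<m - 1. S' (Q' j) = edge_ptr n m e \<and> ends x (S' (Q' j)) = {Q' j, (P(?v := u)) (Q' j)}"
    proof cases
      case 1
      then have "Q j \<in> Q ` {..<h}" by simp
      then have "Q j \<noteq> u" "Q j \<noteq> ?v" using y(2) vR unfolding R_def by (metis DiffD2)+
      then show ?thesis using ptr[OF 1] Q'eq 1 h by (simp add: S'_def)
    next
      case 2
      then show ?thesis using y(1,3) p p_def Q'eq h vu by (auto simp: S'_def)
    qed
  qed
  then show ?thesis unfolding Q'_def tail'_def c_def .
qed

text \<open>A tree on \<open>m\<close> vertices has exactly \<open>m - 1\<close> edges, so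
  \<open>m - 1\<close> positions that yield all of them cannot contain a repetition. This is how
  inputs listing an edge twice are recognised as invalid.\<close>

lemma input_edges_inj:
  assumes wf: "well_formed x L n m" and tree: "is_tree {..<m} (input_edges x n m)"
  shows "inj_on (\<lambda>e. ends x (edge_ptr n m e)) {..<m - 1}"
proof -
  have m: "0 < m" using well_formed_size(3)[OF wf] by simp
  obtain Q par where "leaf_seq {..<m} (input_edges x n m) Q par (m - 1)"
    using leaf_seq_ex[OF tree, of "m - 1"] m by auto
  then interpret elimination m "input_edges x n m" Q par "m - 1"
    using simple_input_edges[OF wf] m by unfold_locales auto
  show ?thesis
    using card_edges unfolding input_edges_def by (intro eq_card_imp_inj_on) auto
qed

text \<open>If the queue is empty, the leaf that a tree still has would have been queued. If the
  head of the queue has degree 0, it is cut off from the root.\<close>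

lemma elim_stuck:
  assumes wf: "well_formed x L n m" and inv: "elim_invariant x n m Q P deg S h tail"
    and h: "h < m - 1" and stuck: "tail \<le> h \<or> deg (Q h) \<noteq> 1"
  shows "\<not> is_tree {..<m} (input_edges x n m)"
proof
  let ?E = "input_edges x n m"
  assume tree: "is_tree {..<m} ?E"
  define R where "R = {..<m} - Q ` {..<h}"
  define I where "I = (\<lambda>w. incident x n m (m - 1) R w)"
  have ls: "leaf_seq {..<m} ?E Q P h" and "h \<le> tail" and inj: "inj_on Q {..<tail}"
    and Q: "\<And>t. t < tail \<Longrightarrow> Q t < m \<and> Q t \<noteq> 0"
    and deg: "\<And>w. w \<in> R \<Longrightarrow> deg w = card (I w)"
    and queued: "\<And>w. w \<in> R \<Longrightarrow> w \<noteq> 0 \<Longrightarrow> deg w = 1 \<Longrightarrow> w \<in> Q ` {..<tail}"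
    and le1: "\<And>t. t < tail \<Longrightarrow> h \<le> t \<Longrightarrow> deg (Q t) \<le> 1"
    using inv unfolding elim_invariant_def R_def I_def Let_def by blast+
  have zero: "0 \<in> {..<m}" using h by simp
  have edge_in: "\<exists>e\<in>I w. ends x (edge_ptr n m e) = {w, y}" if "{w, y} \<in> ?E" "y \<in> R" for w y
    using that by (fastforce simp: input_edges_def I_def incident_def)
  show False
  proof (cases "tail \<le> h")
    case True
    then have tail: "tail = h" using \<open>h \<le> tail\<close> by simp
    have "card (R - {0}) \<noteq> 0"
      using remaining_card[OF ls] h card_Diff_singleton_if[of R 0] by (auto simp: R_def)
    then obtain z0 where "z0 \<in> R - {0}" by (metis card.empty ex_in_conv)
    then obtain z y where z: "z \<in> R" "z \<noteq> 0" "{y \<in> R. {z, y} \<in> ?E} = {y}"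
      using leaf_exists[OF tree ls zero, of z0] unfolding R_def by blast
    have yR: "y \<in> R" "{z, y} \<in> ?E" using z(3) by auto
    obtain e where e: "e \<in> I z" "ends x (edge_ptr n m e) = {z, y}" using edge_in[OF yR(2,1)] by blast
    \<comment> \<open>A single remaining neighbour gives degree 1 only because no edge is listed at
      two positions.\<close>
    have "e' = e" if e': "e' \<in> I z" for e'
    proof -
      obtain y' where y': "y' \<in> R" "ends x (edge_ptr n m e') = {z, y'}" "e' < m - 1"
        using e' by (auto simp: I_def incident_def)
      then have "{z, y'} \<in> ?E" by (auto simp: input_edges_def)
      then have "y' = y" using y'(1) z(3) by blast
      then show ?thesis
        using inj_onD[OF input_edges_inj[OF wf tree], of e' e] e y' by (auto simp: I_def incident_def)
    qed
    then have "I z = {e}" using e(1) by blast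
    then have "deg z = 1" using deg[OF z(1)] by simp
    then show False using queued[OF z(1,2)] z(1) tail by (simp add: R_def)
  next
    case False
    then have ht: "h < tail" by simp
    have "Q h \<noteq> Q t" if "t < h" for t using inj_onD[OF inj, of h t] that ht by auto
    then have QR: "Q h \<in> R" using Q[OF ht] by (auto simp: R_def)
    have "deg (Q h) = 0" using le1[OF ht] stuck False by linarith
    then have "I (Q h) = {}" using deg[OF QR] by (simp add: I_def)
    moreover obtain y where "y \<in> R" "{Q h, y} \<in> ?E"
      using remaining_neighbour[OF _ ls zero, of "Q h"] tree QR Q[OF ht]
      unfolding R_def is_tree_def by blast
    ultimately show False using edge_in by blast
  qed
qed

section \<open>Programs for the degrees, the queue of leaves and the elimination\<close>

definition degrees :: com where
  "degrees = Assign vp (V vpe) ;; For vi vH (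
     Assign vu (Arr aX (V vp)) ;; Assign vv (Arr aX (Plus (V vp) (N 1))) ;;
     add_arr aDeg (V vu) (N 1) ;; add_arr aDeg (V vv) (N 1) ;;
     add_arr aS (V vu) (V vp) ;; add_arr aS (V vv) (V vp) ;; incr vp (N 4))"

lemma degrees_simps [simp]:
  "changed_vars degrees = {vp, vi, vu, vv}" "changed_arrs degrees = {aDeg, aS}"
  "silent degrees" "com_fits degrees"
  by (auto simp: degrees_def)

lemma wp_degrees:
  assumes wf: "well_formed x L n m" and ld: "loaded x n m s"
    and zero: "arrs s aDeg = (\<lambda>_. 0)" "arrs s aS = (\<lambda>_. 0)"
    and post: "\<And>s' t'. t' \<le> t + 3 + (m - 1) * 9 \<Longrightarrow> frame degrees s s' \<Longrightarrow>
      (\<And>w. arrs s' aDeg w = card (incident x n m (m - 1) {..<m} w)) \<Longrightarrow>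
      (\<And>w. arrs s' aS w = (\<Sum>e\<in>incident x n m (m - 1) {..<m} w. edge_ptr n m e)) \<Longrightarrow> Q s' t'"
  shows "wp degrees Q s t"
  unfolding degrees_def wp_simps
proof (rule wp_For[where n = "m - 1" and B = 7 and I = "\<lambda>j s. vars s vp = edge_ptr n m j \<and>
    (\<forall>w. arrs s aDeg w = card (incident x n m j {..<m} w)) \<and>
    (\<forall>w. arrs s aS w = (\<Sum>e\<in>incident x n m j {..<m} w. edge_ptr n m e))"], goal_cases)
  case 5
  then show ?case using zero ld by (simp add: loaded_def edge_ptr_def incident_def)
next
  case (6 j s1 t1)
  note fr = frameD[OF 6(2)]
  note e = well_formed_edge[OF wf 6(1)]
  have X: "arrs s1 aX = x" using ld fr by (simp add: loaded_def)
  have p: "vars s1 vp = edge_ptr n m j"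
    and deg: "\<And>w. arrs s1 aDeg w = card (incident x n m j {..<m} w)"
    and S: "\<And>w. arrs s1 aS w = (\<Sum>e\<in>incident x n m j {..<m} w. edge_ptr n m e)"
    using 6(4) by auto
  have ptr: "edge_ptr n m (Suc j) = edge_ptr n m j + 4" by (simp add: edge_ptr_def)
  show ?case
    using e(3) by (auto simp: X p deg S incident_Suc[OF wf 6(1)] not_incident ptr)
next
  case (7 s1 t1)
  note fr = frameD[OF 7(2)]
  show ?case by (rule post) (use 7 fr in \<open>simp_all add: frame_def\<close>)
qed (use ld in \<open>simp_all add: loaded_def\<close>)

definition enqueue_leaves :: com where
  "enqueue_leaves = Assign vtail (N 0) ;; For vu vm (
     If (V vu) (If (neq (Arr aDeg (V vu)) (N 1)) Skip
       (Update aQ (V vtail) (V vu) ;; incr vtail (N 1))) Skip)"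

lemma enqueue_leaves_simps [simp]:
  "changed_vars enqueue_leaves = {vtail, vu}" "changed_arrs enqueue_leaves = {aQ}"
  "silent enqueue_leaves" "com_fits enqueue_leaves"
  by (auto simp: enqueue_leaves_def)

lemma wp_enqueue_leaves:
  assumes "vars s vm = m" "arrs s aDeg = deg"
    and post: "\<And>s' t'. t' \<le> t + 3 + m * 7 \<Longrightarrow> frame enqueue_leaves s s' \<Longrightarrow>
      arrs s' aQ ` {..<vars s' vtail} = {w. w < m \<and> w \<noteq> 0 \<and> deg w = 1} \<Longrightarrow>
      inj_on (arrs s' aQ) {..<vars s' vtail} \<Longrightarrow> Q s' t'"
  shows "wp enqueue_leaves Q s t"
  unfolding enqueue_leaves_def wp_simps
proof (rule wp_For[where n = m and B = 5 and I = "\<lambda>j s.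
    arrs s aQ ` {..<vars s vtail} = {w. w < j \<and> w \<noteq> 0 \<and> deg w = 1} \<and>
    inj_on (arrs s aQ) {..<vars s vtail}"], goal_cases)
  case (6 j s1 t1)
  note fr = frameD[OF 6(2)]
  define q tl where "q = arrs s1 aQ" and "tl = vars s1 vtail"
  have q: "q ` {..<tl} = {w. w < j \<and> w \<noteq> 0 \<and> deg w = 1}" "inj_on q {..<tl}"
    using 6(4) by (simp_all add: q_def tl_def)
  have j: "vars s1 vu = j" "arrs s1 aDeg = deg" using 6 fr assms by simp_all
  have jq: "j \<notin> q ` {..<tl}" unfolding q(1) by simp
  have im: "(q(tl := j)) ` {..<Suc tl} = insert j (q ` {..<tl})"
    unfolding lessThan_Suc by (auto simp: image_iff)
  have inj: "inj_on (q(tl := j)) {..<Suc tl}"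
    using q(2) jq unfolding lessThan_Suc by (subst inj_on_insert) (auto simp: inj_on_def)
  have im': "{w. w < Suc j \<and> w \<noteq> 0 \<and> deg w = 1} =
      (if j \<noteq> 0 \<and> deg j = 1 then insert j {w. w < j \<and> w \<noteq> 0 \<and> deg w = 1}
       else {w. w < j \<and> w \<noteq> 0 \<and> deg w = 1})"
    by (auto simp: less_Suc_eq)
  have upd: "(\<lambda>a. if a = tl then j else q a) = q(tl := j)" by auto
  have q0: "j = 0 \<Longrightarrow> tl = 0" using q(1) by auto
  show ?case
    using im[unfolded q(1)] inj q im' q0
    by (auto simp: j q_def[symmetric] tl_def[symmetric])
next
  case (7 s1 t1)
  note fr = frameD[OF 7(2)]
  show ?case by (rule post) (use 7 fr in \<open>simp_all add: frame_def\<close>)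
qed (use assms in simp_all)

definition eliminate_leaf :: com where
  "eliminate_leaf = Assign vv (Arr aQ (V vh)) ;;
     If (neq (Arr aDeg (V vv)) (N 1)) (fail_if (N 1))
       (Assign vp (Arr aS (V vv)) ;;
        Assign vu (Minus (Plus (Arr aX (V vp)) (Arr aX (Plus (V vp) (N 1)))) (V vv)) ;;
        Update aP (V vv) (V vu) ;; sub_arr aDeg (V vu) (N 1) ;; sub_arr aS (V vu) (V vp) ;;
        If (V vu) (If (neq (Arr aDeg (V vu)) (N 1)) Skip
          (Update aQ (V vtail) (V vu) ;; incr vtail (N 1))) Skip)"

definition eliminate :: com where
  "eliminate = For vh vH (If (lt (V vh) (V vtail)) eliminate_leaf (fail_if (N 1)))"

lemma eliminate_simps [simp]:
  "changed_vars eliminate = {vh, vv, vp, vu, vtail, vok}"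
  "changed_arrs eliminate = {aP, aDeg, aS, aQ}" "silent eliminate" "com_fits eliminate"
  by (auto simp: eliminate_def eliminate_leaf_def)

abbreviation elim_state :: "(nat \<Rightarrow> nat) \<Rightarrow> nat \<Rightarrow> nat \<Rightarrow> nat \<Rightarrow> store \<Rightarrow> bool" where
  "elim_state x n m h s \<equiv>
     elim_invariant x n m (arrs s aQ) (arrs s aP) (arrs s aDeg) (arrs s aS) h (vars s vtail)"

text \<open>A failure does not end the loop. From then on the invariant records only that the graph
  is no tree, and further iterations, whatever they do to the arrays, can at most clear the flag
  again.\<close>

lemma wp_eliminate:
  assumes wf: "well_formed x L n m" and ld: "loaded x n m s" and ok: "vars s vok = 1"
    and inv: "elim_state x n m 0 s"
    and post: "\<And>s' t'. t' \<le> t + 2 + (m - 1) * 16 \<Longrightarrow> frame eliminate s s' \<Longrightarrow>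
      vars s' vok = 1 \<and> elim_state x n m (m - 1) s' \<or>
      vars s' vok = 0 \<and> \<not> is_tree {..<m} (input_edges x n m) \<Longrightarrow> Q s' t'"
  shows "wp eliminate Q s t"
  unfolding eliminate_def
proof (rule wp_For[where n = "m - 1" and B = 14 and I = "\<lambda>h s.
    vars s vok = 1 \<and> elim_state x n m h s \<or>
    vars s vok = 0 \<and> \<not> is_tree {..<m} (input_edges x n m)"], goal_cases)
  case 1 then show ?case by (simp add: eliminate_leaf_def)
next
  case 2 then show ?case by (simp add: eliminate_leaf_def)
next
  case (6 h s1 t1)
  note fr = frameD[OF 6(2)]
  have X: "arrs s1 aX = x" using ld fr by (simp add: loaded_def eliminate_leaf_def)
  have vh: "vars s1 vh = h" using 6 by simp
  show ?case
  proof (cases "vars s1 vok = 0")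
    case True
    then have "\<not> is_tree {..<m} (input_edges x n m)" using 6 by auto
    then show ?thesis using True by (simp add: eliminate_leaf_def vh)
  next
    case False
    then have ok: "vars s1 vok = 1" and inv: "elim_state x n m h s1" using 6 by auto
    let ?q = "arrs s1 aQ" and ?deg = "arrs s1 aDeg"
    show ?thesis
    proof (cases "h < vars s1 vtail \<and> ?deg (?q h) = 1")
      case True
      then have *: "h < vars s1 vtail" "?deg (?q h) = 1" by auto
      define p u where "p = arrs s1 aS (?q h)" and "u = x p + x (p + 1) - ?q h"
      have u: "x p + x (Suc p) - ?q h = u" "?q h < x p + x (Suc p) \<longleftrightarrow> 0 < u"
        by (auto simp: u_def)
      note st = elim_step[OF wf inv *, folded p_def, folded u_def]
      show ?thesis
        using st * ok
        by (cases "u = 0"; cases "?deg u - 1 = 1")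
          (simp_all add: eliminate_leaf_def vh X p_def[symmetric] u)
    next
      case stuck: False
      then have "\<not> is_tree {..<m} (input_edges x n m)"
        using elim_stuck[OF wf inv 6(1)] by auto
      then show ?thesis using stuck by (auto simp: eliminate_leaf_def vh)
    qed
  qed
next
  case (7 s1 t1)
  note fr = frameD[OF 7(2)]
  show ?case by (rule post) (use 7 fr in \<open>simp_all add: frame_def eliminate_leaf_def\<close>)
qed (use assms in \<open>simp_all add: loaded_def\<close>)

definition find_order :: com where
  "find_order = degrees ;; enqueue_leaves ;; eliminate"

lemma find_order_simps [simp]:
  "changed_vars find_order = {vp, vi, vu, vv, vtail, vh, vok}"
  "changed_arrs find_order = {aDeg, aS, aQ, aP}" "silent find_order" "com_fits find_order"
  by (auto simp: find_order_def)

definition edge_pointers :: "(nat \<Rightarrow> nat) \<Rightarrow> nat \<Rightarrow> (nat \<Rightarrow> nat) \<Rightarrow> (nat \<Rightarrow> nat) \<Rightarrow> (nat \<Rightarrow> nat) \<Rightarrow> nat \<Rightarrow> bool" where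
  "edge_pointers x n Q P S m \<longleftrightarrow> (\<forall>h<m - 1. \<exists>e<m - 1. S (Q h) = edge_ptr n m e \<and>
     ends x (S (Q h)) = {Q h, P (Q h)})"

lemma wp_find_order:
  assumes wf: "well_formed x L n m" and ld: "loaded x n m s" and ok: "vars s vok = 1"
    and zero: "arrs s aDeg = (\<lambda>_. 0)" "arrs s aS = (\<lambda>_. 0)"
    and post: "\<And>s' t'. t' \<le> t + 40 * m \<Longrightarrow> frame find_order s s' \<Longrightarrow>
      vars s' vok = (if is_tree {..<m} (input_edges x n m) then 1 else 0) \<Longrightarrow>
      (is_tree {..<m} (input_edges x n m) \<Longrightarrow>
        elimination m (input_edges x n m) (arrs s' aQ) (arrs s' aP) (m - 1) \<and>
        edge_pointers x n (arrs s' aQ) (arrs s' aP) (arrs s' aS) m) \<Longrightarrow> Q s' t'"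
  shows "wp find_order Q s t"
proof -
  have m: "0 < m" using well_formed_size(3)[OF wf] by simp
  let ?tree = "is_tree {..<m} (input_edges x n m)"
  have "wp find_order (\<lambda>s' t'. t' \<le> t + 40 * m \<and> vars s' vok = (if ?tree then 1 else 0) \<and>
      (?tree \<longrightarrow> elimination m (input_edges x n m) (arrs s' aQ) (arrs s' aP) (m - 1) \<and>
        edge_pointers x n (arrs s' aQ) (arrs s' aP) (arrs s' aS) m)) s t"
    unfolding find_order_def wp_simps
  proof (rule wp_degrees[OF wf ld zero], goal_cases)
    case (1 s1 t1)
    note fr1 = frameD[OF 1(2)]
    show ?case
    proof (rule wp_enqueue_leaves[where m = m and deg = "arrs s1 aDeg"], goal_cases)
      case (3 s2 t2)
      note fr2 = frameD[OF 3(2)]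
      have ld2: "loaded x n m s2" using ld by (simp add: loaded_def fr1 fr2)
      let ?q = "arrs s2 aQ" and ?tl = "vars s2 vtail"
      have q: "t < ?tl \<Longrightarrow> ?q t < m \<and> ?q t \<noteq> 0 \<and> arrs s1 aDeg (?q t) = 1" for t
        using 3(3) by blast
      have inv: "elim_state x n m 0 s2"
        unfolding elim_invariant_def
        using q 3(3,4) 1(3,4) by (auto simp: leaf_seq_def fr2 Let_def)
      show ?case
      proof (rule wp_eliminate[OF wf ld2 _ inv], goal_cases)
        case 1 then show ?case using ok by (simp add: fr1 fr2)
      next
        case (2 s3 t3)
        have time: "t3 \<le> t + 40 * m" using 1(1) 3(1) 2(1) m by (cases m) auto
        show ?case
        proof (cases "vars s3 vok = 0")
          case True
          then show ?thesis using 2(3) time by auto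
        next
          case False
          then have ok: "vars s3 vok = 1" and inv: "elim_state x n m (m - 1) s3" using 2(3) by auto
          interpret elimination m "input_edges x n m" "arrs s3 aQ" "arrs s3 aP" "m - 1"
            using inv simple_input_edges[OF wf] m
            by unfold_locales (auto simp: elim_invariant_def)
          have "edge_pointers x n (arrs s3 aQ) (arrs s3 aP) (arrs s3 aS) m"
            using inv by (auto simp: elim_invariant_def edge_pointers_def)
          then show ?thesis using tree ok time elimination_axioms by simp
        qed
      qed
    qed (use ld in \<open>simp_all add: fr1 loaded_def\<close>)
  qed
  then show ?thesis
    by (rule wp_mono[OF wp_frame]) (use post in blast)
qed

subsection \<open>Tables\<close>

text \<open>An entry 0 of a table stands for infinity, an entry \<open>c + 1\<close> for the cost \<open>c\<close>.\<close>

definition decode :: "nat \<Rightarrow> enat" where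
  "decode c = (if c = 0 then \<infinity> else enat (c - 1))"

lemma decode_0 [simp]: "decode 0 = \<infinity>" and decode_Suc [simp]: "decode (Suc c) = enat c"
  by (simp_all add: decode_def)

lemma decode_eq_infinity [simp]: "decode c = \<infinity> \<longleftrightarrow> c = 0"
  by (simp add: decode_def)

lemma row_less: "u < v \<Longrightarrow> k \<le> n \<Longrightarrow> u * Suc n + k < v * Suc n"
proof -
  assume "u < v" "k \<le> n"
  then have "u * Suc n + k < Suc u * Suc n" by simp
  also have "\<dots> \<le> v * Suc n" using \<open>u < v\<close> by (intro mult_le_mono1) simp
  finally show ?thesis .
qed

lemma row_disjoint:
  "u \<noteq> v \<Longrightarrow> k \<le> n \<Longrightarrow> u * Suc n + k < v * Suc n \<or> v * Suc n + Suc n \<le> u * Suc n + k"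
  using row_less[of u v k n] row_less[of v u n n] by (cases "u < v") auto

definition node_ptr :: "nat \<Rightarrow> nat \<Rightarrow> nat" where
  "node_ptr n u = n * n + 2 + 2 * u"

definition node_cost_fun :: "(nat \<Rightarrow> nat) \<Rightarrow> nat \<Rightarrow> nat \<Rightarrow> nat \<Rightarrow> enat" where
  "node_cost_fun x n u k = (if k \<le> x (node_ptr n u) then enat (k * x (node_ptr n u + 1)) else \<infinity>)"

text \<open>The row offsets \<open>u * Suc n\<close> arise by running addition and are kept in
  \<open>aRow\<close>, so that later accesses need no product. Likewise \<open>va\<close> runs
  through the multiples of the node cost.\<close>

definition init_tables :: com where
  "init_tables = Assign vz (N 0) ;; Assign vp (Plus (V vsq) (N 2)) ;; For vu vm (
     Update aRow (V vu) (V vz) ;; Assign vc (Arr aX (V vp)) ;;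
     Assign vw (Arr aX (Plus (V vp) (N 1))) ;; Assign va (N 0) ;;
     For vk vN (If (lt (V vc) (V vk)) (Update aD (V vz) (N 0)) (Update aD (V vz) (Plus (V va) (N 1))) ;;
       incr va (V vw) ;; incr vz (N 1)) ;;
     incr vp (N 2))"

lemma init_tables_simps [simp]:
  "changed_vars init_tables = {vz, vp, vu, vc, vw, va, vk}" "changed_arrs init_tables = {aRow, aD}"
  "silent init_tables" "com_fits init_tables"
  by (auto simp: init_tables_def)

lemma wp_init_tables:
  assumes ld: "loaded x n m s"
    and post: "\<And>s' t'. t' \<le> t + 4 + m * (Suc n * 6 + 9) \<Longrightarrow> frame init_tables s s' \<Longrightarrow>
      (\<And>u. u < m \<Longrightarrow> arrs s' aRow u = u * Suc n) \<Longrightarrow>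
      (\<And>u k. u < m \<Longrightarrow> k \<le> n \<Longrightarrow> decode (arrs s' aD (u * Suc n + k)) = node_cost_fun x n u k) \<Longrightarrow>
      Q s' t'"
  shows "wp init_tables Q s t"
  unfolding init_tables_def wp_simps
proof (rule wp_For[where n = m and B = "Suc n * 6 + 7" and I = "\<lambda>j s.
    vars s vz = j * Suc n \<and> vars s vp = node_ptr n j \<and> (\<forall>u<j. arrs s aRow u = u * Suc n) \<and>
    (\<forall>u<j. \<forall>k\<le>n. decode (arrs s aD (u * Suc n + k)) = node_cost_fun x n u k)"], goal_cases)
  case (6 j s1 t1)
  note fr = frameD[OF 6(2)]
  have s1: "arrs s1 aX = x" "vars s1 vN = Suc n" using ld fr by (simp_all add: loaded_def)
  let ?d = "arrs s1 aD"
  show ?case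
    unfolding wp_simps
  proof (rule wp_For[where n = "Suc n" and B = 4 and I = "\<lambda>k s.
      vars s vz = j * Suc n + k \<and> vars s va = k * x (node_ptr n j + 1) \<and>
      (\<forall>i<j * Suc n. arrs s aD i = ?d i) \<and>
      (\<forall>k'<k. decode (arrs s aD (j * Suc n + k')) = node_cost_fun x n j k')"], goal_cases)
    case (6 k s2 t2)
    note fr2 = frameD[OF 6(2)]
    have s2: "vars s2 vc = x (node_ptr n j)" "vars s2 vw = x (node_ptr n j + 1)"
      using s1 \<open>vars s1 vz = j * Suc n \<and> _\<close> by (simp_all add: fr2)
    show ?case
      using 6 s2 by (auto simp: less_Suc_eq node_cost_fun_def add.commute)
  next
    case (7 s2 t2)
    note fr2 = frameD[OF 7(2)]
    have I: "vars s1 vz = j * Suc n" "vars s1 vp = node_ptr n j"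
      "\<And>u. u < j \<Longrightarrow> arrs s1 aRow u = u * Suc n"
      "\<And>u k. u < j \<Longrightarrow> k \<le> n \<Longrightarrow> decode (?d (u * Suc n + k)) = node_cost_fun x n u k"
      using 6(4) by auto
    have J: "vars s2 vz = Suc j * Suc n" "\<And>i. i < j * Suc n \<Longrightarrow> arrs s2 aD i = ?d i"
      "\<And>k. k \<le> n \<Longrightarrow> decode (arrs s2 aD (j * Suc n + k)) = node_cost_fun x n j k"
      using 7(4) by (auto simp: less_Suc_eq_le)
    have D: "decode (arrs s2 aD (u * Suc n + k)) = node_cost_fun x n u k" if "u < Suc j" "k \<le> n" for u k
    proof (cases "u = j")
      case True
      then show ?thesis using J(3) that by simp
    next
      case False
      then have "u < j" using that by simp
      then show ?thesis using J(2)[OF row_less[OF _ that(2)]] I(4) that by simp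
    qed
    have R: "arrs s2 aRow u = u * Suc n" if "u < Suc j" for u
      using that I(1,3) 6(3) by (auto simp: fr2 less_Suc_eq)
    have "vars s2 vp = node_ptr n j" using I(2) by (simp add: fr2)
    then show ?case
      using 7(1) J(1) D R by (simp add: node_ptr_def del: mult_Suc)
  qed (use 6 s1 in simp_all)
next
  case (7 s1 t1)
  note fr = frameD[OF 7(2)]
  show ?case by (rule post) (use 7 fr in \<open>simp_all add: frame_def\<close>)
qed (use ld in \<open>simp_all add: loaded_def node_ptr_def\<close>)

text \<open>Adding \<open>j\<close> and \<open>j * w\<close> in \<open>n - j\<close> rounds yields
  \<open>j * (n - j)\<close> and \<open>j * (n - j) * w\<close>; the whole table takes time
  quadratic in \<open>n\<close>, like the convolution. As \<open>vx\<close> encodes a cost plus one,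
  \<open>vx + vb\<close> is again an encoded cost.\<close>

definition edge_table :: com where
  "edge_table = Assign vjw (N 0) ;; For vj vN (
     Assign vd (Minus (V vn) (V vj)) ;; Assign va (N 0) ;; Assign vb (N 0) ;;
     For vi vd (incr va (V vj) ;; incr vb (V vjw)) ;;
     Assign vx (Arr aD (Plus (V vrv) (V vj))) ;;
     If (V vx) (If (lt (V vc) (V va)) (Update aE (V vj) (N 0)) (Update aE (V vj) (Plus (V vx) (V vb))))
       (Update aE (V vj) (N 0)) ;;
     incr vjw (V vw))"

lemma edge_table_simps [simp]:
  "changed_vars edge_table = {vjw, vj, vd, va, vb, vi, vx}" "changed_arrs edge_table = {aE}"
  "silent edge_table" "com_fits edge_table"
  by (auto simp: edge_table_def)

definition edge_cost_fun :: "nat \<Rightarrow> nat \<Rightarrow> nat \<Rightarrow> nat \<Rightarrow> enat" where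
  "edge_cost_fun n c w k = (if k * (n - k) \<le> c then enat (k * (n - k) * w) else \<infinity>)"

lemma wp_edge_table:
  assumes "vars s vn = n" "vars s vN = Suc n" "vars s vc = c" "vars s vw = w" "vars s vrv = rv"
    and post: "\<And>s' t'. t' \<le> t + 3 + Suc n * (4 * n + 10 + 2) \<Longrightarrow> frame edge_table s s' \<Longrightarrow>
      (\<And>k. k \<le> n \<Longrightarrow> decode (arrs s' aE k) =
        decode (arrs s aD (rv + k)) + edge_cost_fun n c w k) \<Longrightarrow> Q s' t'"
  shows "wp edge_table Q s t"
  unfolding edge_table_def wp_simps
proof (rule wp_For[where n = "Suc n" and B = "4 * n + 10" and I = "\<lambda>j s'. vars s' vjw = j * w \<and>
    (\<forall>k<j. decode (arrs s' aE k) = decode (arrs s aD (rv + k)) + edge_cost_fun n c w k)"], goal_cases)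
  case (6 j s1 t1)
  note fr = frameD[OF 6(2)]
  have s1: "vars s1 vn = n" "vars s1 vc = c" "vars s1 vw = w" "vars s1 vrv = rv" "vars s1 vj = j"
    "arrs s1 aD = arrs s aD" "vars s1 vjw = j * w"
    "\<And>k. k < j \<Longrightarrow> decode (arrs s1 aE k) = decode (arrs s aD (rv + k)) + edge_cost_fun n c w k"
    using assms 6 fr by simp_all
  show ?case
    unfolding wp_simps
  proof (rule wp_For[where n = "n - j" and B = 2 and I = "\<lambda>i s'. vars s' va = i * j \<and>
      vars s' vb = i * (j * w)"], goal_cases)
    case (6 i s2 t2)
    note fr2 = frameD[OF 6(2)]
    show ?case using 6 s1 by (simp add: fr2)
  next
    case (7 s2 t2)
    note fr2 = frameD[OF 7(2)]
    have "(n - j) * 4 \<le> n * 4" by simp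
    then have time: "t2 \<le> t1 + 3 + 2 + 4 * n" using 7(1) by simp
    have s2: "vars s2 va = j * (n - j)" "vars s2 vb = j * (n - j) * w" using 7(4) by simp_all
    have s2': "vars s2 vc = c" "vars s2 vw = w" "vars s2 vrv = rv" "vars s2 vj = j"
      "arrs s2 aD = arrs s aD" "vars s2 vjw = j * w" "arrs s2 aE = arrs s1 aE"
      using s1 by (simp_all add: fr2)
    show ?case
      using s2 s2' s1(8) time
      by (cases "arrs s aD (rv + j)")
        (auto simp: less_Suc_eq edge_cost_fun_def add.commute not_less)
  qed (use s1 in simp_all)
next
  case (7 s1 t1)
  note fr = frameD[OF 7(2)]
  show ?case by (rule post) (use 7 fr in \<open>simp_all add: frame_def less_Suc_eq_le\<close>)
qed (use assms in simp_all)

text \<open>The sum of two encoded costs carries the increment twice, hence the subtraction of 1.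
  The inner test is nonzero exactly if \<open>vbest\<close> is infinite, that is 0, or larger than
  the candidate.\<close>

definition improve :: com where
  "improve = Assign vx (Arr aD (Plus (V vru) (Minus (V vk) (V vj)))) ;; Assign vy (Arr aE (V vj)) ;;
     If (V vx) (If (V vy)
       (Assign vz (Minus (Plus (V vx) (V vy)) (N 1)) ;;
        If (Plus (Minus (N 1) (V vbest)) (Minus (V vbest) (V vz)))
          (Assign vbest (V vz) ;; Assign vbj (V vj)) Skip) Skip) Skip"

text \<open>The old row of the parent is read for several \<open>k\<close>, so the new row is built
  in \<open>aF\<close>. The minimising splits are stored in the row of the child, which is merged
  only once.\<close>

definition convolve :: com where
  "convolve = For vk vN (
     Assign vbest (N 0) ;; Assign vbj (N 0) ;; Assign vk1 (Plus (V vk) (N 1)) ;;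
     For vj vk1 improve ;;
     Update aF (V vk) (V vbest) ;; Update aC (Plus (V vrv) (V vk)) (V vbj))"

lemma convolve_simps [simp]:
  "changed_vars convolve = {vk, vbest, vbj, vk1, vj, vx, vy, vz}" "changed_arrs convolve = {aF, aC}"
  "silent convolve" "com_fits convolve"
  by (auto simp: convolve_def improve_def)

lemma improve_step:
  fixes f :: "nat \<Rightarrow> enat" and best bj j k p q :: nat
  defines "better \<equiv> p \<noteq> 0 \<and> q \<noteq> 0 \<and> (best = 0 \<or> p + q - 1 < best)"
  assumes f: "f j = decode p + decode q"
    and inv: "bj \<le> k" "best = 0 \<or> decode best = f bj" "\<forall>j'<j. decode best \<le> f j'" "j \<le> k"
  shows "(if better then j else bj) \<le> k"
    "(if better then p + q - 1 else best) = 0 \<or>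
      decode (if better then p + q - 1 else best) = f (if better then j else bj)"
    "\<forall>j'<Suc j. decode (if better then p + q - 1 else best) \<le> f j'"
proof -
  show "(if better then j else bj) \<le> k" using inv by simp
  have fj: "f j = (if p = 0 \<or> q = 0 then \<infinity> else enat (p + q - 2))"
    using f by (cases p; cases q) auto
  show "(if better then p + q - 1 else best) = 0 \<or>
      decode (if better then p + q - 1 else best) = f (if better then j else bj)"
    using fj inv(2) by (auto simp: better_def decode_def)
  have "decode (if better then p + q - 1 else best) \<le> f j"
    using fj by (auto simp: better_def decode_def)
  moreover have "decode (if better then p + q - 1 else best) \<le> decode best"
    by (auto simp: better_def decode_def)
  ultimately show "\<forall>j'<Suc j. decode (if better then p + q - 1 else best) \<le> f j'"
    using inv(3) by (auto simp: less_Suc_eq intro: order_trans)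
qed

lemma wp_convolve:
  assumes "vars s vN = Suc n" "vars s vrv = rv" "vars s vru = ru"
    and post: "\<And>s' t'. t' \<le> t + 2 + Suc n * (Suc n * 10 + 9) \<Longrightarrow> frame convolve s s' \<Longrightarrow>
      (\<And>k j. k \<le> n \<Longrightarrow> j \<le> k \<Longrightarrow> decode (arrs s' aF k) \<le>
        decode (arrs s aD (ru + (k - j))) + decode (arrs s aE j)) \<Longrightarrow>
      (\<And>k. k \<le> n \<Longrightarrow> arrs s' aC (rv + k) \<le> k \<and> decode (arrs s' aF k) =
        decode (arrs s aD (ru + (k - arrs s' aC (rv + k)))) + decode (arrs s aE (arrs s' aC (rv + k)))) \<Longrightarrow>
      (\<And>i. i < rv \<or> rv + Suc n \<le> i \<Longrightarrow> arrs s' aC i = arrs s aC i) \<Longrightarrow> Q s' t'"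
  shows "wp convolve Q s t"
proof -
  define f where "f k j = decode (arrs s aD (ru + (k - j))) + decode (arrs s aE j)" for k j
  show ?thesis
    unfolding convolve_def
  proof (rule wp_For[where n = "Suc n" and B = "Suc n * 10 + 7" and I = "\<lambda>k s'.
      (\<forall>k'<k. \<forall>j\<le>k'. decode (arrs s' aF k') \<le> f k' j) \<and>
      (\<forall>k'<k. arrs s' aC (rv + k') \<le> k' \<and> decode (arrs s' aF k') = f k' (arrs s' aC (rv + k'))) \<and>
      (\<forall>i. i < rv \<or> rv + k \<le> i \<longrightarrow> arrs s' aC i = arrs s aC i)"], goal_cases)
    case (6 k s1 t1)
    note fr = frameD[OF 6(2)]
    have s1: "vars s1 vrv = rv" "vars s1 vru = ru" "vars s1 vk = k" "arrs s1 aD = arrs s aD"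
      "arrs s1 aE = arrs s aE"
      using assms 6 fr by (simp_all add: improve_def)
    show ?case
      unfolding wp_simps
    proof (rule wp_For[where n = "Suc k" and B = 8 and I = "\<lambda>j s'. vars s' vbj \<le> k \<and>
        (vars s' vbest = 0 \<or> decode (vars s' vbest) = f k (vars s' vbj)) \<and>
        (\<forall>j'<j. decode (vars s' vbest) \<le> f k j')"], goal_cases)
      case (6 j s2 t2)
      note fr2 = frameD[OF 6(2)]
      have s2: "vars s2 vru = ru" "vars s2 vk = k" "arrs s2 aD = arrs s aD" "arrs s2 aE = arrs s aE"
        "vars s2 vj = j"
        using s1 6 by (simp_all add: fr2 improve_def)
      define p q where "p = arrs s aD (ru + (k - j))" and "q = arrs s aE j"
      have p: "arrs s aD (ru + k - j) = p" using 6(1) by (simp add: p_def)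
      have "f k j = decode p + decode q" by (simp add: f_def p_def q_def)
      from improve_step[where f = "f k" and j = j and k = k and bj = "vars s2 vbj" and
          best = "vars s2 vbest", OF this] 6
      show ?case
        unfolding improve_def
        
        by (simp add: s2 p p_def[symmetric] q_def[symmetric] split: if_splits; auto)
    next
      case (7 s2 t2)
      note fr2 = frameD[OF 7(2)]
      have s2: "vars s2 vk = k" "vars s2 vrv = rv" "arrs s2 aF = arrs s1 aF" "arrs s2 aC = arrs s1 aC"
        using s1 by (simp_all add: fr2 improve_def)
      let ?b = "vars s2 vbest" and ?bj = "vars s2 vbj"
      have b: "?bj \<le> k" "?b = 0 \<or> decode ?b = f k ?bj" "\<And>j. j \<le> k \<Longrightarrow> decode ?b \<le> f k j"
        using 7(4) by (auto simp: less_Suc_eq_le)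
      \<comment> \<open>If \<open>?b = 0\<close>, every candidate is infinite, and then any index
        attains the minimum, in particular the default \<open>?bj\<close>.\<close>
      have eq: "decode ?b = f k ?bj"
        using b(2) b(3)[OF b(1)] by auto
      have "Suc k * 10 \<le> Suc n * 10" using 6(1) by simp
      then have time: "t2 \<le> t1 + 5 + Suc n * 10" using 7(1) by simp
      show ?case
        using 6(4) time b(1,3) eq by (auto simp: s2 less_Suc_eq)
    qed (use s1 in \<open>simp_all add: improve_def\<close>)
  next
    case (7 s1 t1)
    note fr = frameD[OF 7(2)]
    show ?case
      by (rule post)
        (use 7 fr in \<open>auto simp: frame_def improve_def less_Suc_eq_le f_def\<close>)
  qed (use assms in \<open>simp_all add: improve_def\<close>)
qed

definition write_back :: com where
  "write_back = For vk vN (Update aD (Plus (V vru) (V vk)) (Arr aF (V vk)))"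

lemma write_back_simps [simp]:
  "changed_vars write_back = {vk}" "changed_arrs write_back = {aD}"
  "silent write_back" "com_fits write_back"
  by (auto simp: write_back_def)

lemma wp_write_back:
  assumes "vars s vN = Suc n" "vars s vru = ru"
    and post: "\<And>s' t'. t' \<le> t + 2 + Suc n * 3 \<Longrightarrow> frame write_back s s' \<Longrightarrow>
      (\<And>k. k \<le> n \<Longrightarrow> arrs s' aD (ru + k) = arrs s aF k) \<Longrightarrow>
      (\<And>i. i < ru \<or> ru + Suc n \<le> i \<Longrightarrow> arrs s' aD i = arrs s aD i) \<Longrightarrow> Q s' t'"
  shows "wp write_back Q s t"
  unfolding write_back_def
proof (rule wp_For[where n = "Suc n" and B = 1 and I = "\<lambda>k s'.
    (\<forall>k'<k. arrs s' aD (ru + k') = arrs s aF k') \<and>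
    (\<forall>i. i < ru \<or> ru + k \<le> i \<longrightarrow> arrs s' aD i = arrs s aD i)"], goal_cases)
  case (6 k s1 t1)
  note fr = frameD[OF 6(2)]
  show ?case using 6 assms by (auto simp: fr less_Suc_eq)
next
  case (7 s1 t1)
  note fr = frameD[OF 7(2)]
  show ?case by (rule post) (use 7 fr in \<open>auto simp: frame_def less_Suc_eq_le\<close>)
qed (use assms in simp_all)

text \<open>After the elimination \<open>aS\<close> points to the input block of the edge to the
  parent, in which the offsets 2 and 3 hold capacity and cost.\<close>

definition merge_step :: com where
  "merge_step = Assign vv (Arr aQ (V vh)) ;; Assign vu (Arr aP (V vv)) ;; Assign vp (Arr aS (V vv)) ;;
     Assign vc (Arr aX (Plus (V vp) (N 2))) ;; Assign vw (Arr aX (Plus (V vp) (N 3))) ;;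
     Assign vrv (Arr aRow (V vv)) ;; Assign vru (Arr aRow (V vu)) ;;
     edge_table ;; convolve ;; write_back"

definition merge :: com where
  "merge = For vh vH merge_step ;; Assign vbest (Arr aD (V vn))"

lemma merge_step_simps [simp]:
  "changed_vars merge_step = {vv, vu, vp, vc, vw, vrv, vru, vjw, vj, vd, va, vb, vi, vx, vk, vbest,
     vbj, vk1, vy, vz}"
  "changed_arrs merge_step = {aE, aF, aC, aD}" "silent merge_step" "com_fits merge_step"
  by (auto simp: merge_step_def)

lemma merge_simps [simp]:
  "changed_vars merge = insert vh (changed_vars merge_step)"
  "changed_arrs merge = changed_arrs merge_step" "silent merge" "com_fits merge"
  by (auto simp: merge_def)

section \<open>Traceback of the loads and output of the paths\<close>

definition trace :: com where
  "trace = Update aK (N 0) (V vn) ;; For vh vH (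
     Assign vv (Arr aQ (Minus (V vH) (Plus (V vh) (N 1)))) ;; Assign vu (Arr aP (V vv)) ;;
     Assign vk (Arr aK (V vu)) ;; Assign vj (Arr aC (Plus (Arr aRow (V vv)) (V vk))) ;;
     Update aK (V vv) (V vj) ;; Update aK (V vu) (Minus (V vk) (V vj)))"

lemma trace_simps [simp]:
  "changed_vars trace = {vh, vv, vu, vk, vj}" "changed_arrs trace = {aK}" "silent trace" "com_fits trace"
  by (auto simp: trace_def)

text \<open>Where \<open>sweep\<close> prepends to its backward half, the program appends to
  \<open>aPB\<close>; \<open>emit\<close> therefore reads this array from the end.\<close>

definition sweep_pair :: com where
  "sweep_pair = Assign vx (Arr aM (V vj)) ;; Assign vy (Arr aM (V vk)) ;;
     Assign vlf (N 0) ;; Assign vlb (N 0) ;; For vh vH (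
       Assign vv (Arr aQ (V vh)) ;;
       If (neq (V vx) (V vy))
         (If (neq (V vx) (V vv))
           (If (neq (V vy) (V vv)) Skip
             (Update aPB (V vlb) (V vy) ;; incr vlb (N 1) ;; Assign vy (Arr aP (V vy))))
           (Update aPF (V vlf) (V vx) ;; incr vlf (N 1) ;; Assign vx (Arr aP (V vx))))
         Skip)"

lemma sweep_pair_simps [simp]:
  "changed_vars sweep_pair = {vx, vy, vlf, vlb, vh, vv}" "changed_arrs sweep_pair = {aPF, aPB}"
  "silent sweep_pair" "com_fits sweep_pair"
  by (auto simp: sweep_pair_def)

definition emit :: com where
  "emit = Output (V vj) ;; Output (V vk) ;; Output (Plus (V vlf) (Plus (V vlb) (N 1))) ;;
     For vi vlf (Output (Arr aPF (V vi))) ;; Output (V vx) ;;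
     For vi vlb (Output (Arr aPB (Minus (V vlb) (Plus (V vi) (N 1)))))"

lemma emit_simps [simp]:
  "changed_vars emit = {vi}" "changed_arrs emit = {}" "com_fits emit"
  by (auto simp: emit_def)

text \<open>Every pair scans the whole elimination order, even after the two halves have met: time
  of order \<open>m\<close> for fewer than \<open>n * n\<close> pairs.\<close>

definition pairs :: com where
  "pairs = For vj vn (For vk vj (sweep_pair ;; emit))"

lemma pairs_simps [simp]: "com_fits pairs"
  by (simp add: pairs_def)

context elimination_dp
begin

lemma D_Suc_eqI:
  assumes "j \<le> k" "c = D h (par (Q h)) (k - j) + (D h (Q h) j + g (Q h) j)"
    and "\<And>j. j \<le> k \<Longrightarrow> c \<le> D h (par (Q h)) (k - j) + (D h (Q h) j + g (Q h) j)"
  shows "D (Suc h) (par (Q h)) k = c"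
  using assms by (auto intro!: Min_eqI)

text \<open>Only the row of the parent in \<open>aD\<close> and the row of the child in
  \<open>aC\<close> are rewritten. Distinct rows are disjoint, so all other entries carry over from
  \<open>D h\<close> to \<open>D (Suc h)\<close>.\<close>

lemma wp_merge_step:
  assumes h: "h < H" and vars: "vars s vn = n" "vars s vN = Suc n" "vars s vh = h"
    and arrs: "arrs s aQ = Q" "arrs s aP = par" "arrs s aS = S" "arrs s aX = x"
      "\<And>u. u < m \<Longrightarrow> arrs s aRow u = u * Suc n"
    and tab: "\<And>u k. u < m \<Longrightarrow> k \<le> n \<Longrightarrow> decode (arrs s aD (u * Suc n + k)) = D h u k"
    and g: "\<And>k. k \<le> n \<Longrightarrow> g (Q h) k = edge_cost_fun n (x (S (Q h) + 2)) (x (S (Q h) + 3)) k"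
    and post: "\<And>s' t'. t' \<le> t + 60 * (Suc n * Suc n) \<Longrightarrow> frame merge_step s s' \<Longrightarrow>
      (\<And>u k. u < m \<Longrightarrow> k \<le> n \<Longrightarrow> decode (arrs s' aD (u * Suc n + k)) = D (Suc h) u k) \<Longrightarrow>
      (\<And>k. k \<le> n \<Longrightarrow> let j = arrs s' aC (Q h * Suc n + k) in j \<le> k \<and>
        D (Suc h) (par (Q h)) k = D h (par (Q h)) (k - j) + (D h (Q h) j + g (Q h) j)) \<Longrightarrow>
      (\<And>u k. u < m \<Longrightarrow> u \<noteq> Q h \<Longrightarrow> k \<le> n \<Longrightarrow>
        arrs s' aC (u * Suc n + k) = arrs s aC (u * Suc n + k)) \<Longrightarrow> Q' s' t'"
  shows "wp merge_step Q' s t"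
proof -
  let ?v = "Q h" and ?p = "par (Q h)"
  let ?post = "\<lambda>s' t'. t' \<le> t + 60 * (Suc n * Suc n) \<and>
      (\<forall>u k. u < m \<longrightarrow> k \<le> n \<longrightarrow> decode (arrs s' aD (u * Suc n + k)) = D (Suc h) u k) \<and>
      (\<forall>k. k \<le> n \<longrightarrow> (let j = arrs s' aC (?v * Suc n + k) in j \<le> k \<and>
        D (Suc h) ?p k = D h ?p (k - j) + (D h ?v j + g ?v j))) \<and>
      (\<forall>u k. u < m \<longrightarrow> u \<noteq> ?v \<longrightarrow> k \<le> n \<longrightarrow>
        arrs s' aC (u * Suc n + k) = arrs s aC (u * Suc n + k))"
  have vm: "?v < m" "?p < m" using leaf_seqD(1,4)[OF leaves h] by auto
  define c where "c = x (S ?v + 2)"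
  define w where "w = x (S ?v + 3)"
  define s0 where "s0 = set_var vru (?p * Suc n) (set_var vrv (?v * Suc n) (set_var vw w
    (set_var vc c (set_var vp (S ?v) (set_var vu ?p (set_var vv ?v s))))))"
  have s0: "vars s0 vn = n" "vars s0 vN = Suc n" "vars s0 vc = c" "vars s0 vw = w"
    "vars s0 vrv = ?v * Suc n" "vars s0 vru = ?p * Suc n" "arrs s0 = arrs s"
    using vars by (simp_all add: s0_def)
  have "wp (edge_table ;; convolve ;; write_back) ?post s0 (t + 7)"
    unfolding wp_simps
  proof (rule wp_edge_table[OF s0(1-5)], goal_cases)
    case (1 s1 t1)
    note fr1 = frameD[OF 1(2)]
    have E: "decode (arrs s1 aE j) = D h ?v j + g ?v j" if "j \<le> n" for j
      using 1(3)[OF that] tab[OF vm(1) that] g[OF that] by (simp add: s0(7) c_def w_def)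
    have s1: "vars s1 vN = Suc n" "vars s1 vrv = ?v * Suc n" "vars s1 vru = ?p * Suc n"
      "arrs s1 aD = arrs s aD" "arrs s1 aC = arrs s aC"
      by (simp_all add: fr1 s0)
    show ?case
    proof (rule wp_convolve[OF s1(1-3)], goal_cases)
      case (1 s2 t2)
      note fr2 = frameD[OF 1(2)]
      have f: "decode (arrs s1 aD (?p * Suc n + (k - j))) + decode (arrs s1 aE j) =
          D h ?p (k - j) + (D h ?v j + g ?v j)" if "j \<le> k" "k \<le> n" for j k
        using tab[OF vm(2), of "k - j"] E[of j] that unfolding s1 by simp
      let ?j = "\<lambda>k. arrs s2 aC (?v * Suc n + k)"
      have j: "?j k \<le> k" "decode (arrs s2 aF k) = D h ?p (k - ?j k) + (D h ?v (?j k) + g ?v (?j k))"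
        if "k \<le> n" for k
        using 1(4)[OF that] f[of "?j k" k] that by auto
      have F: "D (Suc h) ?p k = decode (arrs s2 aF k)" if "k \<le> n" for k
        by (rule D_Suc_eqI[OF j[OF that]]) (use 1(3)[OF that] f that in auto)
      have C: "arrs s2 aC (u * Suc n + k) = arrs s aC (u * Suc n + k)" if "u \<noteq> ?v" "k \<le> n" for u k
        using 1(5)[OF row_disjoint[OF that]] by (simp add: s1)
      have s2: "vars s2 vN = Suc n" "vars s2 vru = ?p * Suc n" "arrs s2 aD = arrs s aD"
        by (simp_all add: fr2 s1)
      show ?case
      proof (rule wp_write_back[OF s2(1,2)], goal_cases)
        case (1 s3 t3)
        note fr3 = frameD[OF 1(2)]
        have time: "t3 \<le> t + 60 * (Suc n * Suc n)"
          using 1(1) \<open>t2 \<le> _\<close> \<open>t1 \<le> _\<close> by (simp add: algebra_simps)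
        have Dtab: "decode (arrs s3 aD (u * Suc n + k)) = D (Suc h) u k" if "u < m" "k \<le> n" for u k
        proof (cases "u = ?p")
          case True
          then show ?thesis using 1(3)[OF that(2)] F[OF that(2)] by simp
        next
          case False
          have "arrs s3 aD (u * Suc n + k) = arrs s aD (u * Suc n + k)"
            using 1(4)[OF row_disjoint[OF False that(2)]] by (simp only: s2)
          then show ?thesis using tab[OF that] D_Suc_other[OF False] by (simp only:)
        qed
        have C3: "arrs s3 aC = arrs s2 aC" by (simp add: fr3)
        show ?case
          unfolding Let_def C3 using time Dtab C j F by (simp del: D.simps mult_Suc_right)
      qed
    qed
  qed
  then have "wp merge_step ?post s t"
    unfolding merge_step_def wp_simps s0_def c_def w_def
    using vars arrs vm by (simp add: numeral_3_eq_3 numeral_2_eq_2 eval_nat_numeral del: D.simps mult_Suc_right)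
  then show ?thesis
    by (rule wp_mono[OF wp_frame]) (use post in blast)
qed

lemma wp_merge:
  assumes vars: "vars s vn = n" "vars s vN = Suc n" "vars s vH = H"
    and arrs: "arrs s aQ = Q" "arrs s aP = par" "arrs s aS = S" "arrs s aX = x"
      "\<And>u. u < m \<Longrightarrow> arrs s aRow u = u * Suc n"
    and tab: "\<And>u k. u < m \<Longrightarrow> k \<le> n \<Longrightarrow> decode (arrs s aD (u * Suc n + k)) = nd u k"
    and g: "\<And>h k. h < H \<Longrightarrow> k \<le> n \<Longrightarrow>
      g (Q h) k = edge_cost_fun n (x (S (Q h) + 2)) (x (S (Q h) + 3)) k"
    and post: "\<And>s' t'. t' \<le> t + 3 + H * (60 * (Suc n * Suc n) + 2) \<Longrightarrow> frame merge s s' \<Longrightarrow>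
      optimal_choice (\<lambda>v k. arrs s' aC (v * Suc n + k)) \<Longrightarrow> decode (vars s' vbest) = D H 0 n \<Longrightarrow> Q' s' t'"
  shows "wp merge Q' s t"
proof -
  have "wp merge (\<lambda>s' t'. t' \<le> t + 3 + H * (60 * (Suc n * Suc n) + 2) \<and>
      optimal_choice (\<lambda>v k. arrs s' aC (v * Suc n + k)) \<and> decode (vars s' vbest) = D H 0 n) s t"
    unfolding merge_def wp_simps
  proof (rule wp_For[where n = H and B = "60 * (Suc n * Suc n)" and I = "\<lambda>h s'.
      (\<forall>u<m. \<forall>k\<le>n. decode (arrs s' aD (u * Suc n + k)) = D h u k) \<and>
      (\<forall>h'<h. \<forall>k\<le>n. let j = arrs s' aC (Q h' * Suc n + k) in j \<le> k \<and>
        D (Suc h') (par (Q h')) k = D h' (par (Q h')) (k - j) + (D h' (Q h') j + g (Q h') j))"],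
      goal_cases)
    case (6 h s1 t1)
    note fr = frameD[OF 6(2)]
    show ?case
    proof (rule wp_merge_step[where h = h and x = x and S = S], goal_cases)
      case (12 s2 t2)
      \<comment> \<open>A vertex is a child only once, so the splits recorded at earlier merges are
        not overwritten.\<close>
      have Qh: "Q h' < m \<and> Q h' \<noteq> Q h" if "h' < h" for h'
        using leaf_seqD(1)[OF leaves, of h'] leaf_seqD(3)[OF leaves 6(1)] 6(1) that
        by (metis imageI lessThan_iff order.strict_trans)
      have "arrs s2 aC (Q h' * Suc n + k) = arrs s1 aC (Q h' * Suc n + k)" if "h' < h" "k \<le> n" for h' k
        using 12(5) Qh that by blast
      then show ?case
        using 12(1,3,4) 6(4) by (simp add: less_Suc_eq Let_def del: D.simps mult_Suc_right)
    qed (use 6 vars arrs g fr in \<open>simp_all add: fr del: D.simps mult_Suc_right\<close>)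
  next
    case (7 s1 t1)
    note fr = frameD[OF 7(2)]
    \<comment> \<open>The row of the root 0 starts at address 0, so its entry for all
      \<open>n\<close> nodes is found at address \<open>n\<close>.\<close>
    have "decode (arrs s1 aD (0 * Suc n + n)) = D H 0 n"
      using 7(4) m by (metis order_refl zero_less_Suc)
    moreover have "vars s1 vn = n" using vars fr by simp
    ultimately show ?case
      using 7(1,4) by (simp add: optimal_choice_def Let_def del: D.simps mult_Suc_right)
  qed (use vars tab in simp_all)
  then show ?thesis
    by (rule wp_mono[OF wp_frame]) (use post in blast)
qed

lemma wp_trace:
  assumes vars: "vars s vn = n" "vars s vH = H"
    and arrs: "arrs s aQ = Q" "arrs s aP = par" "arrs s aK = (\<lambda>_. 0)"
      "\<And>u. u < m \<Longrightarrow> arrs s aRow u = u * Suc n"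
      "ch = (\<lambda>v k. arrs s aC (v * Suc n + k))"
    and post: "\<And>s' t'. t' \<le> t + 3 + H * 8 \<Longrightarrow> frame trace s s' \<Longrightarrow>
      arrs s' aK = alloc ch H \<Longrightarrow> Q' s' t'"
  shows "wp trace Q' s t"
  unfolding trace_def wp_simps
proof (rule wp_For[where n = H and B = 6 and I = "\<lambda>h s'. arrs s' aK = alloc ch h"], goal_cases)
  case (6 h s1 t1)
  note fr = frameD[OF 6(2)]
  have "Q (H - Suc h) < m" using leaf_seqD(1)[OF leaves, of "H - Suc h"] 6(1) by simp
  then show ?case
    using 6 vars arrs by (simp add: fr Let_def del: mult_Suc_right)
next
  case (7 s1 t1)
  note fr = frameD[OF 7(2)]
  show ?case by (rule post) (use 7 fr in \<open>simp_all add: frame_def\<close>)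
qed (use vars arrs in simp_all)

lemma wp_sweep_pair:
  assumes vars: "vars s vH = H" and arrs: "arrs s aQ = Q" "arrs s aP = par"
    and post: "\<And>s' t'. t' \<le> t + 6 + H * 9 \<Longrightarrow> frame sweep_pair s s' \<Longrightarrow>
      vars s' vlf + vars s' vlb \<le> H \<Longrightarrow>
      sweep H (arrs s aM (vars s vj)) (arrs s aM (vars s vk)) = (vars s' vx, vars s' vy,
        map (arrs s' aPF) [0..<vars s' vlf], rev (map (arrs s' aPB) [0..<vars s' vlb])) \<Longrightarrow> Q' s' t'"
  shows "wp sweep_pair Q' s t"
  unfolding sweep_pair_def wp_simps
proof (rule wp_For[where n = H and B = 7 and I = "\<lambda>h s'. vars s' vlf + vars s' vlb \<le> h \<and>
    sweep h (arrs s aM (vars s vj)) (arrs s aM (vars s vk)) = (vars s' vx, vars s' vy,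
        map (arrs s' aPF) [0..<vars s' vlf], rev (map (arrs s' aPB) [0..<vars s' vlb]))"], goal_cases)
  case (6 h s1 t1)
  note fr = frameD[OF 6(2)]
  have upd: "map (\<lambda>a. if a = l then b else f a) [0..<l] = map f [0..<l]"
    "map (f(l := b)) [0..<l] = map f [0..<l]" for l b and f :: "nat \<Rightarrow> nat"
    by simp_all
  show ?case
    using 6 arrs by (auto simp: fr upd)
next
  case (7 s1 t1)
  note fr = frameD[OF 7(2)]
  show ?case by (rule post) (use 7 fr in \<open>simp_all add: frame_def\<close>)
qed (use vars in simp_all)

end

section \<open>Output of a placement with prescribed loads and of the routes\<close>

definition place :: com where
  "place = Assign va (N 0) ;; For vu vm (
     Assign vk (Arr aK (V vu)) ;;
     For vi vk (Update aM (V va) (V vu) ;; Output (V vu) ;; incr va (N 1)))"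

lemma place_simps [simp]:
  "changed_vars place = {va, vu, vk, vi}" "changed_arrs place = {aM}" "com_fits place"
  "silent place \<longleftrightarrow> False"
  by (auto simp: place_def)

lemma card_fibre_Suc:
  "card {a \<in> {..<Suc l}. (f(l := j)) a = u} =
    card {a \<in> {..<l}. f a = (u::nat)} + (if u = j then 1 else 0)"
proof -
  have "{a \<in> {..<Suc l}. (f(l := j)) a = u} =
      (if u = j then insert l {a \<in> {..<l}. f a = u} else {a \<in> {..<l}. f a = u})"
    by (auto simp: less_Suc_eq)
  then show ?thesis by simp
qed

text \<open>Virtual nodes are assigned in consecutive blocks. Each substrate node is charged for
  \<open>n\<close> placements although there are \<open>n\<close> in total; the resulting order
  \<open>n * m\<close> is within the budget.\<close>

lemma wp_place:
  assumes vars: "vars s vm = m" and K: "arrs s aK = K" "sum K {..<m} = n"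
    and post: "\<And>s' t'. t' \<le> t + 3 + m * (n * 5 + 5) \<Longrightarrow> frame place s s' \<Longrightarrow>
      (\<And>a. a < n \<Longrightarrow> arrs s' aM a < m) \<Longrightarrow>
      (\<And>u. u < m \<Longrightarrow> card {a \<in> {..<n}. arrs s' aM a = u} = K u) \<Longrightarrow>
      outputs s' = outputs s @ map (arrs s' aM) [0..<n] \<Longrightarrow> Q s' t'"
  shows "wp place Q s t"
  unfolding place_def wp_simps
proof (rule wp_For[where n = m and B = "n * 5 + 3" and I = "\<lambda>j s'. vars s' va = sum K {..<j} \<and>
    (\<forall>a<vars s' va. arrs s' aM a < j) \<and>
    (\<forall>u. card {a \<in> {..<vars s' va}. arrs s' aM a = u} = (if u < j then K u else 0)) \<and>
    outputs s' = outputs s @ map (arrs s' aM) [0..<vars s' va]"], goal_cases)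
  case (6 j s1 t1)
  note fr = frameD[OF 6(2)]
  have s1: "vars s1 vu = j" "arrs s1 aK = K" using 6 K fr by simp_all
  have Kn: "K j \<le> n" using member_le_sum[of j "{..<m}" K] 6(1) K(2) by simp
  have inv: "vars s1 va = sum K {..<j}" "\<And>a. a < vars s1 va \<Longrightarrow> arrs s1 aM a < j"
    "\<And>u. card {a \<in> {..<vars s1 va}. arrs s1 aM a = u} = (if u < j then K u else 0)"
    "outputs s1 = outputs s @ map (arrs s1 aM) [0..<vars s1 va]"
    using 6(4) by auto
  show ?case
    unfolding wp_simps
  proof (rule wp_For[where n = "K j" and B = 3 and I = "\<lambda>i s'. vars s' va = sum K {..<j} + i \<and>
      (\<forall>a<vars s' va. arrs s' aM a < Suc j) \<and>
      (\<forall>u. card {a \<in> {..<vars s' va}. arrs s' aM a = u} =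
        (if u < j then K u else if u = j then i else 0)) \<and>
      outputs s' = outputs s @ map (arrs s' aM) [0..<vars s' va]"], goal_cases)
    case 5
    have "arrs s1 aM a < Suc j" if "a < vars s1 va" for a using inv(2)[OF that] by simp
    then show ?case using inv by simp
  next
    case (6 i s2 t2)
    note fr2 = frameD[OF 6(2)]
    have u: "vars s2 vu = j" using s1 by (simp add: fr2)
    define l f where "l = vars s2 va" and "f = arrs s2 aM"
    have I: "l = sum K {..<j} + i" "\<And>a. a < l \<Longrightarrow> f a < Suc j"
      "\<And>u. card {a \<in> {..<l}. f a = u} = (if u < j then K u else if u = j then i else 0)"
      "outputs s2 = outputs s @ map f [0..<l]"
      using 6(4)[folded l_def f_def] by blast+
    have card: "card {a \<in> {..<Suc l}. (f(l := j)) a = u} =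
        (if u < j then K u else if u = j then Suc i else 0)" for u
      unfolding card_fibre_Suc I(3) by simp
    have less: "(f(l := j)) a < Suc j" if "a < Suc l" for a
      using I(2)[of a] that by (auto simp: less_Suc_eq)
    have out: "outputs s2 @ [j] = outputs s @ map (f(l := j)) [0..<Suc l]"
      using I(4) by simp
    have Sl: "Suc l = sum K {..<j} + Suc i" using I(1) by simp
    show ?case
      unfolding wp_simps set_var_sel set_arr_sel eval.simps u l_def[symmetric] f_def[symmetric]
      using card less out I(1) by (simp add: u l_def[symmetric] f_def[symmetric] fun_upd_same fun_upd_other
        del: fun_upd_apply upt_Suc)
  next
    case (7 s2 t2)
    have "t2 \<le> t1 + (n * 5 + 3)"
    proof -
      have "K j * (3 + 2) \<le> n * 5" using Kn by simp
      then show ?thesis using 7(1) by simp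
    qed
    then show ?case
      using 7(4) by (auto simp: less_Suc_eq)
  qed (use s1 in simp_all)
next
  case (7 s1 t1)
  note fr = frameD[OF 7(2)]
  have va: "vars s1 va = n" using 7(4) K(2) by simp
  have inv: "\<And>a. a < n \<Longrightarrow> arrs s1 aM a < m"
    "\<And>u. u < m \<Longrightarrow> card {a \<in> {..<n}. arrs s1 aM a = u} = K u"
    "outputs s1 = outputs s @ map (arrs s1 aM) [0..<n]"
    using 7(4)[unfolded va] by (blast, metis, blast)
  have "n * 5 + 3 + 2 = n * 5 + 5" by simp
  then have "t1 \<le> t + 3 + m * (n * 5 + 5)" using 7(1) by (simp only:)
  then show ?case by (rule post[OF _ _ inv]) (use fr in \<open>simp_all add: frame_def\<close>)
qed (use vars in simp_all)

lemma wp_emit: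
  assumes post: "\<And>s' t'. t' \<le> t + 8 + 3 * (vars s vlf + vars s vlb) \<Longrightarrow> frame emit s s' \<Longrightarrow>
      outputs s' = outputs s @ [vars s vj, vars s vk, vars s vlf + vars s vlb + 1] @
        map (arrs s aPF) [0..<vars s vlf] @ vars s vx # rev (map (arrs s aPB) [0..<vars s vlb]) \<Longrightarrow>
      Q s' t'"
  shows "wp emit Q s t"
proof -
  let ?lf = "vars s vlf" and ?lb = "vars s vlb"
  define o1 where "o1 = outputs s @ [vars s vj, vars s vk, ?lf + ?lb + 1]"
  define o2 where "o2 = o1 @ map (arrs s aPF) [0..<?lf] @ [vars s vx]"
  have rev: "rev (map f [0..<l]) = map (\<lambda>i. f (l - Suc i)) [0..<l]" for f :: "nat \<Rightarrow> nat" and l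
    by (rule nth_equalityI) (auto simp: rev_nth)
  have "wp emit (\<lambda>s' t'. t' \<le> t + 8 + 3 * (?lf + ?lb) \<and>
      outputs s' = o2 @ map (\<lambda>i. arrs s aPB (?lb - Suc i)) [0..<?lb]) s t"
    unfolding emit_def wp_simps
  proof (rule wp_For[where n = ?lf and B = 1 and I = "\<lambda>i s'. outputs s' = o1 @ map (arrs s aPF) [0..<i]"],
      goal_cases)
    case (6 i s1 t1)
    then show ?case using frameD[OF 6(2)] by simp
  next
    case (7 s1 t1)
    note fr = frameD[OF 7(2)]
    show ?case
    proof (rule wp_For[where n = ?lb and B = 1 and I = "\<lambda>i s'. outputs s' =
        o2 @ map (\<lambda>i. arrs s aPB (?lb - Suc i)) [0..<i]"], goal_cases)
      case (6 i s2 t2)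
      then show ?case using frameD[OF 6(2)] fr by simp
    next
      case (7 s2 t2)
      then show ?case using \<open>t1 \<le> _\<close> by simp
    qed (use 7 fr in \<open>simp_all add: o2_def\<close>)
  qed (simp_all add: o1_def)
  then show ?thesis
    by (rule wp_mono[OF wp_frame]) (use post in \<open>auto simp: rev o1_def o2_def\<close>)
qed

definition ordered_pairs :: "nat \<Rightarrow> (nat \<times> nat) list" where
  "ordered_pairs n = concat (map (\<lambda>a. map (\<lambda>b. (a, b)) [0..<a]) [0..<n])"

lemma ordered_pairs_Suc: "ordered_pairs (Suc n) = ordered_pairs n @ map (\<lambda>b. (n, b)) [0..<n]"
  by (simp add: ordered_pairs_def)

lemma ordered_pairs_set: "set (ordered_pairs n) = {(a, b). b < a \<and> a < n}"
  unfolding ordered_pairs_def by auto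

lemma distinct_ordered_pairs: "distinct (ordered_pairs n)"
proof (induction n)
  case 0
  show ?case by (simp add: ordered_pairs_def)
next
  case (Suc n)
  have "distinct (map (\<lambda>b. (n, b)) [0..<n])" by (simp add: distinct_map inj_on_def)
  moreover have "set (ordered_pairs n) \<inter> set (map (\<lambda>b. (n, b)) [0..<n]) = {}"
    unfolding ordered_pairs_set by auto
  ultimately show ?case using Suc by (simp add: ordered_pairs_Suc)
qed

lemma lists_edges_ordered_pairs:
  assumes "is_clique {..<n} F"
  shows "lists_edges (ordered_pairs n) F"
proof -
  have "inj_on edge_pair (set (ordered_pairs n))"
    by (auto simp: inj_on_def ordered_pairs_set edge_pair_def doubleton_eq_iff)
  then have "distinct (map edge_pair (ordered_pairs n))"
    using distinct_ordered_pairs by (simp add: distinct_map)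
  moreover have "edge_pair ` set (ordered_pairs n) = F"
  proof (intro equalityI subsetI)
    fix e assume "e \<in> edge_pair ` set (ordered_pairs n)"
    then obtain a b where "e = {a, b}" "b < a" "a < n" by (auto simp: ordered_pairs_set edge_pair_def)
    then show "e \<in> F" using assms unfolding is_clique_def by auto
  next
    fix e assume e: "e \<in> F"
    then have "card e = 2" "e \<subseteq> {..<n}" using assms by (auto simp: is_clique_def simple_graph_def)
    then obtain a b where ab: "e = {a, b}" "b < a" "a < n"
      by (metis card_2_iff insert_commute insert_subset lessThan_iff linorder_neqE_nat)
    then have "(a, b) \<in> set (ordered_pairs n)" by (simp add: ordered_pairs_set)
    then show "e \<in> edge_pair ` set (ordered_pairs n)" using ab(1) by (force simp: edge_pair_def)
  qed
  ultimately show ?thesis by (simp add: lists_edges_def)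
qed

context elimination_dp
begin

definition block :: "(nat \<Rightarrow> nat) \<Rightarrow> nat \<times> nat \<Rightarrow> nat list" where
  "block f = (\<lambda>(a, b). let p = path_between (f a) (f b) in [a, b, length p] @ p)"

lemma wp_pairs:
  assumes vars: "vars s vH = H" "vars s vn = k" and arrs: "arrs s aQ = Q" "arrs s aP = par" "arrs s aM = f"
    and post: "\<And>s' t'. t' \<le> t + 2 + k * (4 + k * (16 + 12 * H)) \<Longrightarrow>
      outputs s' = outputs s @ concat (map (block f) (ordered_pairs k)) \<Longrightarrow> Q' s' t'"
  shows "wp pairs Q' s t"
  unfolding pairs_def
proof (rule wp_For[where n = k and B = "2 + k * (16 + 12 * H)" and I = "\<lambda>a s'. outputs s' =
    outputs s @ concat (map (block f) (ordered_pairs a))"], goal_cases)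
  case (6 a s1 t1)
  note fr = frameD[OF 6(2)]
  show ?case
  proof (rule wp_For[where n = a and B = "14 + 12 * H" and I = "\<lambda>b s'. outputs s' =
      outputs s @ concat (map (block f) (ordered_pairs a)) @
      concat (map (block f) (map (\<lambda>b. (a, b)) [0..<b]))"], goal_cases)
    case (6 b s2 t2)
    note fr2 = frameD[OF 6(2)]
    have s2: "vars s2 vH = H" "arrs s2 aQ = Q" "arrs s2 aP = par" "arrs s2 aM = f" "vars s2 vj = a"
      "vars s2 vk = b"
      using vars arrs 6 \<open>vars s1 vj = a\<close> by (simp_all add: fr fr2)
    show ?case
      unfolding wp_simps
    proof (rule wp_sweep_pair[OF s2(1-3)], goal_cases)
      case (1 s3 t3)
      note fr3 = frameD[OF 1(2)]
      have p: "path_between (f a) (f b) = map (arrs s3 aPF) [0..<vars s3 vlf] @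
          vars s3 vx # rev (map (arrs s3 aPB) [0..<vars s3 vlb])"
        using 1(4) unfolding path_between_def s2 by (simp del: upt_Suc)
      have s3: "vars s3 vj = a" "vars s3 vk = b" "outputs s3 = outputs s2"
        using s2 by (simp_all add: fr3)
      show ?case
      proof (rule wp_emit, goal_cases)
        case (1 s4 t4)
        have "outputs s4 = outputs s2 @ block f (a, b)"
          using 1(3) unfolding block_def s3 by (simp add: p del: upt_Suc)
        then show ?case
          using 1(1) \<open>t3 \<le> _\<close> \<open>vars s3 vlf + _ \<le> H\<close> 6(4) by simp
      qed
    qed
  next
    case (7 s2 t2)
    have "t2 \<le> t1 + 2 + a * (16 + 12 * H)" using 7(1) by simp
    also have "\<dots> \<le> t1 + 2 + k * (16 + 12 * H)"
      using 6(1) by (intro add_left_mono mult_le_mono1) simp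
    finally show ?case using 7(4) by (simp add: ordered_pairs_Suc)
  qed (use 6 in simp_all)
next
  case (7 s1 t1)
  have "2 + k * (16 + 12 * H) + 2 = 4 + k * (16 + 12 * H)" by simp
  then have "t1 \<le> t + 2 + k * (4 + k * (16 + 12 * H))" using 7(1) by (simp only:)
  then show ?case by (rule post) (rule 7(4))
qed (use vars in \<open>simp_all add: ordered_pairs_def\<close>)

end

definition output_mapping :: com where
  "output_mapping = Output (N 1) ;; trace ;; place ;; pairs"

lemma output_mapping_simps [simp]: "com_fits output_mapping"
  by (simp add: output_mapping_def)

context clique_tree
begin

definition tables_ready :: "store \<Rightarrow> bool" where
  "tables_ready s \<longleftrightarrow> vars s vn = n \<and> vars s vm = m \<and> vars s vH = H \<and>
     arrs s aQ = Q \<and> arrs s aP = par \<and> arrs s aK = (\<lambda>_. 0) \<and>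
     (\<forall>u<m. arrs s aRow u = u * Suc n) \<and>
     optimal_choice (\<lambda>v k. arrs s aC (v * Suc n + k)) \<and> decode (vars s vbest) = D H 0 n"

lemma wp_output_mapping:
  assumes ready: "tables_ready s" and best: "vars s vbest \<noteq> 0"
    and post: "\<And>s' t' f zs. t' \<le> t + 9 + H * 8 + m * (n * 5 + 5) + n * (4 + n * (16 + 12 * H)) \<Longrightarrow>
      min_cost_feasible I f \<Longrightarrow> encodes_mapping I f zs \<Longrightarrow> outputs s' = outputs s @ 1 # zs \<Longrightarrow> Q' s' t'"
  shows "wp output_mapping Q' s t"
  unfolding output_mapping_def wp_simps
proof (rule wp_trace[where ch = "\<lambda>v k. arrs s aC (v * Suc n + k)"], goal_cases)
  case (8 s1 t1)
  let ?ch = "\<lambda>v k. arrs s aC (v * Suc n + k)"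
  have ch: "optimal_choice ?ch" and fin: "D H 0 n \<noteq> \<infinity>"
    using ready best unfolding tables_ready_def by (metis decode_eq_infinity)+
  note fr1 = frameD[OF 8(2)]
  show ?case
  proof (rule wp_place[where m = m and n = n and K = "alloc ?ch H"], goal_cases)
    case (4 s2 t2)
    note fr2 = frameD[OF 4(2)]
    let ?f = "arrs s2 aM"
    show ?case
    proof (rule wp_pairs[where k = n and f = ?f], goal_cases)
      case (6 s3 t3)
      show ?case
      proof (rule post[where f = "(?f, route ?f)" and
          zs = "map ?f [0..<n] @ concat (map (block ?f) (ordered_pairs n))"])
        show "t3 \<le> t + 9 + H * 8 + m * (n * 5 + 5) + n * (4 + n * (16 + 12 * H))"
          using 6(1) 4(1) 8(1) by simp
        show "min_cost_feasible I (?f, route ?f)"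
          using ch 4(3,4) fin by (intro min_cost_feasible_alloc(1)) (auto simp: load_def)
        have "block ?f (a, b) = [a, b, length (route ?f {a, b})] @ route ?f {a, b}"
          if "b < a" for a b
          using that by (simp add: block_def route_def Let_def)
        then have blocks: "map (block ?f) (ordered_pairs n) =
            map (\<lambda>(a, b). [a, b, length (route ?f {a, b})] @ route ?f {a, b}) (ordered_pairs n)"
          by (auto simp: ordered_pairs_set)
        show "encodes_mapping I (?f, route ?f)
            (map ?f [0..<n] @ concat (map (block ?f) (ordered_pairs n)))"
          unfolding encodes_mapping_def prod.case
          by (intro exI[of _ "ordered_pairs n"] conjI lists_edges_ordered_pairs[OF clique])
            (simp only: VR card_lessThan blocks)
        show "outputs s3 = outputs s @ 1 # map ?f [0..<n] @ concat (map (block ?f) (ordered_pairs n))"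
          using 6(2) 4(5) fr1(3) by simp
      qed
    qed (use ready in \<open>simp_all add: tables_ready_def fr1 fr2\<close>)
  qed (use ready 8 total_alloc(1)[OF ch] in \<open>simp_all add: tables_ready_def fr1\<close>)
qed (use ready in \<open>simp_all add: tables_ready_def\<close>)

end

section \<open>The complete programs for optimisation and decision\<close>

definition core :: com where
  "core = slurp ;; check ;;
     If (V vok) (find_order ;; If (V vok) (init_tables ;; merge) Skip) Skip"

lemma core_simps [simp]: "com_fits core" "silent core" "vG \<notin> changed_vars core"
  by (simp_all add: core_def)

definition solve :: com where
  "solve = core ;; If (V vbest) output_mapping (Output (N 0))"

definition decide :: com where
  "decide = Input vG ;; core ;;
     If (V vbest)
       (If (lt (Plus (V vG) (N 1)) (V vbest)) (Output (N 0)) (Output (N 1)))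
       (Output (N 0))"

lemma solve_decide_simps [simp]: "com_fits solve" "com_fits decide"
  by (simp_all add: solve_def decide_def)

text \<open>Capacities and costs are compared only on actual nodes and edges, because an encoding
  leaves their values elsewhere open.\<close>

definition describes :: "(nat \<Rightarrow> nat) \<Rightarrow> nat \<Rightarrow> nat \<Rightarrow> (nat, nat) uniVNE \<Rightarrow> bool" where
  "describes x n m I \<longleftrightarrow> VR I = {..<n} \<and> VS I = {..<m} \<and> ES I = input_edges x n m \<and>
     is_clique {..<n} (ER I) \<and>
     (\<forall>u<m. node_cap I u = x (node_ptr n u) \<and> node_cost I u = x (node_ptr n u + 1)) \<and>
     (\<forall>e<m - 1. edge_cap I (ends x (edge_ptr n m e)) = x (edge_ptr n m e + 2) \<and>
        edge_cost I (ends x (edge_ptr n m e)) = x (edge_ptr n m e + 3))"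

definition core_time :: "nat \<Rightarrow> nat \<Rightarrow> nat \<Rightarrow> nat" where
  "core_time L n m = 120 * (L + 1) + (4 + m * (Suc n * 6 + 9) + 3 + m * (60 * (Suc n * Suc n) + 2))"

text \<open>Invalid inputs are rejected before any table is built, hence in time linear in the
  length, and leave \<open>vbest\<close> at its initial value 0, which also stands for an infinite
  minimum. The main term of order \<open>n * n * m\<close> is paid for valid inputs only.\<close>

lemma wp_core:
  fixes xs :: "nat list"
  defines "x \<equiv> entry xs"
  defines "n \<equiv> x 0"
  defines "m \<equiv> x (n * n + 1)"
  defines "valid \<equiv> well_formed x (length xs) n m \<and> is_tree {..<m} (input_edges x n m)"
  assumes start: "vars s vL = 0" "vars s vbest = 0" "arrs s = (\<lambda>_ _. 0)" "inputs s = xs"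
    and inst: "valid \<Longrightarrow> describes x n m I"
    and bad: "\<And>s' t'. t' \<le> t + 120 * (length xs + 1) \<Longrightarrow> frame core s s' \<Longrightarrow> \<not> valid \<Longrightarrow>
      vars s' vbest = 0 \<Longrightarrow> Q s' t'"
    and good: "\<And>s' t' order par. t' \<le> t + core_time (length xs) n m \<Longrightarrow> frame core s s' \<Longrightarrow> valid \<Longrightarrow>
      clique_tree I m order par (m - 1) n \<Longrightarrow>
      clique_tree.tables_ready I m order par (m - 1) n s' \<Longrightarrow> Q s' t'"
  shows "wp core Q s t"
proof -
  let ?L = "length xs" and ?tree = "is_tree {..<m} (input_edges x n m)"
  define R where "R s' t' \<longleftrightarrow> \<not> valid \<and> t' \<le> t + 120 * (?L + 1) \<and> vars s' vbest = 0 \<or>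
    valid \<and> t' \<le> t + core_time ?L n m \<and> (\<exists>order par. clique_tree I m order par (m - 1) n \<and>
      clique_tree.tables_ready I m order par (m - 1) n s')" for s' t'
  have entry_Nil: "entry [] = (\<lambda>_. 0)" by (simp add: entry_def fun_eq_iff)
  have "wp core R s t"
    unfolding core_def wp_simps
  proof (rule wp_slurp[where us = "[]" and ys = xs], goal_cases)
    case (4 s1 t1)
    note fr1 = frameD[OF 4(2)]
    have s1: "vars s1 vL = ?L" "arrs s1 aX = x" using 4(3,4) by (simp_all add: x_def)
    have z1: "vars s1 vbest = 0" "\<And>a. a \<noteq> aX \<Longrightarrow> arrs s1 a = (\<lambda>_. 0)"
      using start by (simp_all add: fr1)
    show ?case
    proof (rule wp_check[where x = x and L = ?L, folded n_def, folded m_def], goal_cases)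
      case (3 s2 t2)
      note fr2 = frameD[OF 3(2)]
      have z2: "vars s2 vbest = 0" "\<And>a. a \<noteq> aX \<Longrightarrow> arrs s2 a = (\<lambda>_. 0)"
        using z1 by (simp_all add: fr2)
      have t2: "t2 \<le> t + 1 + 4 * ?L + 50 * (?L + 1)" using 3(1) 4(1) by simp
      show ?case
      proof (cases "well_formed x ?L n m")
        case False
        then have "\<not> valid" by (simp add: valid_def)
        then show ?thesis using False 3(3) z2(1) t2 by (simp add: R_def)
      next
        case wf: True
        then have ok2: "vars s2 vok = 1" and ld2: "loaded x n m s2" using 3(3,4) by auto
        have mL: "m \<le> ?L + 1" using well_formed_size(4)[OF wf] by linarith
        have "wp find_order (wp (If (V vok) (init_tables ;; merge) Skip) R) s2 (Suc t2)"
        proof (rule wp_find_order[OF wf ld2 ok2], goal_cases)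
          case (3 s3 t3)
          note fr3 = frameD[OF 3(2)]
          have z3: "vars s3 vbest = 0" "\<And>a. a \<notin> {aX, aDeg, aS, aQ, aP} \<Longrightarrow> arrs s3 a = (\<lambda>_. 0)"
            using z2 by (simp_all add: fr3)
          have ld3: "loaded x n m s3" using ld2 by (simp add: loaded_def fr3)
          have t3: "Suc t3 \<le> t + 120 * (?L + 1)" using 3(1) t2 mL by simp
          show ?case
          proof (cases ?tree)
            case False
            then have "\<not> valid" by (simp add: valid_def)
            then show ?thesis using False 3(3) z3(1) t3 by (simp add: R_def)
          next
            case True
            then have valid using wf by (simp add: valid_def)
            have d: "describes x n m I" using inst[OF \<open>valid\<close>] .
            let ?Q = "arrs s3 aQ" and ?P = "arrs s3 aP" and ?S = "arrs s3 aS"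
            have el: "elimination m (input_edges x n m) ?Q ?P (m - 1)"
              and ptr: "edge_pointers x n ?Q ?P ?S m"
              using 3(4)[OF True] by auto
            have "clique_tree I m ?Q ?P (m - 1) n"
              using el d unfolding clique_tree_def clique_tree_axioms_def describes_def by simp
            then interpret ct: clique_tree I m ?Q ?P "m - 1" n .
            \<comment> \<open>The program finds capacity and cost through the position of an edge,
              the abstract cost through its end points; \<open>edge_pointers\<close> reconciles the
              two.\<close>
            have gc: "ct.gc (?Q h) k = edge_cost_fun n (x (?S (?Q h) + 2)) (x (?S (?Q h) + 3)) k"
              if h: "h < m - 1" for h k
            proof -
              obtain e where e: "e < m - 1" "?S (?Q h) = edge_ptr n m e"
                "ends x (?S (?Q h)) = {?Q h, ?P (?Q h)}"
                using ptr h by (auto simp: edge_pointers_def)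
              then have "edge_cap I {?Q h, ?P (?Q h)} = x (?S (?Q h) + 2)"
                "edge_cost I {?Q h, ?P (?Q h)} = x (?S (?Q h) + 3)"
                using d unfolding describes_def by metis+
              then show ?thesis by (simp add: ct.gc_def edge_cost_fun_def)
            qed
            have ok3: "vars s3 vok = 1" using 3(3) True by simp
            have "wp init_tables (wp merge R) s3 (Suc t3)"
            proof (rule wp_init_tables[OF ld3], goal_cases)
              case (1 s4 t4)
              note fr4 = frameD[OF 1(2)]
              have nd: "node_cost_fun x n u k = ct.nd u k" if "u < m" for u k
                using d that by (simp add: node_cost_fun_def ct.nd_def describes_def)
              have ld4: "loaded x n m s4" using ld3 by (simp add: loaded_def fr4)
              show ?case
              proof (rule ct.wp_merge[where x = x and S = ?S], goal_cases)
                case (11 s5 t5)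
                note fr5 = frameD[OF 11(2)]
                have "(m - 1) * (60 * (Suc n * Suc n) + 2) \<le> m * (60 * (Suc n * Suc n) + 2)"
                  by (intro mult_le_mono1) simp
                then have "t5 \<le> t + core_time ?L n m"
                  using 11(1) 1(1) t3 unfolding core_time_def by linarith
                moreover have "ct.tables_ready s5"
                  unfolding ct.tables_ready_def
                  using 11(3,4) 1(3) ld4 z3(2) by (simp add: fr5 fr4 loaded_def)
                ultimately show ?case
                  using \<open>valid\<close> ct.clique_tree_axioms by (auto simp: R_def)
              next
                case (9 u k)
                then show ?case using 1(4) nd by simp
              next
                case (10 h k)
                then show ?case using gc by blast
              qed (use ld4 1(3) in \<open>simp_all add: loaded_def fr4\<close>)
            qed
            then show ?thesis using ok3 by simp
          qed
        qed (use z2 in simp_all)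
        from this[unfolded wp_simps] show ?thesis using ok2 by (simp split del: if_split)
      qed
    qed (use s1 in simp_all)
  qed (use start entry_Nil in simp_all)
  then show ?thesis
    by (rule wp_mono[OF wp_frame]) (use bad good in \<open>auto simp: R_def\<close>)
qed

subsection \<open>Encodings\<close>

text \<open>Equality with a concatenated encoding is turned into conditions on single entries, the
  form in which the program tests its input.\<close>

lemma layout_iff:
  "xs = a # A @ b # B @ c # C \<longleftrightarrow> length xs = 3 + length A + length B + length C \<and>
     xs ! 0 = a \<and> (\<forall>i<length A. xs ! (1 + i) = A ! i) \<and> xs ! (1 + length A) = b \<and>
     (\<forall>i<length B. xs ! (2 + length A + i) = B ! i) \<and> xs ! (2 + length A + length B) = c \<and>
     (\<forall>i<length C. xs ! (3 + length A + length B + i) = C ! i)"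
  (is "xs = ?ys \<longleftrightarrow> ?R xs")
proof
  assume "xs = ?ys"
  then show "?R xs" by (simp add: nth_append nth_Cons numeral_2_eq_2 numeral_3_eq_3)
next
  assume R: "?R xs"
  show "xs = ?ys"
  proof (rule nth_equalityI)
    show "length xs = length ?ys" using R by simp
    fix i assume i: "i < length xs"
    have ys: "?R ?ys" by (simp add: nth_append nth_Cons numeral_2_eq_2 numeral_3_eq_3)
    consider "i = 0" | j where "i = 1 + j" "j < length A" | "i = 1 + length A"
      | j where "i = 2 + length A + j" "j < length B" | "i = 2 + length A + length B"
      | j where "i = 3 + length A + length B + j" "j < length C"
    proof -
      have "i = 0 \<or> (i = 1 + (i - 1) \<and> i - 1 < length A) \<or> i = 1 + length A \<or>
        (i = 2 + length A + (i - (2 + length A)) \<and> i - (2 + length A) < length B) \<or>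
        i = 2 + length A + length B \<or>
        (i = 3 + length A + length B + (i - (3 + length A + length B)) \<and>
          i - (3 + length A + length B) < length C)"
        using i R by linarith
      then show ?thesis using that by blast
    qed
    then show "xs ! i = ?ys ! i"
      by cases (use R ys in metis)+
  qed
qed

lemma length_concat_blocks:
  "(\<And>i. i < k \<Longrightarrow> length (f i) = c) \<Longrightarrow> length (concat (map f [0..<k])) = k * c"
  by (induction k) simp_all

lemma nth_concat_blocks:
  "(\<And>i. i < k \<Longrightarrow> length (f i) = c) \<Longrightarrow> p < k * c \<Longrightarrow>
    concat (map f [0..<k]) ! p = f (p div c) ! (p mod c)"
proof (induction k)
  case (Suc k)
  have len: "length (concat (map f [0..<k])) = k * c" using Suc.prems by (simp add: length_concat_blocks)
  show ?case
  proof (cases "p < k * c")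
    case True
    then show ?thesis using Suc len by (simp add: nth_append)
  next
    case False
    then obtain r where r: "p = k * c + r" "r < c" using Suc.prems(2)
      by (metis add.commute add_diff_inverse_nat mult_Suc nat_add_left_cancel_less)
    then have "p div c = k" "p mod c = r" by auto
    then show ?thesis using r len by (simp add: nth_append)
  qed
qed simp

lemma div_mod_less: "p < n * n \<Longrightarrow> p div n < n \<and> p mod n < (n::nat)"
  by (metis less_mult_imp_div_less mod_less_divisor mult_0_right neq0_conv not_less_zero)

lemma encodes_instance_iff:
  assumes sizes: "VR I = {..<n}" "VS I = {..<m}"
  shows "encodes_instance I xs \<longleftrightarrow> (\<exists>es. lists_edges es (ES I) \<and>
     xs = n # adjacency_matrix n (ER I) @
          m # concat (map (\<lambda>u. [node_cap I u, node_cost I u]) [0..<m]) @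
          length es # concat (map (\<lambda>(u, v). [u, v, edge_cap I {u, v}, edge_cost I {u, v}]) es))"
  using sizes unfolding encodes_instance_def by auto

definition edge_block :: "(nat, nat) uniVNE \<Rightarrow> nat \<times> nat \<Rightarrow> nat list" where
  "edge_block I = (\<lambda>(u, v). [u, v, edge_cap I {u, v}, edge_cost I {u, v}])"

text \<open>Both directions are used: from left to right to read an encoded instance off the array,
  from right to left to show that a reconstructed instance has the given encoding.\<close>

lemma instance_layout_iff:
  fixes es :: "(nat \<times> nat) list"
  shows "xs = n # adjacency_matrix n F @
      m # concat (map (\<lambda>u. [node_cap I u, node_cost I u]) [0..<m]) @
      length es # concat (map (edge_block I) es) \<longleftrightarrow>
    length xs = 3 + n * n + 2 * m + 4 * length es \<and> entry xs 0 = n \<and>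
    (\<forall>i<n. \<forall>j<n. entry xs (1 + i * n + j) = (if {i, j} \<in> F then 1 else 0)) \<and>
    entry xs (n * n + 1) = m \<and>
    (\<forall>u<m. entry xs (node_ptr n u) = node_cap I u \<and> entry xs (node_ptr n u + 1) = node_cost I u) \<and>
    entry xs (n * n + 2 + 2 * m) = length es \<and>
    (\<forall>e<length es. \<forall>r<4. entry xs (edge_ptr n m e + r) = edge_block I (es ! e) ! r)"
  (is "_ \<longleftrightarrow> ?R")
proof -
  define A where "A = adjacency_matrix n F"
  define B where "B = concat (map (\<lambda>u. [node_cap I u, node_cost I u]) [0..<m])"
  define C where "C = concat (map (\<lambda>e. edge_block I (es ! e)) [0..<length es])"
  have C': "concat (map (edge_block I) es) = C"
    unfolding C_def by (metis (no_types, lifting) map_nth map_map comp_apply map_cong)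
  have A: "length A = n * n" "\<And>p. p < n * n \<Longrightarrow> A ! p = (if {p div n, p mod n} \<in> F then 1 else 0)"
    unfolding A_def adjacency_matrix_def
    by (subst length_concat_blocks[where c = n], simp_all)
      (simp add: nth_concat_blocks[where c = n] div_mod_less)
  have B: "length B = m * 2" "\<And>p. p < m * 2 \<Longrightarrow>
      B ! p = [node_cap I (p div 2), node_cost I (p div 2)] ! (p mod 2)"
    unfolding B_def by (subst length_concat_blocks[where c = 2], simp_all)
      (subst nth_concat_blocks[where c = 2], simp_all)
  have len4: "length (edge_block I e) = 4" for e by (simp add: edge_block_def split: prod.split)
  have C: "length C = length es * 4" "\<And>p. p < length es * 4 \<Longrightarrow>
      C ! p = edge_block I (es ! (p div 4)) ! (p mod 4)"
    unfolding C_def by (subst length_concat_blocks[where c = 4], simp_all add: len4)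
      (subst nth_concat_blocks[where c = 4], simp_all add: len4)
  have qA: "(\<forall>p<n * n. f p = A ! p) \<longleftrightarrow> (\<forall>i<n. \<forall>j<n. f (i * n + j) = (if {i, j} \<in> F then 1 else 0))" for f
  proof (intro iffI allI impI)
    fix i j assume *: "\<forall>p<n * n. f p = A ! p" "i < n" "j < n"
    have "i * n + j < Suc i * n" using *(3) by simp
    also have "\<dots> \<le> n * n" using *(2) by (intro mult_le_mono1) simp
    finally show "f (i * n + j) = (if {i, j} \<in> F then 1 else 0)"
      using *(1,3) A(2)[of "i * n + j"] by simp
  next
    fix p assume *: "\<forall>i<n. \<forall>j<n. f (i * n + j) = (if {i, j} \<in> F then 1 else 0)" "p < n * n"
    then have "p div n < n" "p mod n < n" using div_mod_less by blast+
    then show "f p = A ! p" using *(1)[rule_format, of "p div n" "p mod n"] A(2)[OF *(2)] by simp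
  qed
  have qB: "(\<forall>p<m * 2. f p = B ! p) \<longleftrightarrow> (\<forall>u<m. f (2 * u) = node_cap I u \<and> f (2 * u + 1) = node_cost I u)" for f
  proof (intro iffI allI impI)
    fix u assume *: "\<forall>p<m * 2. f p = B ! p" "u < m"
    have "f (2 * u) = B ! (2 * u)" "f (2 * u + 1) = B ! (2 * u + 1)" using * by auto
    then show "f (2 * u) = node_cap I u \<and> f (2 * u + 1) = node_cost I u"
      using *(2) B(2)[of "2 * u"] B(2)[of "2 * u + 1"] by simp
  next
    fix p assume *: "\<forall>u<m. f (2 * u) = node_cap I u \<and> f (2 * u + 1) = node_cost I u" "p < m * 2"
    then have d: "p div 2 < m" by (simp add: less_mult_imp_div_less)
    have "p = 2 * (p div 2) \<and> p mod 2 = 0 \<or> p = 2 * (p div 2) + 1 \<and> p mod 2 = 1" by presburger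
    then show "f p = B ! p"
      using *(1)[rule_format, OF d] B(2)[OF *(2)] by (auto simp del: mult_2)
  qed
  have qC: "(\<forall>p<length es * 4. f p = C ! p) \<longleftrightarrow>
      (\<forall>e<length es. \<forall>r<4. f (4 * e + r) = edge_block I (es ! e) ! r)" for f
  proof (intro iffI allI impI)
    fix e r :: nat assume *: "\<forall>p<length es * 4. f p = C ! p" "e < length es" "r < 4"
    then have p: "4 * e + r < length es * 4" by linarith
    have "(4 * e + r) div 4 = e" "(4 * e + r) mod 4 = r" using *(3) by auto
    then show "f (4 * e + r) = edge_block I (es ! e) ! r" using *(1) p C(2)[OF p] by simp
  next
    fix p assume *: "\<forall>e<length es. \<forall>r<4. f (4 * e + r) = edge_block I (es ! e) ! r" "p < length es * 4"
    then have d: "p div 4 < length es" by (simp add: less_mult_imp_div_less)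
    have "f (4 * (p div 4) + p mod 4) = edge_block I (es ! (p div 4)) ! (p mod 4)"
      using *(1)[rule_format, OF d, of "p mod 4"] by simp
    then show "f p = C ! p" using C(2)[OF *(2)] by simp
  qed
  have "xs = n # A @ m # B @ length es # C \<longleftrightarrow> length xs = 3 + n * n + m * 2 + length es * 4 \<and>
     xs ! 0 = n \<and> (\<forall>i<n * n. xs ! (1 + i) = A ! i) \<and> xs ! (1 + n * n) = m \<and>
     (\<forall>i<m * 2. xs ! (2 + n * n + i) = B ! i) \<and> xs ! (2 + n * n + m * 2) = length es \<and>
     (\<forall>i<length es * 4. xs ! (3 + n * n + m * 2 + i) = C ! i)"
    unfolding layout_iff A(1) B(1) C(1) ..
  also have "\<dots> \<longleftrightarrow> length xs = 3 + n * n + m * 2 + length es * 4 \<and>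
     entry xs 0 = n \<and> (\<forall>i<n * n. entry xs (1 + i) = A ! i) \<and> entry xs (1 + n * n) = m \<and>
     (\<forall>i<m * 2. entry xs (2 + n * n + i) = B ! i) \<and> entry xs (2 + n * n + m * 2) = length es \<and>
     (\<forall>i<length es * 4. entry xs (3 + n * n + m * 2 + i) = C ! i)"
    by (rule conj_cong[OF refl]) (simp add: entry_def)
  also have "\<dots> \<longleftrightarrow> ?R"
    unfolding qA[of "\<lambda>i. entry xs (1 + i)"] qB[of "\<lambda>i. entry xs (2 + n * n + i)"]
      qC[of "\<lambda>i. entry xs (3 + n * n + m * 2 + i)"]
    by (simp add: node_ptr_def edge_ptr_def first_edge_def add_ac mult.commute)
  finally show ?thesis unfolding A_def B_def C' .
qed

lemma describes_encoded:
  assumes inst: "uniVNE_instance I" and clique: "is_clique (VR I) (ER I)"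
    and tree: "is_tree (VS I) (ES I)" and enc: "encodes_instance I xs"
  defines "x \<equiv> entry xs"
  defines "n \<equiv> x 0"
  defines "m \<equiv> x (n * n + 1)"
  shows "well_formed x (length xs) n m" "describes x n m I" "card (VR I) = n" "card (VS I) = m"
proof -
  obtain n' m' es where sizes: "VR I = {..<n'}" "VS I = {..<m'}" and es: "lists_edges es (ES I)"
    and xs: "xs = n' # adjacency_matrix n' (ER I) @
      m' # concat (map (\<lambda>u. [node_cap I u, node_cost I u]) [0..<m']) @
      length es # concat (map (edge_block I) es)"
    using enc unfolding encodes_instance_def edge_block_def by blast
  note lay = instance_layout_iff[THEN iffD1, OF xs, folded x_def]
  have nm: "n' = n" "m' = m" using lay by (auto simp: n_def m_def)
  note lay = lay[unfolded nm] and sizes = sizes[unfolded nm]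
  have n: "n \<noteq> 0" "m \<noteq> 0"
    using inst sizes by (auto simp: uniVNE_instance_def graph_connected_def)
  have tree': "is_tree {..<m} (ES I)" using tree sizes by simp
  have sg: "simple_graph {..<m} (ES I)" using tree' by (simp add: is_tree_def)
  \<comment> \<open>The edge count of a tree, obtained by interpreting a complete elimination; it
    ties the length of the input to \<open>n\<close> and \<open>m\<close>.\<close>
  have card: "length es = m - 1"
  proof -
    obtain Q par where "leaf_seq {..<m} (ES I) Q par (m - 1)"
      using leaf_seq_ex[OF tree', of "m - 1"] n(2) by auto
    then interpret elimination m "ES I" Q par "m - 1"
      using sg n(2) by unfold_locales auto
    have "card (set (map edge_pair es)) = length es"
      using es distinct_card[of "map edge_pair es"] by (simp add: lists_edges_def)
    then show ?thesis using card_edges es by (simp add: lists_edges_def)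
  qed
  have blk: "x (edge_ptr n m e) = fst (es ! e)" "x (edge_ptr n m e + 1) = snd (es ! e)"
    "x (edge_ptr n m e + 2) = edge_cap I (edge_pair (es ! e))"
    "x (edge_ptr n m e + 3) = edge_cost I (edge_pair (es ! e))" if e: "e < m - 1" for e
  proof -
    have "x (edge_ptr n m e + r) = edge_block I (es ! e) ! r" if "r < 4" for r
      using lay e card that by simp
    from this[of 0] this[of 1] this[of 2] this[of 3]
    show "x (edge_ptr n m e) = fst (es ! e)" "x (edge_ptr n m e + 1) = snd (es ! e)"
      "x (edge_ptr n m e + 2) = edge_cap I (edge_pair (es ! e))"
      "x (edge_ptr n m e + 3) = edge_cost I (edge_pair (es ! e))"
      by (simp_all add: edge_block_def edge_pair_def split: prod.splits)
  qed
  have pair: "edge_pair (es ! e) = ends x (edge_ptr n m e)" if "e < m - 1" for e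
    using blk[OF that] by (simp add: ends_def edge_pair_def split: prod.splits)
  have E: "ES I = input_edges x n m"
  proof -
    have "set es = (!) es ` {..<m - 1}"
      using card by (metis lessThan_atLeast0 list.set_map map_nth set_upt)
    then have "ES I = (\<lambda>e. edge_pair (es ! e)) ` {..<m - 1}"
      using es unfolding lists_edges_def by (metis image_image)
    then show ?thesis using pair unfolding input_edges_def by auto
  qed
  have edge_in: "ends x (edge_ptr n m e) \<in> ES I" if "e < m - 1" for e
    using that E by (auto simp: input_edges_def)
  have cl: "is_clique {..<n} (ER I)" using clique sizes by simp
  show "describes x n m I"
    unfolding describes_def using sizes E cl lay blk pair by simp
  have "matrix_entry_ok x n i j" if "i < n" "j < n" for i j
  proof -
    have "{i, j} \<in> ER I \<longleftrightarrow> i \<noteq> j"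
      using cl that unfolding is_clique_def simple_graph_def
      by (metis card_1_singleton_iff insert_absorb2 lessThan_iff numeral_eq_one_iff semiring_norm(85)
        One_nat_def)
    then show ?thesis using lay that by (simp add: matrix_entry_ok_def)
  qed
  moreover have "node_ok x n u" if "u < m" for u
    using inst sizes lay that by (auto simp: uniVNE_instance_def node_ok_def node_ptr_def)
  moreover have "edge_ok x n m e" if e: "e < m - 1" for e
  proof -
    let ?p = "edge_ptr n m e"
    have "ends x ?p \<in> ES I" using edge_in[OF e] .
    then have "x ?p < m" "x (?p + 1) < m" "x ?p \<noteq> x (?p + 1)"
      using simple_graphD[OF sg, of "x ?p" "x (?p + 1)"] by (auto simp: ends_def)
    moreover have "x (?p + 2) \<noteq> 0"
      using inst edge_in[OF e] blk(3)[OF e] pair[OF e] by (auto simp: uniVNE_instance_def)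
    ultimately show ?thesis by (simp add: edge_ok_def edge_ptr_def Let_def)
  qed
  moreover have "instance_size_ok x (length xs) n m"
    using lay n card by (simp add: instance_size_ok_def)
  ultimately show "well_formed x (length xs) n m" by (simp add: well_formed_def)
  show "card (VR I) = n" "card (VS I) = m" using sizes by simp_all
qed

text \<open>Capacities and costs are functions of an edge, but the input lists them by position;
  \<open>inv_into\<close> recovers the position, which is unique for a tree.\<close>

definition decoded_instance :: "(nat \<Rightarrow> nat) \<Rightarrow> nat \<Rightarrow> nat \<Rightarrow> (nat, nat) uniVNE" where
  "decoded_instance x n m = (let ptr = \<lambda>e. edge_ptr n m
       (inv_into {..<m - 1} (\<lambda>e. ends x (edge_ptr n m e)) e) in
     \<lparr>VR = {..<n}, ER = {{a, b} | a b. a < n \<and> b < n \<and> a \<noteq> b}, VS = {..<m}, ES = input_edges x n m,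
      node_cap = (\<lambda>u. x (node_ptr n u)), edge_cap = (\<lambda>e. x (ptr e + 2)),
      node_cost = (\<lambda>u. x (node_ptr n u + 1)), edge_cost = (\<lambda>e. x (ptr e + 3))\<rparr>)"

text \<open>The converse of \<open>describes_encoded\<close>: whatever passes the tests does encode
  an instance, so no sequence outside the language can be accepted.\<close>

lemma decoded_instance:
  assumes wf: "well_formed (entry xs) (length xs) n m"
    and tree: "is_tree {..<m} (input_edges (entry xs) n m)"
  defines "I \<equiv> decoded_instance (entry xs) n m"
  shows "uniVNE_instance I" "is_clique (VR I) (ER I)" "is_tree (VS I) (ES I)" "encodes_instance I xs"
proof -
  let ?x = "entry xs"
  let ?e = "\<lambda>e. ends ?x (edge_ptr n m e)"
  have inj: "inj_on ?e {..<m - 1}" by (rule input_edges_inj[OF wf tree])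
  have I: "VR I = {..<n}" "ER I = {{a, b} | a b. a < n \<and> b < n \<and> a \<noteq> b}" "VS I = {..<m}"
    "ES I = input_edges ?x n m" "\<And>u. node_cap I u = ?x (node_ptr n u)"
    "\<And>u. node_cost I u = ?x (node_ptr n u + 1)"
    by (simp_all add: I_def decoded_instance_def Let_def)
  have cost: "edge_cap I (?e e) = ?x (edge_ptr n m e + 2)" "edge_cost I (?e e) = ?x (edge_ptr n m e + 3)"
    if "e < m - 1" for e
    using inv_into_f_f[OF inj, of e] that by (simp_all add: I_def decoded_instance_def Let_def)
  have n: "0 < n" "0 < m" using well_formed_size(2,3)[OF wf] by simp_all
  have cl: "is_clique {..<n} (ER I)"
    unfolding is_clique_def simple_graph_def I(2) by auto
  then show "is_clique (VR I) (ER I)" by (simp add: I)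
  show "is_tree (VS I) (ES I)" using tree by (simp add: I)
  have "graph_connected {..<n} (ER I)"
    unfolding graph_connected_def
  proof (intro conjI ballI)
    show "{..<n} \<noteq> {}" using n by auto
    fix u v assume uv: "u \<in> {..<n}" "v \<in> {..<n}"
    show "\<exists>p. is_path {..<n} (ER I) p \<and> hd p = u \<and> last p = v"
    proof (cases "u = v")
      case True
      then show ?thesis using uv by (intro exI[of _ "[u]"]) (simp add: is_path_def)
    next
      case False
      then have "{u, v} \<in> ER I" using uv by (auto simp: I)
      then show ?thesis using uv False by (intro exI[of _ "[u, v]"]) (simp add: is_path_def)
    qed
  qed
  moreover have "0 < edge_cap I e" if "e \<in> ES I" for e
    using that cost(1) well_formed_edge(4)[OF wf] by (auto simp: I input_edges_def)
  moreover have "0 < node_cap I u" if "u < m" for u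
    using wf that by (auto simp: well_formed_def node_ok_def I node_ptr_def)
  ultimately show "uniVNE_instance I"
    using cl tree by (simp add: uniVNE_instance_def I is_clique_def is_tree_def)
  define es where "es = map (\<lambda>e. (?x (edge_ptr n m e), ?x (edge_ptr n m e + 1))) [0..<m - 1]"
  have pairs: "map edge_pair es = map ?e [0..<m - 1]"
    by (simp add: es_def edge_pair_def ends_def)
  have es: "lists_edges es (ES I)"
  proof -
    have "distinct (map edge_pair es)"
      unfolding pairs using inj by (simp add: distinct_map lessThan_atLeast0)
    moreover have "edge_pair ` set es = set (map edge_pair es)" by simp
    then have "edge_pair ` set es = ES I"
      unfolding pairs by (simp add: I input_edges_def lessThan_atLeast0)
    ultimately show ?thesis by (simp add: lists_edges_def)
  qed
  have size: "instance_size_ok ?x (length xs) n m" using wf by (simp add: well_formed_def)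
  have "xs = n # adjacency_matrix n (ER I) @
      m # concat (map (\<lambda>u. [node_cap I u, node_cost I u]) [0..<m]) @
      length es # concat (map (edge_block I) es)"
    unfolding instance_layout_iff
  proof (intro conjI allI impI)
    show "length xs = 3 + n * n + 2 * m + 4 * length es"
      using size n by (auto simp: instance_size_ok_def es_def)
    show "?x 0 = n" "?x (n * n + 1) = m" "?x (n * n + 2 + 2 * m) = length es"
      using size by (auto simp: instance_size_ok_def es_def)
    fix i j assume ij: "i < n" "j < n"
    have "{i, j} \<in> ER I \<longleftrightarrow> i \<noteq> j" using ij by (auto simp: I doubleton_eq_iff)
    then show "?x (1 + i * n + j) = (if {i, j} \<in> ER I then 1 else 0)"
      using wf ij by (simp add: well_formed_def matrix_entry_ok_def)
  next
    fix e r :: nat assume e: "e < length es" and r: "r < 4"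
    then have e': "e < m - 1" by (simp add: es_def)
    have "r = 0 \<or> r = 1 \<or> r = 2 \<or> r = 3" using r by linarith
    then show "?x (edge_ptr n m e + r) = edge_block I (es ! e) ! r"
      using e' cost[OF e'] by (auto simp: es_def edge_block_def ends_def)
  qed (simp_all add: I)
  then show "encodes_instance I xs"
    using es unfolding encodes_instance_iff[OF I(1,3)] edge_block_def by blast
qed

subsection \<open>Correctness and running time\<close>

text \<open>The last \<open>K m\<close> nodes go to \<open>m\<close>, the others are placed
  inductively. Needed for the decision problem, where the program computes a cost without producing
  a placement.\<close>

lemma fibres_ex:
  fixes m :: nat
  assumes "sum K {..<m} = n"
  shows "\<exists>f. (\<forall>a<n. f a < m) \<and> (\<forall>u<m. card {a \<in> {..<n}. f a = u} = (K u :: nat))"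
  using assms
proof (induction m arbitrary: n)
  case (Suc m)
  let ?l = "sum K {..<m}"
  obtain f where f: "\<And>a. a < ?l \<Longrightarrow> f a < m" "\<And>u. u < m \<Longrightarrow> card {a \<in> {..<?l}. f a = u} = K u"
    using Suc.IH by blast
  define g where "g a = (if a < ?l then f a else m)" for a
  have n: "n = ?l + K m" using Suc.prems by simp
  have "g a < Suc m" for a using f(1) by (auto simp: g_def less_Suc_eq)
  moreover have "card {a \<in> {..<n}. g a = u} = K u" if "u < Suc m" for u
  proof (cases "u = m")
    case True
    have g: "g a = m \<longleftrightarrow> \<not> a < ?l" for a using f(1)[of a] by (auto simp: g_def)
    have "{a \<in> {..<n}. g a = u} = {?l..<n}"
      by (rule set_eqI) (simp add: True g not_less conj_commute)
    then show ?thesis using True n by simp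
  next
    case False
    then have "a < n \<and> g a = u \<longleftrightarrow> a < ?l \<and> f a = u" for a
      unfolding g_def n by (cases "a < ?l") simp_all
    then have "{a \<in> {..<n}. g a = u} = {a \<in> {..<?l}. f a = u}" by simp
    then show ?thesis using False f(2) that by simp
  qed
  ultimately show ?case by blast
qed simp

context clique_tree
begin

text \<open>\<open>vbest\<close> holds the minimum cost plus one, or 0 if there is no feasible
  mapping; hence the comparison with \<open>c + 1\<close>.\<close>

lemma feasible_cost_iff:
  assumes ready: "tables_ready s"
  shows "(\<exists>f. feasible I f \<and> mapping_cost I f \<le> c) \<longleftrightarrow> vars s vbest \<noteq> 0 \<and> vars s vbest \<le> c + 1"
proof -
  let ?ch = "\<lambda>v k. arrs s aC (v * Suc n + k)"
  have ch: "optimal_choice ?ch" and D: "D H 0 n = decode (vars s vbest)"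
    using ready by (simp_all add: tables_ready_def)
  have "vars s vbest \<noteq> 0 \<and> vars s vbest \<le> c + 1 \<longleftrightarrow> D H 0 n \<le> enat c"
    unfolding D by (auto simp: decode_def)
  also have "\<dots> \<longleftrightarrow> (\<exists>f. feasible I f \<and> mapping_cost I f \<le> c)"
  proof
    assume le: "D H 0 n \<le> enat c"
    obtain f where f: "\<And>a. a < n \<Longrightarrow> f a < m" "\<And>u. u < m \<Longrightarrow> load f u = alloc ?ch H u"
      using fibres_ex[OF total_alloc(1)[OF ch]] unfolding load_def by blast
    have "D H 0 n \<noteq> \<infinity>" using le by (cases "D H 0 n") simp_all
    from min_cost_feasible_alloc[OF ch f this] le
    show "\<exists>f. feasible I f \<and> mapping_cost I f \<le> c" by (auto simp: min_cost_feasible_def)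
  next
    assume "\<exists>f. feasible I f \<and> mapping_cost I f \<le> c"
    then obtain f p where f: "feasible I (f, p)" "mapping_cost I (f, p) \<le> c" by auto
    then show "D H 0 n \<le> enat c"
      using D_le_mapping_cost[OF f(1)] by (meson enat_ord_simps(1) order_trans)
  qed
  finally show ?thesis ..
qed

end

lemma wpD: "wp c Q s 0 \<Longrightarrow> \<exists>t s'. big c s t s' \<and> Q s' t"
  unfolding wp_def by auto

text \<open>As \<open>n\<close> and \<open>m\<close> are positive, each of \<open>1\<close>,
  \<open>m\<close> and \<open>n * n\<close> is at most \<open>n * n * m\<close>, and the length of
  the input is linear in the latter two. The collected coefficients sum to 1110.\<close>

lemma core_time_le:
  assumes "well_formed x L n m"
  shows "core_time L n m \<le> 2000 * (n\<^sup>2 * m)"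
proof -
  note sz = well_formed_size[OF assms]
  define q where "q = n * n"
  have n: "n \<le> q" "1 \<le> q" using sz(2) by (auto simp: q_def)
  have q: "q * m = n\<^sup>2 * m" by (simp add: q_def power2_eq_square)
  have "Suc n * Suc n = q + 2 * n + 1" by (simp add: q_def)
  then have "core_time L n m = 120 * q + 720 * m + 7 + m * (6 * n + 15) + m * (60 * q + 120 * n + 62)"
    unfolding core_time_def sz(4) q_def[symmetric] by (simp add: algebra_simps)
  also have "\<dots> \<le> 120 * (q * m) + 720 * (q * m) + 7 * (q * m) + 21 * (q * m) + 242 * (q * m)"
  proof -
    have le: "120 * q + 720 * m + 7 + a + b \<le> 120 * r + 720 * r + 7 * r + 21 * r + 242 * r"
      if "q \<le> r" "m \<le> r" "1 \<le> r" "a \<le> r * 21" "b \<le> r * 242" for a b r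
      using that by simp
    have "m * (6 * n + 15) \<le> m * (q * 21)" "m * (60 * q + 120 * n + 62) \<le> m * (q * 242)"
      using n by (intro mult_le_mono2; simp)+
    then have "m * (6 * n + 15) \<le> q * m * 21" "m * (60 * q + 120 * n + 62) \<le> q * m * 242"
      by (simp_all only: mult.assoc[symmetric] mult.commute[of m q])
    then show ?thesis using sz(3) n(2) by (intro le) simp_all
  qed
  also have "\<dots> \<le> 2000 * (q * m)" by simp
  finally show ?thesis unfolding q .
qed

lemma decide_correct:
  "\<exists>t s. big decide (init xs) t s \<and>
    outputs s = [if xs \<in> C_uniVNE is_clique is_tree then 1 else 0] \<and> t \<le> 3000 * (length xs + 1)\<^sup>2"
proof (rule wpD)
  define G where "G = (case xs of [] \<Rightarrow> 0 | y # _ \<Rightarrow> y)"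
  define ys where "ys = tl xs"
  define x where "x = entry ys"
  define n where "n = x 0"
  define m where "m = x (n * n + 1)"
  let ?yes = "xs \<in> C_uniVNE is_clique is_tree"
  let ?valid = "well_formed x (length ys) n m \<and> is_tree {..<m} (input_edges x n m)"
  define good where "good I \<longleftrightarrow> uniVNE_instance I \<and> is_clique (VR I) (ER I) \<and>
    is_tree (VS I) (ES I) \<and> encodes_instance I ys" for I
  have desc: "well_formed x (length ys) n m \<and> describes x n m I \<and> ?valid" if "good I" for I
  proof -
    have "well_formed x (length ys) n m" "describes x n m I"
      using describes_encoded[of I ys] that by (auto simp: good_def x_def n_def m_def)
    then show ?thesis using that by (simp add: good_def describes_def)
  qed
  \<comment> \<open>On empty input the budget would be read as 0 and the rest would be empty as
    well; a valid rest is nonempty, which excludes this case.\<close>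
  have xs: "xs = G # ys" if ?valid
  proof -
    have "ys \<noteq> []" using that well_formed_size(4)[of x "length ys" n m]
        well_formed_size(3)[of x "length ys" n m] by auto
    then show ?thesis by (cases xs) (auto simp: G_def ys_def)
  qed
  have yes: "?yes \<longleftrightarrow> xs = G # ys \<and> (\<exists>I. good I \<and> (\<exists>f. feasible I f \<and> mapping_cost I f \<le> G))"
    unfolding C_uniVNE_def good_def by (cases xs) (auto simp: G_def ys_def)
  \<comment> \<open>The run is analysed for one fixed instance, although several may share an
    encoding: the witness of membership if there is one, and the reconstructed instance otherwise.
    For this choice, membership is equivalent to the existence of a cheap mapping for
    \<open>I\<close>.\<close>
  have "\<exists>I. ?valid \<longrightarrow> good I \<and> (?yes \<longrightarrow> (\<exists>f. feasible I f \<and> mapping_cost I f \<le> G))"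
  proof (cases ?yes)
    case True
    then show ?thesis using yes by blast
  next
    case False
    show ?thesis using decoded_instance[of ys n m] by (auto simp: good_def x_def False)
  qed
  then obtain I where I: "?valid \<Longrightarrow> good I"
    "?valid \<Longrightarrow> ?yes \<Longrightarrow> \<exists>f. feasible I f \<and> mapping_cost I f \<le> G"
    by blast
  have time: "4 + core_time (length ys) n m \<le> 3000 * (length xs + 1)\<^sup>2"
    if wf: "well_formed x (length ys) n m"
  proof -
    note sz = well_formed_size[OF wf]
    \<comment> \<open>Each of the factors \<open>n * n\<close> and \<open>m\<close> is bounded by
      the length separately, so their product is quadratic in it.\<close>
    have "n\<^sup>2 \<le> length xs + 1" "m \<le> length xs + 1"
      using sz(4) by (simp_all add: ys_def power2_eq_square)
    then have "n\<^sup>2 * m \<le> (length xs + 1)\<^sup>2"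
      unfolding power2_eq_square[of "length xs + 1"] by (rule mult_le_mono)
    moreover have "1 \<le> (length xs + 1)\<^sup>2" by simp
    ultimately show ?thesis using core_time_le[OF wf] by linarith
  qed
  have time0: "3 + 120 * (length ys + 1) \<le> 3000 * (length xs + 1)\<^sup>2"
  proof -
    have "length ys + 1 \<le> (length xs + 1) * (length xs + 1)" by (simp add: ys_def)
    then show ?thesis by (simp add: power2_eq_square)
  qed
  define s0 where "s0 = (set_var vG G (init xs))\<lparr>inputs := ys\<rparr>"
  have s0: "vars s0 vL = 0" "vars s0 vbest = 0" "arrs s0 = (\<lambda>_ _. 0)" "inputs s0 = ys"
    "vars s0 vG = G" "outputs s0 = []"
    by (simp_all add: s0_def init_def)
  let ?goal = "\<lambda>s t. outputs s = [if ?yes then 1 else 0] \<and> t \<le> 3000 * (length xs + 1)\<^sup>2"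
  have "wp core (wp (If (V vbest) (If (lt (Plus (V vG) (N 1)) (V vbest)) (Output (N 0)) (Output (N 1)))
      (Output (N 0))) ?goal) s0 (Suc 0)"
  proof (rule wp_core[where I = I and xs = ys, folded x_def, folded n_def, folded m_def], goal_cases)
    case 5
    then show ?case using desc I(1) by blast
  next
    case (6 s t)
    have "\<not> ?yes" using 6(3) yes desc by blast
    then show ?case using 6 time0 s0 by (simp add: frameD)
  next
    case (7 s t order par)
    interpret clique_tree I m order par "m - 1" n by (rule 7(4))
    have "?yes \<longleftrightarrow> (\<exists>f. feasible I f \<and> mapping_cost I f \<le> G)"
      using yes xs[OF 7(3)] I[OF 7(3)] by blast
    then have "?yes \<longleftrightarrow> vars s vbest \<noteq> 0 \<and> vars s vbest \<le> G + 1"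
      using feasible_cost_iff[OF 7(5)] by simp
    moreover have "vars s vG = G" "outputs s = []"
      using frameD[OF 7(2)] s0 by simp_all
    moreover have "t + 3 \<le> 3000 * (length xs + 1)\<^sup>2"
      using 7(1,3) time by linarith
    ultimately show ?case by auto
  qed (use s0 in simp_all)
  then show "wp decide ?goal (init xs) 0"
    unfolding decide_def by (simp add: s0_def G_def ys_def init_def split del: if_split)
qed

lemma solve_correct:
  assumes inst: "uniVNE_instance I" "is_clique (VR I) (ER I)" "is_tree (VS I) (ES I)"
    "encodes_instance I xs"
  shows "\<exists>t s. big solve (init xs) t s \<and> is_solution I (outputs s) \<and>
    t \<le> 3000 * ((card (VR I))\<^sup>2 * card (VS I))"
proof (rule wpD)
  define x where "x = entry xs"
  define n where "n = x 0"
  define m where "m = x (n * n + 1)"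
  note desc = describes_encoded[OF inst, folded x_def, folded n_def, folded m_def]
  have tree: "is_tree {..<m} (input_edges x n m)"
    using inst(3) desc(2) by (simp add: describes_def)
  let ?goal = "\<lambda>s t. is_solution I (outputs s) \<and> t \<le> 3000 * ((card (VR I))\<^sup>2 * card (VS I))"
  have s0: "vars (init xs) vL = 0" "vars (init xs) vbest = 0" "arrs (init xs) = (\<lambda>_ _. 0)"
    "inputs (init xs) = xs" "outputs (init xs) = []"
    by (simp_all add: init_def)
  note sz = well_formed_size[OF desc(1)]
  have nm: "1 \<le> n\<^sup>2 * m" using sz(2,3) by (simp add: power2_eq_square)
  have "wp core (wp (If (V vbest) output_mapping (Output (N 0))) ?goal) (init xs) 0"
  proof (rule wp_core[where I = I and xs = xs, folded x_def, folded n_def, folded m_def], goal_cases)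
    case 5
    then show ?case using desc by blast
  next
    case (6 s t)
    then show ?case using desc tree by blast
  next
    case (7 s t order par)
    interpret clique_tree I m order par "m - 1" n by (rule 7(4))
    have out: "outputs s = []" using frameD(3)[OF 7(2)] s0 by simp
    have t: "t \<le> 2000 * (n\<^sup>2 * m)" using 7(1) core_time_le[OF desc(1)] by simp
    show ?case
    proof (cases "vars s vbest = 0")
      case True
      have "\<not> (\<exists>f. feasible I f)"
        using feasible_cost_iff[OF 7(5)] True by blast
      then have "is_solution I [0]" by (simp add: is_solution_def)
      moreover have "t + 2 \<le> 3000 * (n\<^sup>2 * m)" using t nm by linarith
      ultimately show ?thesis using True out desc(3,4) by simp
    next
      case False
      have "wp output_mapping ?goal s (Suc t)"
      proof (rule wp_output_mapping[OF 7(5) False], goal_cases)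
        case (1 s' t' f zs)
        have "9 + (m - 1) * 8 + m * (n * 5 + 5) + n * (4 + n * (16 + 12 * (m - 1))) \<le> 60 * (n\<^sup>2 * m)"
        proof -
          define q where "q = n * n"
          have q: "n \<le> q" "1 \<le> q" using sz(2) by (auto simp: q_def)
          have qm: "q \<le> q * m" "m \<le> q * m" "1 \<le> q * m" using sz(3) q(2) by simp_all
          have "m * (n * 5 + 5) \<le> m * (10 * q)" using q by (intro mult_le_mono2) simp
          moreover have "n * (4 + n * (16 + 12 * (m - 1))) = 4 * n + 16 * q + 12 * (q * (m - 1))"
            by (simp add: q_def algebra_simps)
          moreover have "q * (m - 1) \<le> q * m" by simp
          moreover have "(m - 1) * 8 \<le> 8 * m" by simp
          moreover have "n\<^sup>2 * m = q * m" by (simp add: q_def power2_eq_square)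
          moreover have "m * (10 * q) = 10 * (q * m)" by simp
          ultimately show ?thesis using q(1) qm by linarith
        qed
        then have "t' \<le> 3000 * (n\<^sup>2 * m)" using 1(1) t nm by linarith
        moreover have "is_solution I (1 # zs)"
          using 1(2,3) unfolding is_solution_def min_cost_feasible_def
          by (auto simp del: split_paired_Ex split_paired_All)
        ultimately show ?case using 1(4) out desc(3,4) by simp
      qed
      then show ?thesis using False by simp
    qed
  qed (use s0 in simp_all)
  then show "wp solve ?goal (init xs) 0"
    unfolding solve_def by (simp split del: if_split)
qed

theorem theorem9:
  shows "C_uniVNE is_clique is_tree \<in> class_P \<and>
    (\<exists>P (C :: nat). \<forall>I xs.
       uniVNE_instance I \<and> is_clique (VR I) (ER I) \<and> is_tree (VS I) (ES I) \<and>
       encodes_instance I xs \<longrightarrow>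
       (\<exists>t ys. t \<le> C * ((card (VR I))\<^sup>2 * card (VS I)) \<and>
               computes_within P xs t ys \<and> is_solution I ys))"
proof (intro conjI)
  show "C_uniVNE is_clique is_tree \<in> class_P"
    by (rule class_P_I[where c = decide]) (simp, rule decide_correct)
  show "\<exists>P (C :: nat). \<forall>I xs.
       uniVNE_instance I \<and> is_clique (VR I) (ER I) \<and> is_tree (VS I) (ES I) \<and>
       encodes_instance I xs \<longrightarrow>
       (\<exists>t ys. t \<le> C * ((card (VR I))\<^sup>2 * card (VS I)) \<and>
               computes_within P xs t ys \<and> is_solution I ys)"
  proof (rule exI[of _ "compile 0 solve"], rule exI[of _ "unit_cost solve * 3000"], intro allI impI)
    fix I :: "(nat, nat) uniVNE" and xs :: "nat list"
    assume *: "uniVNE_instance I \<and> is_clique (VR I) (ER I) \<and> is_tree (VS I) (ES I) \<and>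
      encodes_instance I xs"
    let ?T = "unit_cost solve * 3000 * ((card (VR I))\<^sup>2 * card (VS I))"
    obtain t s where s: "big solve (init xs) t s" "is_solution I (outputs s)"
      "t \<le> 3000 * ((card (VR I))\<^sup>2 * card (VS I))"
      using solve_correct[of I xs] * by blast
    have "unit_cost solve * t \<le> ?T"
      unfolding mult.assoc using s(3) by (rule mult_le_mono2)
    from computes_within_compile[OF s(1) _ this] s(2)
    show "\<exists>t ys. t \<le> ?T \<and> computes_within (compile 0 solve) xs t ys \<and> is_solution I ys"
      by auto
  qed
qed

end
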